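(* Let $(\Omega,\mathbf P)$, $\Gamma_\omega$ and $\alpha(\omega)=\{\alpha_\gamma(\omega)\}_{\gamma\in\Gamma_\omega}$ satisfy conditions (i)–(vi) listed in the context, and let $H_\omega$ be the Friedrichs extension of $\left(\frac1i\nabla-\mathbf a_\omega\right)^2$ on $C_0^\infty(\mathbb R^2\setminus\Gamma_\omega)$, where $\operatorname{curl}\mathbf a_\omega=\sum_{\gamma\in\Gamma_\omega}2\pi\alpha_\gamma(\omega)\delta_\gamma$. Then $\sigma(H_\omega)=[0,\infty)$ almost surely.
   Context: Notation. For $k\ge 0$, $Q_k=\{(x_1,x_2)\in\mathbb R^2: -k-\frac12\le x_j<k+\frac12,\ j=1,2\}$; $B_x(r)=\{y\in\mathbb R^2:|y-x|<r\}$; $S+x=\{s+x: s\in S\}$; $\partial S$ is the boundary of $S$. $\mathbb R^2$ is identified with $\mathbb C$ via $z=x_1+ix_2$. Random data. $(\Omega,\mathbf P)$ is a probability space; for each $\omega\in\Omega$, $\Gamma_\omega\subset\mathbb R^2$ is a discrete set without accumulation points in $\mathbb R^2$, and $\alpha(\omega)=\{\alpha_\gamma(\omega)\}_{\gamma\in\Gamma_\omega}$ is a sequence of real numbers with $0\le\alpha_\gamma(\omega)<1$. For a Borel set $E\subset\mathbb R^2$ put $\Phi_\omega(E)=\sum_{\gamma\in\Gamma_\omega\cap E}\alpha_\gamma(\omega)$, and let $\Phi(E)$ denote the map $\omega\mapsto\Phi_\omega(E)$. The conditions are: (i) For any Borel set $E\subset\mathbb R^2$, $\Phi(E)$ is measurable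 in $\omega$. (ii) For any finitely many distinct points $n_1,\dots,n_J\in\mathbb Z^2$ and any Borel sets $E_1,\dots,E_J$ with $E_j\subset n_j+Q_0$, the random variables $\{\Phi(E_j)\}_{j=1}^J$ are independent. (iii) For any Borel set $E\subset Q_0$, the random variables $\{\Phi(E+n)\}_{n\in\mathbb Z^2}$ are identically distributed. (iv) The expectation $\mathbf E[\Phi(Q_0)]$ is positive and finite, and the variance $\mathbf V[\Phi(Q_0)]$ is finite. (v) $\Phi_\omega(\partial Q_0)=0$ almost surely. (vi) One of the following (a) or (b) holds. (a) There is a constant $c$ with $0<c\le1$, independent of $\omega$, such that for every $\epsilon>0$ the following event has positive probability: $\Phi_\omega(Q_0)<\epsilon$ and, for all $\gamma,\gamma'\in\Gamma_\omega\cap Q_0$ with $\gamma\ne\gamma'$, $B_\gamma(c\sqrt{\alpha_\gamma})\cap B_{\gamma'}(c\sqrt{\alpha_{\gamma'}})=\emptyset$ and $B_\gamma(c\sqrt{\alpha_\gamma})\cap\partial Q_0=\emptyset$. (b) For every $\epsilon>0$ the event $\sum_{\gamma\in\Gamma_\omega\cap Q_0}\sqrt{\alpha_\gamma}<\epsilon$ has positive probability. Operator. Let $\phi_\omega$ be a meromorphic function on $\mathbb C$ with poles only on $\Gamma_\omega$ and principal part $\alpha_\gamma(\omega)/(z-\gamma)$ at each $\gamma\in\Gamma_\omega$ (it exists by the Mittag-Leffler theorem), and put $\mathbf a_\omega=(\operatorname{Im}\phi_\omega,\operatorname{Re}\phi_\omega)$. Then $\mathbf a_\omega\in C^\infty(\mathbb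 R^2\setminus\Gamma_\omega;\mathbb R^2)$ and $\operatorname{curl}\mathbf a_\omega=\partial_1a_{\omega,2}-\partial_2a_{\omega,1}=\sum_{\gamma\in\Gamma_\omega}2\pi\alpha_\gamma(\omega)\delta_\gamma$ as distributions, where $\delta_\gamma$ is the Dirac measure at $\gamma$. Let $\mathcal L_\omega=\left(\frac1i\nabla-\mathbf a_\omega\right)^2$. $H_\omega$ is the Friedrichs extension in $L^2(\mathbb R^2)$ of $\mathcal L_\omega$ with domain $C_0^\infty(\mathbb R^2\setminus\Gamma_\omega)$ (smooth functions with compact support contained in $\mathbb R^2\setminus\Gamma_\omega$); it is a non-negative self-adjoint operator. Its domain is $D(H_\omega)=\{u\in L^2(\mathbb R^2):\mathcal L_\omega u\in L^2(\mathbb R^2),\ \limsup_{x\to\gamma}|u(x)|<\infty\text{ for every }\gamma\in\Gamma_\omega\}$, with $\mathcal L_\omega u$ taken in the sense of distributions on $\mathbb R^2\setminus\Gamma_\omega$. $\sigma(H_\omega)$ denotes the spectrum of $H_\omega$. *)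

theory Defs
  imports "HOL-Probability.Probability" "HOL-Complex_Analysis.Complex_Analysis"
begin

section \<open>Unbounded operators in a complex \<open>L\<^sup>2\<close> space\<close>

text \<open>
  Elements of \<open>L\<^sup>2\<close> are handled through representatives: functions equal almost everywhere
  stand for the same vector. An unbounded operator is given by its graph, a set of pairs of
  representatives that is saturated under almost everywhere equality.
\<close>

definition L2 :: "'a measure \<Rightarrow> ('a \<Rightarrow> complex) set" where
  "L2 M = {u \<in> borel_measurable M. integrable M (\<lambda>x. (cmod (u x))\<^sup>2)}"

definition L2_inner :: "'a measure \<Rightarrow> ('a \<Rightarrow> complex) \<Rightarrow> ('a \<Rightarrow> complex) \<Rightarrow> complex" where
  "L2_inner M u v = (\<integral>x. u x * cnj (v x) \<partial>M)"

definition L2_norm :: "'a measure \<Rightarrow> ('a \<Rightarrow> complex) \<Rightarrow> real" where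
  "L2_norm M u = sqrt (\<integral>x. (cmod (u x))\<^sup>2 \<partial>M)"

text \<open>
  A number \<open>z\<close> is in the resolvent set of \<open>H\<close> if \<open>H - z\<close> maps the domain of \<open>H\<close> bijectively
  onto \<open>L\<^sup>2\<close> with bounded inverse \<open>R\<close>. In terms of graphs, \<open>(H - z) (R f) = f\<close> reads
  \<open>(R f, f + z R f) \<in> H\<close>.
\<close>

definition resolvent_set ::
    "'a measure \<Rightarrow> (('a \<Rightarrow> complex) \<times> ('a \<Rightarrow> complex)) set \<Rightarrow> complex set" where
  "resolvent_set M H = {z. \<exists>R C.
      (\<forall>f\<in>L2 M. (R f, \<lambda>x. f x + z * R f x) \<in> H \<and> L2_norm M (R f) \<le> C * L2_norm M f) \<and>
      (\<forall>(u, h)\<in>H. AE x in M. R (\<lambda>y. h y - z * u y) x = u x)}"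

definition op_spectrum ::
    "'a measure \<Rightarrow> (('a \<Rightarrow> complex) \<times> ('a \<Rightarrow> complex)) set \<Rightarrow> complex set" where
  "op_spectrum M H = - resolvent_set M H"

text \<open>
  \<open>form_converges M D q s u\<close>: the sequence \<open>s\<close> in the form domain \<open>D\<close> converges to \<open>u\<close> in
  \<open>L\<^sup>2\<close> and is Cauchy with respect to \<open>q\<close>. The limits \<open>u\<close> of such sequences make up the domain
  of the closure of \<open>q\<close>, whose value at \<open>(u, v)\<close> is the common limit of \<open>q (s n) (t n)\<close> over all
  sequences \<open>s\<close> for \<open>u\<close> and \<open>t\<close> for \<open>v\<close>.
\<close>

definition form_converges ::
    "'a measure \<Rightarrow> ('a \<Rightarrow> complex) set \<Rightarrow> (('a \<Rightarrow> complex) \<Rightarrow> ('a \<Rightarrow> complex) \<Rightarrow> complex)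
      \<Rightarrow> (nat \<Rightarrow> 'a \<Rightarrow> complex) \<Rightarrow> ('a \<Rightarrow> complex) \<Rightarrow> bool" where
  "form_converges M D q s u \<longleftrightarrow>
     (\<forall>n. s n \<in> D) \<and> u \<in> L2 M \<and>
     (\<lambda>n. L2_norm M (\<lambda>x. s n x - u x)) \<longlonglongrightarrow> 0 \<and>
     (\<forall>e>0. \<exists>N. \<forall>m\<ge>N. \<forall>n\<ge>N. cmod (q (\<lambda>x. s m x - s n x) (\<lambda>x. s m x - s n x)) < e)"

definition form_closure_dom ::
    "'a measure \<Rightarrow> ('a \<Rightarrow> complex) set \<Rightarrow> (('a \<Rightarrow> complex) \<Rightarrow> ('a \<Rightarrow> complex) \<Rightarrow> complex)
      \<Rightarrow> ('a \<Rightarrow> complex) set" where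
  "form_closure_dom M D q = {u. \<exists>s. form_converges M D q s u}"

definition form_closure ::
    "'a measure \<Rightarrow> ('a \<Rightarrow> complex) set \<Rightarrow> (('a \<Rightarrow> complex) \<Rightarrow> ('a \<Rightarrow> complex) \<Rightarrow> complex)
      \<Rightarrow> ('a \<Rightarrow> complex) \<Rightarrow> ('a \<Rightarrow> complex) \<Rightarrow> complex" where
  "form_closure M D q u v =
     (THE c. \<forall>s t. form_converges M D q s u \<longrightarrow> form_converges M D q t v \<longrightarrow>
        (\<lambda>n. q (s n) (t n)) \<longlonglongrightarrow> c)"

text \<open>
  The Friedrichs extension of a non-negative symmetric operator \<open>T\<close> with domain \<open>D\<close> is the
  operator associated with the closure of the form \<open>q u v = \<langle>T u, v\<rangle>\<close> on \<open>D\<close>.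
\<close>

definition friedrichs_extension ::
    "'a measure \<Rightarrow> ('a \<Rightarrow> complex) set \<Rightarrow> (('a \<Rightarrow> complex) \<Rightarrow> ('a \<Rightarrow> complex))
      \<Rightarrow> (('a \<Rightarrow> complex) \<times> ('a \<Rightarrow> complex)) set" where
  "friedrichs_extension M D T =
     (let q = (\<lambda>u v. L2_inner M (T u) v)
      in {(u, f). u \<in> form_closure_dom M D q \<and> f \<in> L2 M \<and>
            (\<forall>v\<in>form_closure_dom M D q. form_closure M D q u v = L2_inner M f v)})"


section \<open>Magnetic Schroedinger operators\<close>

definition partial_deriv ::
    "'a \<Rightarrow> ('a::euclidean_space \<Rightarrow> 'b::real_normed_vector) \<Rightarrow> 'a \<Rightarrow> 'b" where
  "partial_deriv b f x = frechet_derivative f (at x) b"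

primrec times_cont_differentiable ::
    "nat \<Rightarrow> ('a::euclidean_space \<Rightarrow> 'b::real_normed_vector) \<Rightarrow> bool" where
  "times_cont_differentiable 0 f \<longleftrightarrow> continuous_on UNIV f"
| "times_cont_differentiable (Suc k) f \<longleftrightarrow>
     f differentiable_on UNIV \<and> (\<forall>b\<in>Basis. times_cont_differentiable k (partial_deriv b f))"

text \<open>
  The space \<open>C\<^sub>0\<^sup>\<infinity>(U)\<close> for open \<open>U\<close>, its elements being extended by zero to the whole space.
\<close>

definition test_functions :: "'a::euclidean_space set \<Rightarrow> ('a \<Rightarrow> complex) set" where
  "test_functions U = {u. (\<forall>k. times_cont_differentiable k u) \<and>
     compact (closure {x. u x \<noteq> 0}) \<and> closure {x. u x \<noteq> 0} \<subseteq> U}"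

text \<open>The component \<open>(1/\<i>) \<partial>\<^sub>b - a\<^sub>b\<close> of \<open>(1/\<i>) \<nabla> - a\<close>, and \<open>((1/\<i>) \<nabla> - a)\<^sup>2\<close>.\<close>

definition magnetic_deriv ::
    "('a::euclidean_space \<Rightarrow> 'a) \<Rightarrow> 'a \<Rightarrow> ('a \<Rightarrow> complex) \<Rightarrow> 'a \<Rightarrow> complex" where
  "magnetic_deriv a b u x = (1 / \<i>) * partial_deriv b u x - of_real (a x \<bullet> b) * u x"

definition magnetic_schroedinger ::
    "('a::euclidean_space \<Rightarrow> 'a) \<Rightarrow> ('a \<Rightarrow> complex) \<Rightarrow> 'a \<Rightarrow> complex" where
  "magnetic_schroedinger a u x = (\<Sum>b\<in>Basis. magnetic_deriv a b (magnetic_deriv a b u) x)"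

text \<open>
  From here on the plane is the type \<^typ>\<open>complex\<close>, whose standard basis is \<open>{1, \<i>}\<close>.
  The following says that \<open>\<phi>\<close> is a meromorphic function with poles only in \<open>\<Gamma>\<close> and
  with principal part \<open>\<alpha> \<gamma> / (z - \<gamma>)\<close> at each \<open>\<gamma> \<in> \<Gamma>\<close>; its value at points of \<open>\<Gamma>\<close> is irrelevant.
\<close>

definition has_simple_principal_parts ::
    "complex set \<Rightarrow> (complex \<Rightarrow> real) \<Rightarrow> (complex \<Rightarrow> complex) \<Rightarrow> bool" where
  "has_simple_principal_parts \<Gamma> \<alpha> \<phi> \<longleftrightarrow>
     \<phi> meromorphic_on UNIV \<and> \<phi> analytic_on (- \<Gamma>) \<and>
     (\<forall>\<gamma>\<in>\<Gamma>. \<exists>g. g analytic_on {\<gamma>} \<and>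
        (\<forall>\<^sub>F z in at \<gamma>. \<phi> z = of_real (\<alpha> \<gamma>) / (z - \<gamma>) + g z))"

definition vector_potential :: "(complex \<Rightarrow> complex) \<Rightarrow> complex \<Rightarrow> complex" where
  "vector_potential \<phi> z = Complex (Im (\<phi> z)) (Re (\<phi> z))"

definition delta_hamiltonian ::
    "complex set \<Rightarrow> (complex \<Rightarrow> complex) \<Rightarrow> ((complex \<Rightarrow> complex) \<times> (complex \<Rightarrow> complex)) set" where
  "delta_hamiltonian \<Gamma> \<phi> =
     friedrichs_extension lborel (test_functions (- \<Gamma>))
       (magnetic_schroedinger (vector_potential \<phi>))"


section \<open>The random field\<close>

definition square :: "nat \<Rightarrow> complex set" where
  "square k = {z. - real k - 1/2 \<le> Re z \<and> Re z < real k + 1/2 \<and>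
                  - real k - 1/2 \<le> Im z \<and> Im z < real k + 1/2}"

definition int_lattice :: "complex set" where
  "int_lattice = {z. Re z \<in> \<int> \<and> Im z \<in> \<int>}"

text \<open>The sum may be infinite when \<open>E\<close> is unbounded, hence the extended values.\<close>

definition flux :: "complex set \<Rightarrow> (complex \<Rightarrow> real) \<Rightarrow> complex set \<Rightarrow> ennreal" where
  "flux \<Gamma> \<alpha> E = (\<Sum>\<^sub>\<infinity>\<gamma>\<in>\<Gamma> \<inter> E. ennreal (\<alpha> \<gamma>))"

lemma finite_Int_square:
  assumes "\<And>z. \<not> z islimpt \<Gamma>"
  shows "finite (\<Gamma> \<inter> square k)"
proof -
  define K where "K = cbox (Complex (- real k - 1/2) (- real k - 1/2)) (Complex (real k + 1/2) (real k + 1/2))"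
  have "finite (K \<inter> \<Gamma>)"
    using assms unfolding K_def by (intro finite_not_islimpt_in_compact) auto
  moreover have "\<Gamma> \<inter> square k \<subseteq> K \<inter> \<Gamma>"
    by (auto simp: square_def K_def in_cbox_complex_iff)
  ultimately show ?thesis
    by (rule finite_subset[rotated])
qed

text \<open>
  By the preceding lemma, the flux through \<open>square 0\<close> is a finite real number, so \<open>enn2real\<close>
  is exact in the moment conditions. Integrability of the squared deviation
  expresses that the variance is finite. In the last assumption \<^const>\<open>measure\<close> vanishes on
  non-measurable sets, so positivity includes that the set is an event.
\<close>

locale random_flux = prob_space P
  for P :: "'w measure" and \<Gamma> :: "'w \<Rightarrow> complex set" and \<alpha> :: "'w \<Rightarrow> complex \<Rightarrow> real" +
  assumes no_accumulation: "\<And>\<omega> z. \<omega> \<in> space P \<Longrightarrow> \<not> z islimpt \<Gamma> \<omega>"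
    and alpha_range: "\<And>\<omega> \<gamma>. \<omega> \<in> space P \<Longrightarrow> \<gamma> \<in> \<Gamma> \<omega> \<Longrightarrow> 0 \<le> \<alpha> \<omega> \<gamma> \<and> \<alpha> \<omega> \<gamma> < 1"
    and flux_measurable:
      "\<And>E. E \<in> sets borel \<Longrightarrow> (\<lambda>\<omega>. flux (\<Gamma> \<omega>) (\<alpha> \<omega>) E) \<in> borel_measurable P"
    and flux_indep:
      "\<And>J E. finite J \<Longrightarrow> J \<subseteq> int_lattice \<Longrightarrow>
         (\<And>n. n \<in> J \<Longrightarrow> E n \<in> sets borel \<and> E n \<subseteq> (\<lambda>z. z + n) ` square 0) \<Longrightarrow>
         indep_vars (\<lambda>_. borel) (\<lambda>n \<omega>. flux (\<Gamma> \<omega>) (\<alpha> \<omega>) (E n)) J"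
    and flux_identically_distributed:
      "\<And>E m n. E \<in> sets borel \<Longrightarrow> E \<subseteq> square 0 \<Longrightarrow> m \<in> int_lattice \<Longrightarrow> n \<in> int_lattice \<Longrightarrow>
         distr P borel (\<lambda>\<omega>. flux (\<Gamma> \<omega>) (\<alpha> \<omega>) ((\<lambda>z. z + m) ` E)) =
         distr P borel (\<lambda>\<omega>. flux (\<Gamma> \<omega>) (\<alpha> \<omega>) ((\<lambda>z. z + n) ` E))"
    and flux_expectation:
      "integrable P (\<lambda>\<omega>. enn2real (flux (\<Gamma> \<omega>) (\<alpha> \<omega>) (square 0)))"
      "0 < expectation (\<lambda>\<omega>. enn2real (flux (\<Gamma> \<omega>) (\<alpha> \<omega>) (square 0)))"
    and flux_variance:
      "integrable P (\<lambda>\<omega>. (enn2real (flux (\<Gamma> \<omega>) (\<alpha> \<omega>) (square 0)) -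
         expectation (\<lambda>\<omega>'. enn2real (flux (\<Gamma> \<omega>') (\<alpha> \<omega>') (square 0))))\<^sup>2)"
    and flux_frontier: "AE \<omega> in P. flux (\<Gamma> \<omega>) (\<alpha> \<omega>) (frontier (square 0)) = 0"
    and small_flux:
      "(\<exists>c::real. 0 < c \<and> c \<le> 1 \<and> (\<forall>\<epsilon>>0.
          prob {\<omega> \<in> space P. flux (\<Gamma> \<omega>) (\<alpha> \<omega>) (square 0) < ennreal \<epsilon> \<and>
            (\<forall>\<gamma>\<in>\<Gamma> \<omega> \<inter> square 0. \<forall>\<gamma>'\<in>\<Gamma> \<omega> \<inter> square 0. \<gamma> \<noteq> \<gamma>' \<longrightarrow>
               ball \<gamma> (c * sqrt (\<alpha> \<omega> \<gamma>)) \<inter> ball \<gamma>' (c * sqrt (\<alpha> \<omega> \<gamma>')) = {}) \<and>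
            (\<forall>\<gamma>\<in>\<Gamma> \<omega> \<inter> square 0. ball \<gamma> (c * sqrt (\<alpha> \<omega> \<gamma>)) \<inter> frontier (square 0) = {})} > 0)) \<or>
       (\<forall>\<epsilon>>0. prob {\<omega> \<in> space P. (\<Sum>\<gamma>\<in>\<Gamma> \<omega> \<inter> square 0. sqrt (\<alpha> \<omega> \<gamma>)) < \<epsilon>} > 0)"

end

theory Submission
  imports Defs
begin

text \<open>
  The operator \<open>H\<close> is non-negative and self-adjoint, so only \<open>[0, \<infinity>) \<subseteq> \<sigma>(H)\<close> is at stake. If a test
  function \<open>f\<close> satisfies \<open>\<parallel>((1/\<i>) \<nabla> - a) f\<parallel> \<le> \<delta> \<parallel>f\<parallel>\<close>, then \<open>u = exp(\<i> \<xi> \<bullet> x) f\<close> satisfies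
  \<open>|\<langle>(H - |\<xi>|\<^sup>2) u, v\<rangle>| \<le> C \<delta> \<parallel>u\<parallel>\<close> times the form norm of \<open>v\<close>, which suffices for Weyl's criterion.
  So everything reduces to \<open>inf \<sigma>(H) = 0\<close>.

  By independence, almost surely there are arbitrarily large discs of radius \<open>R\<close> whose double has total
  flux at most \<open>1/400\<close>. In such a disc the regular part of \<open>\<phi>\<close> is gauged away, which leaves the
  potential with \<open>\<phi>\<^sub>0 = \<Sum>\<alpha>\<^sub>\<gamma>/(z - \<gamma>)\<close>, and \<open>|\<phi>\<^sub>0| = |\<nabla>W|\<close> for \<open>W = \<Sum>\<alpha>\<^sub>\<gamma> log(|z - \<gamma>|/3R) \<le> 0\<close>.
  The trial function \<open>\<chi> E(1 + W)\<close>, with a radial cutoff \<open>\<chi>\<close> and \<open>E(t) = exp(-1/t)\<close> for \<open>t > 0\<close>, vanishes near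
  the points \<open>\<gamma>\<close>. Since \<open>W\<close> is harmonic, a Caccioppoli estimate bounds its energy by \<open>\<integral>|\<nabla>\<chi>|\<^sup>2\<close>, a
  constant independent of \<open>R\<close> and of the number of points, while its squared norm grows like \<open>R\<^sup>2\<close>
  because \<open>W > -1/2\<close> on most of the disc.
\<close>

section \<open>Sesquilinear forms\<close>

text \<open>A small flux does not control the number or the spacing of the points of \<Gamma> in a
  disc, which separate cutoffs around them would require. Cutting off with W itself weights each
  point by its flux, and the magnetic term |phi_0|^2 f^2 and the gradient of the cutoff are then
  dominated by one density, chi^2 E'(1+W) |phi_0|^2. Its integral is bounded by integrating (d_1 + i
  d_2) of chi^2 E(1+W) phi_0 to zero: phi_0 is holomorphic off the points, and E(1+W) vanishes near
  them. The cross term with the gradient of chi is absorbed because E^2 <= E' on (-infinity, 1],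
  which is where W <= 0 enters. Points with \<alpha> = 0 leave no trace in W, so a second cutoff
  with small artificial weights removes them. The constant 1/400 comes from areas: each of the two
  exceptional sets, where a potential is below -1/2, fills at most 0.06 of pi R^2, so more than half
  of the half-radius disc, which fills 0.25, remains.\<close>

locale sesquilinear =
  fixes V :: "('a \<Rightarrow> complex) set" and B :: "('a \<Rightarrow> complex) \<Rightarrow> ('a \<Rightarrow> complex) \<Rightarrow> complex"
  assumes V_zero: "(\<lambda>x. 0) \<in> V"
    and V_add: "u \<in> V \<Longrightarrow> v \<in> V \<Longrightarrow> (\<lambda>x. u x + v x) \<in> V"
    and V_scale: "u \<in> V \<Longrightarrow> (\<lambda>x. c * u x) \<in> V"
    and B_add_left: "u \<in> V \<Longrightarrow> v \<in> V \<Longrightarrow> w \<in> V \<Longrightarrow> B (\<lambda>x. u x + v x) w = B u w + B v w"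
    and B_scale_left: "u \<in> V \<Longrightarrow> w \<in> V \<Longrightarrow> B (\<lambda>x. c * u x) w = c * B u w"
    and B_herm: "u \<in> V \<Longrightarrow> v \<in> V \<Longrightarrow> B v u = cnj (B u v)"
    and B_pos: "u \<in> V \<Longrightarrow> 0 \<le> Re (B u u)"
begin

text \<open>Only a seminorm, since functions that agree almost everywhere are not identified. The
  Hilbert space arguments below are therefore phrased without passing to a quotient.\<close>

definition nn :: "('a \<Rightarrow> complex) \<Rightarrow> real" where "nn u = sqrt (Re (B u u))"

lemma V_diff: "u \<in> V \<Longrightarrow> v \<in> V \<Longrightarrow> (\<lambda>x. u x - v x) \<in> V"
  using V_add[of u "\<lambda>x. (-1) * v x"] V_scale[of v "-1"] by simp

lemma B_add_right:
  assumes "u \<in> V" "v \<in> V" "w \<in> V"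
  shows "B w (\<lambda>x. u x + v x) = B w u + B w v"
  using B_herm[OF V_add[OF assms(1,2)] assms(3)] B_herm[OF assms(1,3)] B_herm[OF assms(2,3)]
    B_add_left[OF assms] by simp

lemma B_scale_right:
  assumes "u \<in> V" "w \<in> V"
  shows "B w (\<lambda>x. c * u x) = cnj c * B w u"
  using B_herm[OF V_scale[OF assms(1)] assms(2)] B_herm[OF assms] B_scale_left[OF assms] by simp

lemma B_diff_left:
  assumes "u \<in> V" "v \<in> V" "w \<in> V"
  shows "B (\<lambda>x. u x - v x) w = B u w - B v w"
  using B_add_left[OF assms(1) V_scale[OF assms(2), of "-1"] assms(3)]
    B_scale_left[OF assms(2,3), of "-1"] by simp

lemma B_diff_right:
  assumes "u \<in> V" "v \<in> V" "w \<in> V"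
  shows "B w (\<lambda>x. u x - v x) = B w u - B w v"
  using B_add_right[OF assms(1) V_scale[OF assms(2), of "-1"] assms(3)]
    B_scale_right[OF assms(2,3), of "-1"] by simp

lemma B_self: "u \<in> V \<Longrightarrow> B u u = of_real (Re (B u u))"
  using B_herm[of u u] by (auto simp: complex_eq_iff)

lemma nn_nonneg [simp]: "u \<in> V \<Longrightarrow> 0 \<le> nn u"
  by (simp add: nn_def B_pos)

lemma nn_sq: "u \<in> V \<Longrightarrow> (nn u)\<^sup>2 = Re (B u u)"
  by (simp add: nn_def B_pos)

lemma B_self': "u \<in> V \<Longrightarrow> B u u = of_real ((nn u)\<^sup>2)"
  using B_self nn_sq by simp

lemma cauchy_schwarz:
  assumes u: "u \<in> V" and v: "v \<in> V"
  shows "cmod (B u v) \<le> nn u * nn v"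
proof -
  define b where "b = B u v"
  \<comment> \<open>Positivity of the form on s u - B(u,v) v; the coefficient B(u,v) makes the cross
    term real.\<close>
  have key: "0 \<le> s\<^sup>2 * (nn u)\<^sup>2 - 2 * s * (cmod b)\<^sup>2 + (cmod b)\<^sup>2 * (nn v)\<^sup>2" for s :: real
  proof -
    let ?w = "\<lambda>x. complex_of_real s * u x - b * v x"
    have su: "(\<lambda>x. of_real s * u x) \<in> V" and bv: "(\<lambda>x. b * v x) \<in> V"
      using V_scale u v by auto
    have "B ?w ?w = of_real (s\<^sup>2) * B u u - s * cnj b * b - s * b * cnj b + b * cnj b * B v v"
      using u v su bv B_herm[OF u v] V_diff[OF su bv]
      by (simp add: B_diff_left B_diff_right B_scale_left B_scale_right flip: b_def)
        (simp add: algebra_simps power2_eq_square)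
    also have "\<dots> = of_real (s\<^sup>2 * (nn u)\<^sup>2 - 2 * s * (cmod b)\<^sup>2 + (cmod b)\<^sup>2 * (nn v)\<^sup>2)"
      using complex_norm_square[of b] by (simp add: B_self'[OF u] B_self'[OF v] algebra_simps)
    finally have "Re (B ?w ?w) = s\<^sup>2 * (nn u)\<^sup>2 - 2 * s * (cmod b)\<^sup>2 + (cmod b)\<^sup>2 * (nn v)\<^sup>2"
      by (simp only: Re_complex_of_real)
    with B_pos[OF V_diff[OF su bv]] show ?thesis by simp
  qed
  show ?thesis
  proof (cases "b = 0")
    case True
    then show ?thesis using u v by (simp add: b_def)
  next
    case False
    then have pos: "0 < (cmod b)\<^sup>2" by simp
    \<comment> \<open>The form may degenerate. If \<open>nn u = 0\<close>, then \<open>key\<close>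
      is affine in s and fails for large s.\<close>
    have nu: "nn u \<noteq> 0"
    proof
      assume "nn u = 0"
      then have "0 \<le> (cmod b)\<^sup>2 * ((nn v)\<^sup>2 - 2 * s)" for s
        using key[of s] by (simp add: algebra_simps)
      from this[of "(nn v)\<^sup>2 + 1"] have "0 \<le> (nn v)\<^sup>2 - 2 * ((nn v)\<^sup>2 + 1)"
        using pos by (simp add: zero_le_mult_iff)
      then have "(nn v)\<^sup>2 + 2 \<le> 0" by (simp add: algebra_simps)
      moreover have "0 < (nn v)\<^sup>2 + 2" by (intro add_nonneg_pos) auto
      ultimately show False by simp
    qed
    have "0 \<le> ((cmod b)\<^sup>2 / (nn u)\<^sup>2)\<^sup>2 * (nn u)\<^sup>2 - 2 * ((cmod b)\<^sup>2 / (nn u)\<^sup>2) * (cmod b)\<^sup>2 + (cmod b)\<^sup>2 * (nn v)\<^sup>2"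
      by (rule key)
    also have "\<dots> = (cmod b)\<^sup>2 * ((nn v)\<^sup>2 - (cmod b)\<^sup>2 / (nn u)\<^sup>2)"
      using nu by (simp add: field_simps power2_eq_square)
    finally have "(cmod b)\<^sup>2 / (nn u)\<^sup>2 \<le> (nn v)\<^sup>2"
      using pos by (simp add: zero_le_mult_iff)
    then have "(cmod b)\<^sup>2 \<le> (nn u * nn v)\<^sup>2"
      using nu by (simp add: field_simps power_mult_distrib)
    then show ?thesis
      using u v by (simp add: b_def abs_le_square_iff[symmetric])
  qed
qed

lemma nn_add:
  assumes u: "u \<in> V" and v: "v \<in> V"
  shows "nn (\<lambda>x. u x + v x) \<le> nn u + nn v"
proof -
  have "(nn (\<lambda>x. u x + v x))\<^sup>2 = (nn u)\<^sup>2 + (nn v)\<^sup>2 + 2 * Re (B u v)"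
    using u v B_herm[OF u v] by (simp add: nn_sq V_add B_add_left B_add_right)
  also have "\<dots> \<le> (nn u)\<^sup>2 + (nn v)\<^sup>2 + 2 * (nn u * nn v)"
    using cauchy_schwarz[OF u v] complex_Re_le_cmod[of "B u v"] by simp
  also have "\<dots> = (nn u + nn v)\<^sup>2" by (simp add: power2_sum)
  finally show ?thesis
    by (rule power2_le_imp_le) (use u v in simp)
qed

lemma nn_scale: "u \<in> V \<Longrightarrow> nn (\<lambda>x. c * u x) = cmod c * nn u"
proof -
  assume u: "u \<in> V"
  have "B (\<lambda>x. c * u x) (\<lambda>x. c * u x) = of_real ((cmod c)\<^sup>2) * B u u"
    using u by (simp add: B_scale_left B_scale_right V_scale complex_mult_cnj cmod_power2 flip: of_real_power)
  then show ?thesis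
    by (simp add: nn_def real_sqrt_mult del: of_real_power)
qed

lemma nn_diff_commute:
  assumes "u \<in> V" "v \<in> V"
  shows "nn (\<lambda>x. u x - v x) = nn (\<lambda>x. v x - u x)"
  using nn_scale[OF V_diff[OF assms], of "-1"] by simp

lemma nn_diff:
  assumes "u \<in> V" "v \<in> V"
  shows "nn (\<lambda>x. u x - v x) \<le> nn u + nn v"
  using nn_add[OF assms(1) V_scale[OF assms(2), of "-1"]] nn_scale[OF assms(2), of "-1"] by simp

lemma nn_triangle:
  assumes "u \<in> V" "v \<in> V" "w \<in> V"
  shows "nn (\<lambda>x. u x - w x) \<le> nn (\<lambda>x. u x - v x) + nn (\<lambda>x. v x - w x)"
  using nn_add[OF V_diff[OF assms(1,2)] V_diff[OF assms(2,3)]] by simp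

lemma nn_triangle3:
  assumes "u \<in> V" "v \<in> V"
  shows "nn u \<le> nn v + nn (\<lambda>x. u x - v x)"
  using nn_add[OF assms(2) V_diff[OF assms]] by simp

lemma nn_reverse_triangle:
  assumes "u \<in> V" "v \<in> V"
  shows "\<bar>nn u - nn v\<bar> \<le> nn (\<lambda>x. u x - v x)"
  using nn_triangle3[OF assms] nn_triangle3[OF assms(2,1)] nn_diff_commute[OF assms] by linarith

lemma parallelogram:
  assumes u: "u \<in> V" and v: "v \<in> V"
  shows "(nn (\<lambda>x. u x + v x))\<^sup>2 + (nn (\<lambda>x. u x - v x))\<^sup>2 = 2 * (nn u)\<^sup>2 + 2 * (nn v)\<^sup>2"
  using u v by (simp add: nn_sq V_add V_diff B_add_left B_add_right B_diff_left B_diff_right)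

lemma nn_zero [simp]: "nn (\<lambda>x. 0) = 0"
  using nn_scale[OF V_zero, of 0] by simp

definition converges_to :: "(nat \<Rightarrow> 'a \<Rightarrow> complex) \<Rightarrow> ('a \<Rightarrow> complex) \<Rightarrow> bool" where
  "converges_to s u \<longleftrightarrow> (\<forall>n. s n \<in> V) \<and> u \<in> V \<and> (\<lambda>n. nn (\<lambda>x. s n x - u x)) \<longlonglongrightarrow> 0"

definition cauchy_seq :: "(nat \<Rightarrow> 'a \<Rightarrow> complex) \<Rightarrow> bool" where
  "cauchy_seq s \<longleftrightarrow> (\<forall>n. s n \<in> V) \<and> (\<forall>e>0. \<exists>N. \<forall>m\<ge>N. \<forall>n\<ge>N. nn (\<lambda>x. s m x - s n x) < e)"

lemma converges_to_nn:
  assumes "converges_to s u"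
  shows "(\<lambda>n. nn (s n)) \<longlonglongrightarrow> nn u"
proof -
  have "(\<lambda>n. \<bar>nn (s n) - nn u\<bar>) \<longlonglongrightarrow> 0"
    by (rule tendsto_sandwich[of "\<lambda>_. 0" _ _ "\<lambda>n. nn (\<lambda>x. s n x - u x)"])
      (use assms nn_reverse_triangle in \<open>auto simp: converges_to_def\<close>)
  then show ?thesis
    by (simp add: LIM_zero_iff tendsto_rabs_zero_iff)
qed

lemma converges_to_B:
  assumes s: "converges_to s u" and t: "converges_to t v"
  shows "(\<lambda>n. B (s n) (t n)) \<longlonglongrightarrow> B u v"
proof -
  have V: "s n \<in> V" "t n \<in> V" "u \<in> V" "v \<in> V" for n
    using s t by (auto simp: converges_to_def)
  have eq: "B (s n) (t n) - B u v = B (\<lambda>x. s n x - u x) (t n) + B u (\<lambda>x. t n x - v x)" for n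
    using V by (simp add: B_diff_left B_diff_right)
  have "(\<lambda>n. nn (\<lambda>x. s n x - u x) * nn (t n) + nn u * nn (\<lambda>x. t n x - v x)) \<longlonglongrightarrow> 0 * nn v + nn u * 0"
    using s t converges_to_nn[OF t] by (intro tendsto_intros) (auto simp: converges_to_def)
  then have lim: "(\<lambda>n. nn (\<lambda>x. s n x - u x) * nn (t n) + nn u * nn (\<lambda>x. t n x - v x)) \<longlonglongrightarrow> 0"
    by simp
  have "(\<lambda>n. B (s n) (t n) - B u v) \<longlonglongrightarrow> 0"
  proof (rule Lim_null_comparison[OF always_eventually lim], rule allI)
    fix n
    show "cmod (B (s n) (t n) - B u v) \<le> nn (\<lambda>x. s n x - u x) * nn (t n) + nn u * nn (\<lambda>x. t n x - v x)"
      unfolding eq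
      by (rule norm_triangle_le) (intro add_mono cauchy_schwarz V V_diff)
  qed
  then show ?thesis by (simp add: LIM_zero_iff)
qed

lemma converges_to_const: "u \<in> V \<Longrightarrow> converges_to (\<lambda>_. u) u"
  by (simp add: converges_to_def)

text \<open>Supplies the convergence of the fixed point iteration in
  \<open>lax_milgram\<close>.\<close>

lemma cauchy_seq_geometric:
  assumes V: "\<And>n. s n \<in> V" and k: "0 \<le> k" "k < 1"
    and step: "\<And>n. nn (\<lambda>x. s (Suc (Suc n)) x - s (Suc n) x) \<le> k * nn (\<lambda>x. s (Suc n) x - s n x)"
  shows "cauchy_seq s"
proof -
  define d where "d n = nn (\<lambda>x. s (Suc n) x - s n x)" for n
  have d: "d n \<le> d 0 * k ^ n" for n
  proof (induction n)
    case (Suc n)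
    have "d (Suc n) \<le> k * d n" using step by (simp add: d_def)
    also have "\<dots> \<le> k * (d 0 * k ^ n)" using Suc k by (intro mult_left_mono) auto
    finally show ?case by (simp add: algebra_simps)
  qed simp
  have d0: "0 \<le> d 0" using V by (simp add: d_def V_diff)
  have tail: "nn (\<lambda>x. s (N + j) x - s N x) \<le> d 0 * k ^ N / (1 - k)" for N j
  proof -
    have "nn (\<lambda>x. s (N + j) x - s N x) \<le> (\<Sum>i<j. d (N + i))"
    proof (induction j)
      case 0
      show ?case by simp
    next
      case (Suc j)
      have "nn (\<lambda>x. s (Suc (N + j)) x - s N x) \<le> d (N + j) + nn (\<lambda>x. s (N + j) x - s N x)"
        unfolding d_def by (rule nn_triangle) (use V in auto)
      then show ?case using Suc by simp
    qed
    also have "\<dots> \<le> (\<Sum>i<j. d 0 * k ^ N * k ^ i)"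
      by (intro sum_mono order_trans[OF d]) (simp add: power_add mult.assoc)
    also have "\<dots> = d 0 * k ^ N * (\<Sum>i<j. k ^ i)" by (simp add: sum_distrib_left)
    also have "\<dots> \<le> d 0 * k ^ N * (1 / (1 - k))"
    proof (intro mult_left_mono)
      show "(\<Sum>i<j. k ^ i) \<le> 1 / (1 - k)"
        using sum_le_suminf[of "\<lambda>i. k ^ i" "{..<j}"] suminf_geometric[of k] summable_geometric[of k] k
        by simp
    qed (use d0 k in auto)
    finally show ?thesis by simp
  qed
  have "(\<lambda>N. 2 * (d 0 * k ^ N / (1 - k))) \<longlonglongrightarrow> 2 * (d 0 * 0 / (1 - k))"
    using k by (intro tendsto_intros LIMSEQ_power_zero) auto
  then have lim: "(\<lambda>N. 2 * (d 0 * k ^ N / (1 - k))) \<longlonglongrightarrow> 0" by simp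
  show ?thesis
    unfolding cauchy_seq_def
  proof (intro conjI allI impI V)
    fix e :: real assume "e > 0"
    from order_tendstoD(2)[OF lim this] obtain N where N: "2 * (d 0 * k ^ N / (1 - k)) < e"
      by (auto simp: eventually_sequentially)
    have "nn (\<lambda>x. s m x - s n x) < e" if "m \<ge> N" "n \<ge> N" for m n
    proof -
      have "nn (\<lambda>x. s m x - s n x) \<le> nn (\<lambda>x. s m x - s N x) + nn (\<lambda>x. s N x - s n x)"
        by (rule nn_triangle) (use V in auto)
      also have "nn (\<lambda>x. s N x - s n x) = nn (\<lambda>x. s n x - s N x)"
        by (rule nn_diff_commute) (use V in auto)
      finally show ?thesis
        using tail[of N "m - N"] tail[of N "n - N"] that N by simp
    qed
    then show "\<exists>N. \<forall>m\<ge>N. \<forall>n\<ge>N. nn (\<lambda>x. s m x - s n x) < e" by blast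
  qed
qed

end

section \<open>Riesz representation and the Lax-Milgram theorem\<close>

locale complete_sesquilinear = sesquilinear +
  assumes complete: "cauchy_seq s \<Longrightarrow> \<exists>u. converges_to s u"
begin

text \<open>Minimise J(u) = |u|^2 - 2 Re l(u). The parallelogram law makes a minimising sequence
  Cauchy, and the first variation at its limit gives the real part of the identity; replacing v by i
  v gives the imaginary part. The functional is conjugate linear because \<open>B\<close> is so in
  its second argument.\<close>

lemma riesz_representation:
  assumes l_add: "\<And>u v. u \<in> V \<Longrightarrow> v \<in> V \<Longrightarrow> l (\<lambda>x. u x + v x) = l u + l v"
    and l_scale: "\<And>c u. u \<in> V \<Longrightarrow> l (\<lambda>x. c * u x) = cnj c * l u"
    and l_bound: "\<And>u. u \<in> V \<Longrightarrow> cmod (l u) \<le> K * nn u"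
  shows "\<exists>w\<in>V. \<forall>v\<in>V. B w v = l v"
proof -
  define J where "J u = (nn u)\<^sup>2 - 2 * Re (l u)" for u
  have J_lower: "- K\<^sup>2 \<le> J u" if "u \<in> V" for u
  proof -
    have "Re (l u) \<le> K * nn u" using l_bound[OF that] complex_Re_le_cmod[of "l u"] by linarith
    moreover have "0 \<le> (nn u - K)\<^sup>2" by simp
    ultimately show ?thesis by (simp add: J_def power2_diff algebra_simps)
  qed
  define I where "I = Inf (J ` V)"
  have bdd: "bdd_below (J ` V)" using J_lower by (auto intro!: bdd_belowI[of _ "- K\<^sup>2"])
  have I_le: "I \<le> J u" if "u \<in> V" for u
    unfolding I_def by (rule cInf_lower) (use that bdd in auto)
  have "\<exists>u\<in>V. J u < I + inverse (real (Suc n))" for n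
    using cInf_lessD[of "J ` V" "I + inverse (real (Suc n))"] V_zero by (auto simp: I_def)
  then obtain s where s: "\<And>n. s n \<in> V" "\<And>n. J (s n) < I + inverse (real (Suc n))"
    by metis
  have diff_bound: "(nn (\<lambda>x. u x - v x))\<^sup>2 \<le> 2 * (J u - I) + 2 * (J v - I)" if u: "u \<in> V" and v: "v \<in> V" for u v
  proof -
    let ?m = "\<lambda>x. (1/2) * (u x + v x)"
    have m: "?m \<in> V" by (intro V_scale V_add u v)
    have "J ?m = (1/4) * (nn (\<lambda>x. u x + v x))\<^sup>2 - Re (l u) - Re (l v)"
      unfolding J_def nn_scale[OF V_add[OF u v], of "1/2"] l_scale[OF V_add[OF u v], of "1/2"] l_add[OF u v]
      by (simp add: power_mult_distrib power_divide field_simps)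
    with I_le[OF m] parallelogram[OF u v] show ?thesis
      unfolding J_def by (simp add: algebra_simps)
  qed
  have cau: "cauchy_seq s"
    unfolding cauchy_seq_def
  proof (intro conjI allI impI s)
    fix e :: real assume e: "e > 0"
    then have "0 < e\<^sup>2 / 4" by simp
    then obtain N where N: "inverse (real (Suc N)) < e\<^sup>2 / 4"
      using reals_Archimedean by blast
    have "nn (\<lambda>x. s m x - s n x) < e" if "m \<ge> N" "n \<ge> N" for m n
    proof -
      define r where "r j = inverse (real (Suc j))" for j
      have "r m \<le> r N" "r n \<le> r N" "J (s m) < I + r m" "J (s n) < I + r n" "r N < e\<^sup>2 / 4"
        using that N s(2)[of m] s(2)[of n] by (auto simp: r_def)
      then have "2 * (J (s m) - I) + 2 * (J (s n) - I) < e\<^sup>2" by (simp add: algebra_simps)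
      with diff_bound[OF s(1)[of m] s(1)[of n]] have "(nn (\<lambda>x. s m x - s n x))\<^sup>2 < e\<^sup>2"
        by (rule le_less_trans)
      then show ?thesis by (rule power2_less_imp_less) (use e in simp)
    qed
    then show "\<exists>N. \<forall>m\<ge>N. \<forall>n\<ge>N. nn (\<lambda>x. s m x - s n x) < e" by blast
  qed
  then obtain w where w: "converges_to s w" using complete by blast
  then have wV: "w \<in> V" by (simp add: converges_to_def)
  have l_diff: "l (\<lambda>x. u x - v x) = l u - l v" if "u \<in> V" "v \<in> V" for u v
    using l_add[OF that(1) V_scale[OF that(2), of "-1"]] l_scale[OF that(2), of "-1"] by simp
  have "(\<lambda>n. l (s n) - l w) \<longlonglongrightarrow> 0"
  proof (rule Lim_null_comparison[OF always_eventually])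
    show "\<forall>n. cmod (l (s n) - l w) \<le> K * nn (\<lambda>x. s n x - w x)"
      using l_bound[OF V_diff[OF s(1) wV]] l_diff[OF s(1) wV] by metis
    show "(\<lambda>n. K * nn (\<lambda>x. s n x - w x)) \<longlonglongrightarrow> 0"
      using w by (auto simp: converges_to_def intro!: tendsto_mult_right_zero)
  qed
  then have "(\<lambda>n. l (s n)) \<longlonglongrightarrow> l w" by (simp add: LIM_zero_iff)
  then have "(\<lambda>n. J (s n)) \<longlonglongrightarrow> J w"
    unfolding J_def by (intro tendsto_intros converges_to_nn w)
  moreover have "(\<lambda>n. I + inverse (real (Suc n))) \<longlonglongrightarrow> I + 0"
    by (intro tendsto_intros LIMSEQ_inverse_real_of_nat)
  ultimately have "J w \<le> I + 0"
    using s(2) by (intro LIMSEQ_le) (auto intro: less_imp_le)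
  then have Jw: "J w \<le> J u" if "u \<in> V" for u using I_le[OF that] by simp
  have real_part: "Re (B w v) = Re (l v)" if v: "v \<in> V" for v
  proof -
    define p where "p = Re (B w v) - Re (l v)"
    have q: "0 \<le> 2 * t * p + t\<^sup>2 * (nn v)\<^sup>2" for t :: real
    proof -
      have tv: "(\<lambda>x. of_real t * v x) \<in> V" using V_scale v by blast
      have "(nn (\<lambda>x. w x + of_real t * v x))\<^sup>2 = (nn w)\<^sup>2 + 2 * t * Re (B w v) + t\<^sup>2 * (nn v)\<^sup>2"
        using wV v tv B_herm[OF wV v] B_self'[OF v]
        by (simp add: nn_sq V_add B_add_left B_add_right B_scale_left B_scale_right)
          (simp add: power2_eq_square)
      then have "J (\<lambda>x. w x + of_real t * v x) = J w + (2 * t * p + t\<^sup>2 * (nn v)\<^sup>2)"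
        using l_add[OF wV tv] l_scale[OF v, of "of_real t"] by (simp add: J_def p_def algebra_simps)
      with Jw[OF V_add[OF wV tv]] show ?thesis by simp
    qed
    \<comment> \<open>Adding 1 keeps the step - p / a meaningful when
      \<open>nn v = 0\<close>.\<close>
    define a where "a = (nn v)\<^sup>2 + 1"
    have a: "a > 0" by (simp add: a_def add_nonneg_pos)
    have "0 \<le> 2 * (- p / a) * p + (- p / a)\<^sup>2 * (nn v)\<^sup>2" by (rule q)
    also have "\<dots> \<le> 2 * (- p / a) * p + (- p / a)\<^sup>2 * a"
      by (intro add_left_mono mult_left_mono) (auto simp: a_def)
    also have "\<dots> = - p\<^sup>2 / a" using a by (simp add: field_simps power2_eq_square)
    finally have "p\<^sup>2 \<le> 0" using a by (simp add: field_simps)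
    then show ?thesis by (simp add: p_def)
  qed
  have "B w v = l v" if v: "v \<in> V" for v
    using real_part[OF v] real_part[OF V_scale[OF v, of "\<i>"]] B_scale_right[OF v wV, of "\<i>"]
      l_scale[OF v, of "\<i>"] by (simp add: complex_eq_iff)
  with wV show ?thesis by blast
qed

text \<open>With A representing b and w representing l, the equation reads A u = w up to null
  vectors. Coercivity and the bound on A make u - t (A u - w) a contraction in u for t = c / K^2,
  and its fixed point is the solution.\<close>

lemma lax_milgram:
  assumes b_add: "\<And>u v w. u \<in> V \<Longrightarrow> v \<in> V \<Longrightarrow> w \<in> V \<Longrightarrow> b (\<lambda>x. u x + v x) w = b u w + b v w"
    and b_scale: "\<And>c u w. u \<in> V \<Longrightarrow> w \<in> V \<Longrightarrow> b (\<lambda>x. c * u x) w = c * b u w"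
    and b_add': "\<And>u v w. u \<in> V \<Longrightarrow> v \<in> V \<Longrightarrow> w \<in> V \<Longrightarrow> b w (\<lambda>x. u x + v x) = b w u + b w v"
    and b_scale': "\<And>c u w. u \<in> V \<Longrightarrow> w \<in> V \<Longrightarrow> b w (\<lambda>x. c * u x) = cnj c * b w u"
    and b_bound: "\<And>u v. u \<in> V \<Longrightarrow> v \<in> V \<Longrightarrow> cmod (b u v) \<le> K * nn u * nn v"
    and coercive: "\<And>u. u \<in> V \<Longrightarrow> c * (nn u)\<^sup>2 \<le> Re (b u u)" and c: "0 < c"
    and l_add: "\<And>u v. u \<in> V \<Longrightarrow> v \<in> V \<Longrightarrow> l (\<lambda>x. u x + v x) = l u + l v"
    and l_scale: "\<And>c u. u \<in> V \<Longrightarrow> l (\<lambda>x. c * u x) = cnj c * l u"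
    and l_bound: "\<And>u. u \<in> V \<Longrightarrow> cmod (l u) \<le> L * nn u"
  shows "\<exists>u\<in>V. \<forall>v\<in>V. b u v = l v"
proof -
  obtain w where w: "w \<in> V" "\<And>v. v \<in> V \<Longrightarrow> B w v = l v"
    using riesz_representation[of l L] l_add l_scale l_bound by blast
  have "\<exists>a\<in>V. \<forall>v\<in>V. B a v = b u v" if u: "u \<in> V" for u
    using riesz_representation[of "b u" "K * nn u"] b_add' b_scale' b_bound u by blast
  then obtain A where A: "\<And>u. u \<in> V \<Longrightarrow> A u \<in> V" "\<And>u v. u \<in> V \<Longrightarrow> v \<in> V \<Longrightarrow> B (A u) v = b u v"
    by metis
  have nnA: "nn (A u) \<le> K * nn u" if u: "u \<in> V" for u
  proof (cases "nn (A u) = 0")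
    case True
    have "0 \<le> K * nn u * nn u" using b_bound[OF u u] norm_ge_zero order_trans by blast
    then have "0 \<le> K * nn u"
      using u nn_nonneg[OF u] by (cases "nn u = 0") (auto simp: zero_le_mult_iff)
    with True show ?thesis by simp
  next
    case False
    have "(nn (A u))\<^sup>2 = Re (b u (A u))" using A u nn_sq by simp
    also have "\<dots> \<le> K * nn u * nn (A u)"
      using b_bound[OF u A(1)[OF u]] complex_Re_le_cmod order_trans by blast
    finally show ?thesis
      using False nn_nonneg[OF A(1)[OF u]] by (simp add: power2_eq_square)
  qed
  \<comment> \<open>The maximum makes the bound positive and at least c, so that the contraction
    factor k below is the root of a number in [0, 1).\<close>
  define K' where "K' = max K c"
  have K': "K' > 0" "c \<le> K'" "K \<le> K'" using c by (auto simp: K'_def)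
  define t where "t = c / K'\<^sup>2"
  define k where "k = sqrt (1 - c\<^sup>2 / K'\<^sup>2)"
  have t: "t > 0" using c K' by (simp add: t_def)
  have ck: "c\<^sup>2 \<le> K'\<^sup>2" using K' c by (intro power_mono) auto
  have k: "0 \<le> k" "k < 1" using c K' ck by (auto simp: k_def field_simps)
  have contract: "nn (\<lambda>x. u x - of_real t * A u x) \<le> k * nn u" if u: "u \<in> V" for u
  proof -
    have tA: "(\<lambda>x. of_real t * A u x) \<in> V" by (intro V_scale A u)
    have "B u (A u) = cnj (b u u)" using B_herm[OF A(1)[OF u] u] A u by simp
    then have "(nn (\<lambda>x. u x - of_real t * A u x))\<^sup>2 = (nn u)\<^sup>2 - 2 * t * Re (b u u) + t\<^sup>2 * (nn (A u))\<^sup>2"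
      using u tA A(1)[OF u] A(2)[OF u u]
      by (simp add: nn_sq V_diff B_diff_left B_diff_right B_scale_left B_scale_right)
        (simp add: power2_eq_square)
    also have "\<dots> \<le> (nn u)\<^sup>2 - 2 * t * (c * (nn u)\<^sup>2) + t\<^sup>2 * (K' * nn u)\<^sup>2"
    proof -
      have "nn (A u) \<le> K' * nn u"
        using nnA[OF u] mult_right_mono[OF K'(3) nn_nonneg[OF u]] by linarith
      then have "t\<^sup>2 * (nn (A u))\<^sup>2 \<le> t\<^sup>2 * (K' * nn u)\<^sup>2"
        using A(1)[OF u] by (intro mult_left_mono power_mono) auto
      moreover have "2 * t * (c * (nn u)\<^sup>2) \<le> 2 * t * Re (b u u)"
        using coercive[OF u] t by (intro mult_left_mono) auto
      ultimately show ?thesis by linarith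
    qed
    also have "\<dots> = (1 - c\<^sup>2 / K'\<^sup>2) * (nn u)\<^sup>2"
      using K' by (simp add: t_def field_simps power2_eq_square)
    also have "\<dots> = (k * nn u)\<^sup>2"
      using K' ck by (simp add: k_def power_mult_distrib field_simps)
    finally show ?thesis
      by (rule power2_le_imp_le) (use u k in simp)
  qed
  define s where "s = rec_nat (\<lambda>_. 0) (\<lambda>_ u. (\<lambda>x. u x - of_real t * (A u x - w x)))"
  have s_Suc: "s (Suc n) = (\<lambda>x. s n x - of_real t * (A (s n) x - w x))" for n
    by (simp add: s_def)
  have sV: "s n \<in> V" for n
  proof (induction n)
    case 0
    then show ?case using V_zero by (simp add: s_def)
  next
    case (Suc n)
    then show ?case unfolding s_Suc by (intro V_diff V_scale A w)
  qed
  \<comment> \<open>A is obtained by choice, hence it is additive only up to vectors of seminorm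
    zero.\<close>
  have A_diff: "nn (\<lambda>x. A (\<lambda>y. u y - v y) x - (A u x - A v x)) = 0" if u: "u \<in> V" and v: "v \<in> V" for u v
  proof -
    let ?d = "\<lambda>x. A (\<lambda>y. u y - v y) x - (A u x - A v x)"
    have d: "?d \<in> V" using u v by (intro V_diff A)
    have b_diff: "b (\<lambda>x. u x - v x) z = b u z - b v z" if "z \<in> V" for z
      using b_add[OF u V_scale[OF v, of "-1"] that] b_scale[OF v that, of "-1"] by simp
    have "B ?d ?d = 0"
      using u v d b_diff by (simp add: B_diff_left A V_diff)
    then show ?thesis by (simp add: nn_def)
  qed
  have step: "nn (\<lambda>x. s (Suc (Suc n)) x - s (Suc n) x) \<le> k * nn (\<lambda>x. s (Suc n) x - s n x)" for n
  proof -
    define d where "d = (\<lambda>x. s (Suc n) x - s n x)"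
    define r where "r = (\<lambda>x. A d x - (A (s (Suc n)) x - A (s n) x))"
    have dV: "d \<in> V" unfolding d_def by (intro V_diff sV)
    have rV: "r \<in> V" unfolding r_def by (intro V_diff A dV sV)
    have r0: "nn r = 0" unfolding r_def d_def by (rule A_diff) (rule sV)+
    have "(\<lambda>x. s (Suc (Suc n)) x - s (Suc n) x) = (\<lambda>x. (d x - of_real t * A d x) + of_real t * r x)"
      by (subst (1) s_Suc, subst (2) s_Suc) (simp add: r_def d_def fun_eq_iff algebra_simps)
    then have "nn (\<lambda>x. s (Suc (Suc n)) x - s (Suc n) x) \<le> nn (\<lambda>x. d x - of_real t * A d x) + nn (\<lambda>x. of_real t * r x)"
      using nn_add[OF V_diff[OF dV V_scale[OF A(1)[OF dV]]] V_scale[OF rV]] by metis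
    also have "\<dots> \<le> k * nn d" using contract[OF dV] nn_scale[OF rV] r0 by simp
    finally show ?thesis by (simp add: d_def)
  qed
  have "cauchy_seq s" using sV k step by (rule cauchy_seq_geometric[where k = k])
  then obtain u where u: "converges_to s u" using complete by blast
  then have uV: "u \<in> V" by (simp add: converges_to_def)
  have "b u v = l v" if v: "v \<in> V" for v
  proof -
    have b_diff: "b (\<lambda>x. s n x - u x) v = b (s n) v - b u v" for n
      using b_add[OF sV V_scale[OF uV, of "-1"] v] b_scale[OF uV v, of "-1"] by simp
    have "(\<lambda>n. b (s n) v - b u v) \<longlonglongrightarrow> 0"
    proof (rule Lim_null_comparison[OF always_eventually])
      show "\<forall>n. cmod (b (s n) v - b u v) \<le> K * nn (\<lambda>x. s n x - u x) * nn v"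
        using b_bound[OF V_diff[OF sV uV] v] b_diff by metis
      have "(\<lambda>n. K * nn (\<lambda>x. s n x - u x) * nn v) \<longlonglongrightarrow> K * 0 * nn v"
        using u by (intro tendsto_intros) (auto simp: converges_to_def)
      then show "(\<lambda>n. K * nn (\<lambda>x. s n x - u x) * nn v) \<longlonglongrightarrow> 0" by simp
    qed
    then have lim1: "(\<lambda>n. b (s n) v) \<longlonglongrightarrow> b u v" by (simp add: LIM_zero_iff)
    have lim2: "(\<lambda>n. B (s n) v) \<longlonglongrightarrow> B u v"
      by (rule converges_to_B[OF u converges_to_const[OF v]])
    have rec: "B (s (Suc n)) v = B (s n) v - of_real t * (b (s n) v - l v)" for n
      unfolding s_Suc using v sV w A by (simp add: B_diff_left B_scale_left V_diff V_scale)
    have "(\<lambda>n. B (s n) v - of_real t * (b (s n) v - l v)) \<longlonglongrightarrow> B u v - of_real t * (b u v - l v)"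
      by (intro tendsto_intros lim1 lim2)
    moreover have "(\<lambda>n. B (s (Suc n)) v) \<longlonglongrightarrow> B u v" using lim2 by (rule LIMSEQ_Suc)
    ultimately have "B u v - of_real t * (b u v - l v) = B u v"
      unfolding rec using LIMSEQ_unique by blast
    then show ?thesis using t by simp
  qed
  with uV show ?thesis by blast
qed

end

section \<open>The space of square integrable functions\<close>

lemma L2_integrable_inner:
  assumes "u \<in> L2 M" "v \<in> L2 M"
  shows "integrable M (\<lambda>x. u x * cnj (v x))"
proof (rule Bochner_Integration.integrable_bound)
  show "integrable M (\<lambda>x. (cmod (u x))\<^sup>2 + (cmod (v x))\<^sup>2)"
    using assms by (auto simp: L2_def)
  have [measurable]: "cnj \<in> borel_measurable borel"
    by (intro borel_measurable_continuous_onI continuous_intros)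
  show "(\<lambda>x. u x * cnj (v x)) \<in> borel_measurable M"
    using assms by (auto simp: L2_def intro!: borel_measurable_times measurable_compose[of v M borel cnj])
  have "cmod (u x * cnj (v x)) \<le> (cmod (u x))\<^sup>2 + (cmod (v x))\<^sup>2" for x
    using sum_squares_bound[of "cmod (u x)" "cmod (v x)"] mult_nonneg_nonneg[OF norm_ge_zero[of "u x"] norm_ge_zero[of "v x"]]
    unfolding norm_mult complex_mod_cnj by linarith
  then show "AE x in M. norm (u x * cnj (v x)) \<le> norm ((cmod (u x))\<^sup>2 + (cmod (v x))\<^sup>2)"
    by (intro AE_I2) (auto intro: order_trans[OF _ abs_ge_self])
qed

lemma L2_add:
  assumes "u \<in> L2 M" "v \<in> L2 M"
  shows "(\<lambda>x. u x + v x) \<in> L2 M"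
proof -
  have "integrable M (\<lambda>x. (cmod (u x + v x))\<^sup>2)"
  proof (rule Bochner_Integration.integrable_bound)
    show "integrable M (\<lambda>x. 2 * (cmod (u x))\<^sup>2 + 2 * (cmod (v x))\<^sup>2)"
      using assms by (auto simp: L2_def)
    show "(\<lambda>x. (cmod (u x + v x))\<^sup>2) \<in> borel_measurable M"
      using assms by (auto simp: L2_def)
    have "(cmod (u x + v x))\<^sup>2 \<le> 2 * (cmod (u x))\<^sup>2 + 2 * (cmod (v x))\<^sup>2" for x
    proof -
      have "(cmod (u x + v x))\<^sup>2 \<le> (cmod (u x) + cmod (v x))\<^sup>2"
        by (intro power_mono norm_triangle_ineq) auto
      then show ?thesis
        using sum_squares_bound[of "cmod (u x)" "cmod (v x)"] by (simp add: power2_sum)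
    qed
    then show "AE x in M. norm ((cmod (u x + v x))\<^sup>2) \<le> norm (2 * (cmod (u x))\<^sup>2 + 2 * (cmod (v x))\<^sup>2)"
      by (intro AE_I2) simp
  qed
  then show ?thesis using assms by (auto simp: L2_def)
qed

lemma L2_inner_sesquilinear: "sesquilinear (L2 M) (L2_inner M)"
proof
  show "(\<lambda>x. 0) \<in> L2 M" by (simp add: L2_def)
  fix u v assume u: "u \<in> L2 M" and v: "v \<in> L2 M"
  show "(\<lambda>x. u x + v x) \<in> L2 M" by (rule L2_add[OF u v])
  show "L2_inner M v u = cnj (L2_inner M u v)"
  proof -
    have "cnj (\<integral>x. u x * cnj (v x) \<partial>M) = (\<integral>x. cnj (u x * cnj (v x)) \<partial>M)"
      by (rule Bochner_Integration.integral_cnj[symmetric])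
    then show ?thesis by (simp add: L2_inner_def mult.commute)
  qed
  show "L2_inner M (\<lambda>x. c * u x) v = c * L2_inner M u v" for c
    unfolding L2_inner_def by (simp add: mult.assoc)
  fix w assume w: "w \<in> L2 M"
  show "L2_inner M (\<lambda>x. u x + v x) w = L2_inner M u w + L2_inner M v w"
    unfolding L2_inner_def by (simp add: L2_integrable_inner u v w distrib_right)
next
  fix u :: "'a \<Rightarrow> complex" and c assume u: "u \<in> L2 M"
  then show "(\<lambda>x. c * u x) \<in> L2 M"
    by (auto simp: L2_def norm_mult power_mult_distrib)
  have "L2_inner M u u = (\<integral>x. of_real ((cmod (u x))\<^sup>2) \<partial>M)"
    by (simp add: L2_inner_def complex_norm_square del: of_real_power)
  also have "\<dots> = of_real (\<integral>x. (cmod (u x))\<^sup>2 \<partial>M)" by (rule integral_complex_of_real)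
  finally show "0 \<le> Re (L2_inner M u u)" by simp
qed

lemma L2_norm_nn:
  assumes "u \<in> L2 M"
  shows "L2_norm M u = sesquilinear.nn (L2_inner M) u"
proof -
  interpret sesquilinear "L2 M" "L2_inner M" by (rule L2_inner_sesquilinear)
  have "L2_inner M u u = (\<integral>x. of_real ((cmod (u x))\<^sup>2) \<partial>M)"
    by (simp add: L2_inner_def complex_norm_square del: of_real_power)
  also have "\<dots> = of_real (\<integral>x. (cmod (u x))\<^sup>2 \<partial>M)" by (rule integral_complex_of_real)
  finally show ?thesis by (simp add: nn_def L2_norm_def)
qed

lemma L2_norm_eq_0_AE:
  assumes "u \<in> L2 M" "L2_norm M u = 0"
  shows "AE x in M. u x = 0"
proof -
  have "(\<integral>x. (cmod (u x))\<^sup>2 \<partial>M) = 0" using assms(2) by (simp add: L2_norm_def)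
  then have "AE x in M. (cmod (u x))\<^sup>2 = 0"
    using assms(1) by (subst (asm) integral_nonneg_eq_0_iff_AE) (auto simp: L2_def)
  then show ?thesis by simp
qed

lemma L2_nn_integral:
  assumes "u \<in> L2 M"
  shows "(\<integral>\<^sup>+x. ennreal ((cmod (u x))\<^sup>2) \<partial>M) = ennreal ((L2_norm M u)\<^sup>2)"
  using assms by (subst nn_integral_eq_integral) (auto simp: L2_def L2_norm_def)

lemma L2_I:
  assumes "u \<in> borel_measurable M" "(\<integral>\<^sup>+x. ennreal ((cmod (u x))\<^sup>2) \<partial>M) < \<infinity>"
  shows "u \<in> L2 M"
  using assms by (auto simp: L2_def intro!: integrableI_nonneg)

lemma L2_norm_nonneg [simp]: "0 \<le> L2_norm M u"
  by (simp add: L2_norm_def)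

text \<open>Riesz--Fischer: a subsequence with geometric increments converges almost everywhere.\<close>

lemma L2_complete:
  assumes s: "\<And>n. s n \<in> L2 M"
    and cau: "\<And>e. e > 0 \<Longrightarrow> \<exists>N. \<forall>m\<ge>N. \<forall>n\<ge>N. L2_norm M (\<lambda>x. s m x - s n x) < e"
  shows "\<exists>u\<in>L2 M. (\<lambda>n. L2_norm M (\<lambda>x. s n x - u x)) \<longlonglongrightarrow> 0"
proof -
  interpret sesquilinear "L2 M" "L2_inner M" by (rule L2_inner_sesquilinear)
  have meas [measurable]: "s n \<in> borel_measurable M" for n
    using s by (auto simp: L2_def)
  have "\<forall>k. \<exists>N. \<forall>m\<ge>N. \<forall>n\<ge>N. L2_norm M (\<lambda>x. s m x - s n x) < (1/2)^k"
    using cau by simp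
  then obtain N where N: "\<And>k m n. m \<ge> N k \<Longrightarrow> n \<ge> N k \<Longrightarrow> L2_norm M (\<lambda>x. s m x - s n x) < (1/2)^k"
    by metis
  define r where "r k = (\<Sum>i\<le>k. N i)" for k
  have r: "N k \<le> r n" if "k \<le> n" for k n
    unfolding r_def by (rule member_le_sum) (use that in auto)
  define d where "d k x = s (r (Suc k)) x - s (r k) x" for k x
  have dL2: "d k \<in> L2 M" for k unfolding d_def by (rule V_diff) (rule s)+
  have d_meas [measurable]: "d k \<in> borel_measurable M" for k
    using dL2 by (auto simp: L2_def)
  have d_norm: "L2_norm M (d k) \<le> (1/2)^k" for k
    unfolding d_def using N[of k "r (Suc k)" "r k"] r by (simp add: less_imp_le)
  \<comment> \<open>The increments are small enough that the weights 2^k keep the integral of g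
    finite. Then 2 |d_k| <= 2^k |d_k|^2 + 2^-k makes the telescoping series converge wherever g is
    finite.\<close>
  define g where "g x = (\<Sum>k. ennreal (2^k * (cmod (d k x))\<^sup>2))" for x
  have g_meas [measurable]: "g \<in> borel_measurable M" unfolding g_def by measurable
  have "(\<integral>\<^sup>+x. g x \<partial>M) = (\<Sum>k. \<integral>\<^sup>+x. ennreal (2^k * (cmod (d k x))\<^sup>2) \<partial>M)"
    unfolding g_def by (rule nn_integral_suminf) measurable
  also have "\<dots> = (\<Sum>k. ennreal (2^k * (L2_norm M (d k))\<^sup>2))"
    by (simp add: ennreal_mult nn_integral_cmult L2_nn_integral dL2)
  also have "\<dots> \<le> (\<Sum>k. ennreal ((1/2)^k))"
  proof (intro suminf_le ennreal_leI)
    fix k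
    have "2^k * (L2_norm M (d k))\<^sup>2 \<le> 2^k * ((1/2)^k)\<^sup>2"
      using d_norm by (intro mult_left_mono power_mono) auto
    also have "\<dots> = (1/2 :: real)^k"
      by (simp add: power2_eq_square power_divide)
    finally show "2^k * (L2_norm M (d k))\<^sup>2 \<le> (1/2)^k" .
  qed auto
  also have "\<dots> < \<infinity>"
    unfolding infinity_ennreal_def less_top[symmetric]
    by (rule ennreal_suminf_neq_top) (auto intro: summable_geometric)
  finally have "AE x in M. g x \<noteq> \<infinity>"
    by (intro nn_integral_PInf_AE) auto
  moreover have "convergent (\<lambda>n. s (r n) x)" if "g x \<noteq> \<infinity>" for x
  proof -
    have "summable (\<lambda>k. 2^k * (cmod (d k x))\<^sup>2)"
      using that by (intro summable_suminf_not_top) (auto simp: g_def)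
    moreover have "summable (\<lambda>k. (1/2 :: real)^k)" by (simp add: summable_geometric)
    ultimately have "summable (\<lambda>k. 2^k * (cmod (d k x))\<^sup>2 + (1/2)^k)" by (rule summable_add)
    moreover have "norm (d k x) \<le> 2^k * (cmod (d k x))\<^sup>2 + (1/2)^k" for k
    proof -
      have "0 \<le> (2^k * cmod (d k x) - 1)\<^sup>2" by simp
      then have "2^k * (2 * cmod (d k x)) \<le> 2^k * (2^k * (cmod (d k x))\<^sup>2 + (1/2)^k)"
        by (simp add: power2_diff power_mult_distrib algebra_simps power_divide) (simp add: power2_eq_square mult_ac)
      then have "2 * cmod (d k x) \<le> 2^k * (cmod (d k x))\<^sup>2 + (1/2)^k"
        by (rule mult_left_le_imp_le) simp
      then show ?thesis using norm_ge_zero[of "d k x"] by linarith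
    qed
    ultimately have "summable (\<lambda>k. d k x)"
      by (rule summable_comparison_test'[where N = 0])
    then have "convergent (\<lambda>n. s (r 0) x + (\<Sum>k<n. d k x))"
      by (intro convergent_add convergent_const) (simp add: summable_iff_convergent)
    then show ?thesis
      unfolding d_def using sum_lessThan_telescope[of "\<lambda>n. s (r n) x"] by simp
  qed
  ultimately have AE_conv: "AE x in M. convergent (\<lambda>n. s (r n) x)" by auto
  define u where "u x = lim (\<lambda>n. s (r n) x)" for x
  have u_meas [measurable]: "u \<in> borel_measurable M" unfolding u_def by measurable
  \<comment> \<open>Fatou's lemma along the subsequence, shifted by k so that all its indices are at
    least \<open>N k\<close>.\<close>
  have fatou: "(\<integral>\<^sup>+x. ennreal ((cmod (s m x - u x))\<^sup>2) \<partial>M) \<le> ennreal (((1/2)^k)\<^sup>2)" if m: "m \<ge> N k" for m k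
  proof -
    have "AE x in M. ennreal ((cmod (s m x - u x))\<^sup>2) = liminf (\<lambda>n. ennreal ((cmod (s m x - s (r (n + k)) x))\<^sup>2))"
      using AE_conv
    proof eventually_elim
      case (elim x)
      then have "(\<lambda>n. s (r n) x) \<longlonglongrightarrow> u x" by (simp add: u_def convergent_LIMSEQ_iff)
      then have "(\<lambda>n. s (r (n + k)) x) \<longlonglongrightarrow> u x" by (rule LIMSEQ_ignore_initial_segment)
      then have "(\<lambda>n. ennreal ((cmod (s m x - s (r (n + k)) x))\<^sup>2)) \<longlonglongrightarrow> ennreal ((cmod (s m x - u x))\<^sup>2)"
        by (intro tendsto_intros tendsto_ennrealI)
      then show ?case by (intro lim_imp_Liminf[symmetric]) auto
    qed
    then have "(\<integral>\<^sup>+x. ennreal ((cmod (s m x - u x))\<^sup>2) \<partial>M) =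
        (\<integral>\<^sup>+x. liminf (\<lambda>n. ennreal ((cmod (s m x - s (r (n + k)) x))\<^sup>2)) \<partial>M)"
      by (rule nn_integral_cong_AE)
    also have "\<dots> \<le> liminf (\<lambda>n. \<integral>\<^sup>+x. ennreal ((cmod (s m x - s (r (n + k)) x))\<^sup>2) \<partial>M)"
      by (rule nn_integral_liminf) measurable
    also have "\<dots> \<le> liminf (\<lambda>n :: nat. ennreal (((1/2)^k)\<^sup>2))"
    proof (intro Liminf_mono always_eventually allI)
      fix n
      have "L2_norm M (\<lambda>x. s m x - s (r (n + k)) x) \<le> (1/2)^k"
        using N[OF m, of "r (n + k)"] r[of k "n + k"] by simp
      then show "(\<integral>\<^sup>+x. ennreal ((cmod (s m x - s (r (n + k)) x))\<^sup>2) \<partial>M) \<le> ennreal (((1/2)^k)\<^sup>2)"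
        by (subst L2_nn_integral[OF V_diff[OF s s]]) (intro ennreal_leI power_mono, auto)
    qed
    also have "\<dots> = ennreal (((1/2)^k)\<^sup>2)" by (rule Liminf_const) simp
    finally show ?thesis .
  qed
  have diff: "(\<lambda>x. s m x - u x) \<in> L2 M" if "m \<ge> N k" for m k
  proof (rule L2_I)
    show "(\<integral>\<^sup>+x. ennreal ((cmod (s m x - u x))\<^sup>2) \<partial>M) < \<infinity>"
      using fatou[OF that] by (rule le_less_trans) simp
  qed measurable
  have u: "u \<in> L2 M"
    using V_diff[OF s diff[of 0 "N 0"], of "N 0"] by simp
  have "(\<lambda>n. L2_norm M (\<lambda>x. s n x - u x)) \<longlonglongrightarrow> 0"
  proof (rule LIMSEQ_I)
    fix e :: real assume "e > 0"
    then obtain k where k: "(1/2)^k < e" using real_arch_pow_inv[of e "1/2"] by auto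
    have "norm (L2_norm M (\<lambda>x. s n x - u x) - 0) < e" if n: "n \<ge> N k" for n
    proof -
      have "(L2_norm M (\<lambda>x. s n x - u x))\<^sup>2 \<le> ((1/2)^k)\<^sup>2"
        using fatou[OF n] L2_nn_integral[OF diff[OF n]] by simp
      then have "L2_norm M (\<lambda>x. s n x - u x) \<le> (1/2)^k" by (rule power2_le_imp_le) simp
      with k show ?thesis by simp
    qed
    then show "\<exists>no. \<forall>n\<ge>no. norm (L2_norm M (\<lambda>x. s n x - u x) - 0) < e" by blast
  qed
  with u show ?thesis by blast
qed

section \<open>Closed forms and the Friedrichs extension\<close>

lemma (in sesquilinear) cauchy_seq_bounded:
  assumes "cauchy_seq s"
  obtains C where "C > 0" "\<And>n. nn (s n) \<le> C"
proof -
  have V: "s n \<in> V" for n using assms by (simp add: cauchy_seq_def)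
  have "Cauchy (\<lambda>n. nn (s n))"
  proof (rule metric_CauchyI)
    fix e :: real assume "e > 0"
    then obtain N where N: "\<And>m n. m \<ge> N \<Longrightarrow> n \<ge> N \<Longrightarrow> nn (\<lambda>x. s m x - s n x) < e"
      using assms unfolding cauchy_seq_def by blast
    have "dist (nn (s m)) (nn (s n)) < e" if "m \<ge> N" "n \<ge> N" for m n
      using nn_reverse_triangle[OF V V, of m n] N[OF that] by (simp add: dist_real_def)
    then show "\<exists>M. \<forall>m\<ge>M. \<forall>n\<ge>M. dist (nn (s m)) (nn (s n)) < e" by blast
  qed
  then have "Bseq (\<lambda>n. nn (s n))" by (intro convergent_imp_Bseq Cauchy_convergent)
  then obtain K where "K > 0" "\<And>n. norm (nn (s n)) \<le> K" by (auto simp: Bseq_def)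
  then show thesis using that[of K] by (auto simp: abs_le_iff)
qed

lemma (in sesquilinear) cauchy_seq_diff:
  assumes s: "cauchy_seq s" and t: "cauchy_seq t"
  shows "cauchy_seq (\<lambda>n x. s n x - t n x)"
proof -
  have V: "s n \<in> V" "t n \<in> V" for n using s t by (auto simp: cauchy_seq_def)
  show ?thesis
    unfolding cauchy_seq_def
  proof (intro conjI allI impI V_diff V)
    fix e :: real assume "e > 0"
    then have "e/2 > 0" by simp
    then obtain N1 N2 where N: "\<And>m n. m \<ge> N1 \<Longrightarrow> n \<ge> N1 \<Longrightarrow> nn (\<lambda>x. s m x - s n x) < e/2"
      "\<And>m n. m \<ge> N2 \<Longrightarrow> n \<ge> N2 \<Longrightarrow> nn (\<lambda>x. t m x - t n x) < e/2"
      using s t unfolding cauchy_seq_def by metis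
    have "nn (\<lambda>x. (s m x - t m x) - (s n x - t n x)) < e" if "m \<ge> max N1 N2" "n \<ge> max N1 N2" for m n
    proof -
      have "(\<lambda>x. (s m x - t m x) - (s n x - t n x)) = (\<lambda>x. (s m x - s n x) - (t m x - t n x))" by auto
      then have "nn (\<lambda>x. (s m x - t m x) - (s n x - t n x)) \<le> nn (\<lambda>x. s m x - s n x) + nn (\<lambda>x. t m x - t n x)"
        using nn_diff[OF V_diff[OF V(1) V(1)] V_diff[OF V(2) V(2)]] by metis
      then show ?thesis using N(1)[of m n] N(2)[of m n] that by auto
    qed
    then show "\<exists>N. \<forall>m\<ge>N. \<forall>n\<ge>N. nn (\<lambda>x. (s m x - t m x) - (s n x - t n x)) < e" by blast
  qed
qed

lemma (in sesquilinear) cauchy_seq_scale: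
  assumes s: "cauchy_seq s"
  shows "cauchy_seq (\<lambda>n x. c * s n x)"
proof -
  have V: "s n \<in> V" for n using s by (auto simp: cauchy_seq_def)
  show ?thesis
    unfolding cauchy_seq_def
  proof (intro conjI allI impI V_scale V)
    fix e :: real assume "e > 0"
    then have "e / (cmod c + 1) > 0" by (simp add: add_nonneg_pos)
    then obtain N where N: "\<And>m n. m \<ge> N \<Longrightarrow> n \<ge> N \<Longrightarrow> nn (\<lambda>x. s m x - s n x) < e / (cmod c + 1)"
      using s unfolding cauchy_seq_def by metis
    have "nn (\<lambda>x. c * s m x - c * s n x) < e" if "m \<ge> N" "n \<ge> N" for m n
    proof -
      have "nn (\<lambda>x. c * s m x - c * s n x) = cmod c * nn (\<lambda>x. s m x - s n x)"
        using nn_scale[OF V_diff[OF V V], of c m n] by (simp add: right_diff_distrib)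
      also have "\<dots> \<le> (cmod c + 1) * nn (\<lambda>x. s m x - s n x)"
        using V by (intro mult_right_mono) (auto simp: V_diff)
      also have "\<dots> < (cmod c + 1) * (e / (cmod c + 1))"
        using N[OF that] by (intro mult_strict_left_mono) (auto simp: add_nonneg_pos)
      also have "\<dots> = e" using norm_ge_zero[of c] by (simp add: add_nonneg_eq_0_iff)
      finally show ?thesis .
    qed
    then show "\<exists>N. \<forall>m\<ge>N. \<forall>n\<ge>N. nn (\<lambda>x. c * s m x - c * s n x) < e" by blast
  qed
qed

lemma (in sesquilinear) cauchy_seq_const: "u \<in> V \<Longrightarrow> cauchy_seq (\<lambda>_. u)"
  by (simp add: cauchy_seq_def)

lemma (in sesquilinear) converges_to_diff:
  assumes s: "converges_to s u" and t: "converges_to t v"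
  shows "converges_to (\<lambda>n x. s n x - t n x) (\<lambda>x. u x - v x)"
proof -
  have V: "s n \<in> V" "t n \<in> V" "u \<in> V" "v \<in> V" for n
    using s t by (auto simp: converges_to_def)
  have "(\<lambda>n. nn (\<lambda>x. (s n x - t n x) - (u x - v x))) \<longlonglongrightarrow> 0"
  proof (rule tendsto_sandwich[OF always_eventually always_eventually])
    show "\<forall>n. 0 \<le> nn (\<lambda>x. (s n x - t n x) - (u x - v x))" using V by (auto simp: V_diff)
    show "\<forall>n. nn (\<lambda>x. (s n x - t n x) - (u x - v x)) \<le> nn (\<lambda>x. s n x - u x) + nn (\<lambda>x. t n x - v x)"
    proof
      fix n
      have "(\<lambda>x. (s n x - t n x) - (u x - v x)) = (\<lambda>x. (s n x - u x) - (t n x - v x))" by auto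
      then show "nn (\<lambda>x. (s n x - t n x) - (u x - v x)) \<le> nn (\<lambda>x. s n x - u x) + nn (\<lambda>x. t n x - v x)"
        using nn_diff[OF V_diff[OF V(1,3)] V_diff[OF V(2,4)]] by metis
    qed
    show "(\<lambda>n. nn (\<lambda>x. s n x - u x) + nn (\<lambda>x. t n x - v x)) \<longlonglongrightarrow> 0"
      using s t by (auto simp: converges_to_def intro!: tendsto_add_zero)
  qed simp
  then show ?thesis using V by (simp add: converges_to_def V_diff)
qed

lemma (in sesquilinear) converges_to_scale:
  assumes s: "converges_to s u"
  shows "converges_to (\<lambda>n x. c * s n x) (\<lambda>x. c * u x)"
proof -
  have V: "s n \<in> V" "u \<in> V" for n using s by (auto simp: converges_to_def)
  have "nn (\<lambda>x. c * s n x - c * u x) = cmod c * nn (\<lambda>x. s n x - u x)" for n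
    using nn_scale[OF V_diff[OF V], of c] by (simp add: right_diff_distrib)
  then show ?thesis using s by (auto simp: converges_to_def V_scale intro!: tendsto_mult_right_zero)
qed

locale nonneg_symmetric =
  fixes M :: "'a measure" and D :: "('a \<Rightarrow> complex) set" and T :: "('a \<Rightarrow> complex) \<Rightarrow> 'a \<Rightarrow> complex"
  assumes D_L2: "D \<subseteq> L2 M" and T_L2: "u \<in> D \<Longrightarrow> T u \<in> L2 M"
    and form: "sesquilinear D (\<lambda>u v. L2_inner M (T u) v)"
begin

abbreviation q where "q \<equiv> \<lambda>u v. L2_inner M (T u) v"
abbreviation fc where "fc \<equiv> form_converges M D q"
abbreviation dom where "dom \<equiv> form_closure_dom M D q"
abbreviation qc where "qc \<equiv> form_closure M D q"

sublocale Q: sesquilinear D q by (rule form)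
sublocale L: sesquilinear "L2 M" "L2_inner M" by (rule L2_inner_sesquilinear)

lemma D_in_L2: "u \<in> D \<Longrightarrow> u \<in> L2 M" using D_L2 by blast

lemma fc_iff: "fc s u \<longleftrightarrow> L.converges_to s u \<and> Q.cauchy_seq s"
proof -
  have "(\<forall>e>0. \<exists>N. \<forall>m\<ge>N. \<forall>n\<ge>N. cmod (q (\<lambda>x. s m x - s n x) (\<lambda>x. s m x - s n x)) < e) \<longleftrightarrow>
     (\<forall>e>0. \<exists>N. \<forall>m\<ge>N. \<forall>n\<ge>N. Q.nn (\<lambda>x. s m x - s n x) < e)" (is "?A \<longleftrightarrow> ?B") if s: "\<And>n. s n \<in> D"
  proof -
    have eq: "cmod (q (\<lambda>x. s m x - s n x) (\<lambda>x. s m x - s n x)) = (Q.nn (\<lambda>x. s m x - s n x))\<^sup>2" for m n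
      using Q.B_self'[OF Q.V_diff[OF s s]] by (simp del: of_real_power)
    have nonneg: "0 \<le> Q.nn (\<lambda>x. s m x - s n x)" for m n by (intro Q.nn_nonneg Q.V_diff s)
    show ?thesis
    proof
      assume A: ?A
      show ?B
      proof (intro allI impI)
        fix e :: real assume e: "e > 0"
        then have "e\<^sup>2 > 0" by simp
        then obtain N where N: "\<And>m n. m \<ge> N \<Longrightarrow> n \<ge> N \<Longrightarrow> (Q.nn (\<lambda>x. s m x - s n x))\<^sup>2 < e\<^sup>2"
          using A unfolding eq by metis
        have "Q.nn (\<lambda>x. s m x - s n x) < e" if "m \<ge> N" "n \<ge> N" for m n
          by (rule power2_less_imp_less[OF N[OF that]]) (use e in simp)
        then show "\<exists>N. \<forall>m\<ge>N. \<forall>n\<ge>N. Q.nn (\<lambda>x. s m x - s n x) < e" by blast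
      qed
    next
      assume B: ?B
      show ?A unfolding eq
      proof (intro allI impI)
        fix e :: real assume e: "e > 0"
        then have "sqrt e > 0" by simp
        then obtain N where N: "\<And>m n. m \<ge> N \<Longrightarrow> n \<ge> N \<Longrightarrow> Q.nn (\<lambda>x. s m x - s n x) < sqrt e"
          using B by metis
        have "(Q.nn (\<lambda>x. s m x - s n x))\<^sup>2 < e" if "m \<ge> N" "n \<ge> N" for m n
          using power_strict_mono[OF N[OF that] nonneg, of 2] e by simp
        then show "\<exists>N. \<forall>m\<ge>N. \<forall>n\<ge>N. (Q.nn (\<lambda>x. s m x - s n x))\<^sup>2 < e" by blast
      qed
    qed
  qed
  moreover have "L2_norm M (\<lambda>x. s n x - u x) = L.nn (\<lambda>x. s n x - u x)" if "u \<in> L2 M" "s n \<in> D" for n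
    by (rule L2_norm_nn) (intro L.V_diff D_in_L2 that)
  ultimately show ?thesis
    unfolding form_converges_def L.converges_to_def Q.cauchy_seq_def
    using D_L2 by (auto 4 3)
qed

lemma fc_D: "fc s u \<Longrightarrow> s n \<in> D" by (simp add: form_converges_def)
lemma fc_L2: "fc s u \<Longrightarrow> u \<in> L2 M" by (simp add: form_converges_def)

lemma fc_diff: "fc s u \<Longrightarrow> fc t v \<Longrightarrow> fc (\<lambda>n x. s n x - t n x) (\<lambda>x. u x - v x)"
  unfolding fc_iff using L.converges_to_diff Q.cauchy_seq_diff by blast

lemma fc_scale: "fc s u \<Longrightarrow> fc (\<lambda>n x. c * s n x) (\<lambda>x. c * u x)"
  unfolding fc_iff using L.converges_to_scale Q.cauchy_seq_scale by blast

lemma fc_add: "fc s u \<Longrightarrow> fc t v \<Longrightarrow> fc (\<lambda>n x. s n x + t n x) (\<lambda>x. u x + v x)"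
  using fc_diff[of s u "\<lambda>n x. -1 * t n x" "\<lambda>x. -1 * v x"] fc_scale[of t v "-1"] by simp

lemma fc_const: "u \<in> D \<Longrightarrow> fc (\<lambda>_. u) u"
  unfolding fc_iff by (intro conjI L.converges_to_const Q.cauchy_seq_const D_in_L2)

text \<open>Closability of the form. As q comes from an operator, q(s_N, s_n) = <T s_N, s_n> tends
  to 0 in n when s_n tends to 0 in L2, and the Cauchy property controls the remainder q(s_n - s_N,
  s_n).\<close>

lemma fc_null:
  assumes "fc s (\<lambda>x. 0)"
  shows "(\<lambda>n. Q.nn (s n)) \<longlonglongrightarrow> 0"
proof -
  have sD: "s n \<in> D" for n using assms by (rule fc_D)
  have cau: "Q.cauchy_seq s" and conv: "L.converges_to s (\<lambda>x. 0)" using assms by (auto simp: fc_iff)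
  obtain C where C: "C > 0" "\<And>n. Q.nn (s n) \<le> C" using Q.cauchy_seq_bounded[OF cau] by blast
  show ?thesis
  proof (rule LIMSEQ_I)
    fix e :: real assume e: "e > 0"
    then have "e\<^sup>2 / (2 * C) > 0" using C by simp
    then obtain N where N: "\<And>m n. m \<ge> N \<Longrightarrow> n \<ge> N \<Longrightarrow> Q.nn (\<lambda>x. s m x - s n x) < e\<^sup>2 / (2 * C)"
      using cau unfolding Q.cauchy_seq_def by metis
    have "(\<lambda>n. L2_inner M (T (s N)) (s n)) \<longlonglongrightarrow> L2_inner M (T (s N)) (\<lambda>x. 0)"
      by (rule L.converges_to_B[OF L.converges_to_const conv]) (intro T_L2 sD)
    moreover have "L2_inner M (T (s N)) (\<lambda>x. 0) = 0" by (simp add: L2_inner_def)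
    ultimately have "\<forall>\<^sub>F n in sequentially. norm (L2_inner M (T (s N)) (s n)) < e\<^sup>2 / 2"
      using order_tendstoD(2)[OF tendsto_norm_zero, of _ sequentially "e\<^sup>2 / 2"] e by simp
    then obtain N' where N': "\<And>n. n \<ge> N' \<Longrightarrow> cmod (q (s N) (s n)) < e\<^sup>2 / 2"
      by (auto simp: eventually_sequentially)
    have "norm (Q.nn (s n) - 0) < e" if n: "n \<ge> max N N'" for n
    proof -
      have "q (s n) (s n) = q (\<lambda>x. s n x - s N x) (s n) + q (s N) (s n)"
        using Q.B_diff_left[OF sD sD sD] by simp
      then have "(Q.nn (s n))\<^sup>2 \<le> cmod (q (\<lambda>x. s n x - s N x) (s n)) + cmod (q (s N) (s n))"
        using Q.nn_sq[OF sD, of n] complex_Re_le_cmod[of "q (s n) (s n)"]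
          norm_triangle_ineq[of "q (\<lambda>x. s n x - s N x) (s n)" "q (s N) (s n)"] by simp
      also have "cmod (q (\<lambda>x. s n x - s N x) (s n)) \<le> Q.nn (\<lambda>x. s n x - s N x) * Q.nn (s n)"
        by (intro Q.cauchy_schwarz Q.V_diff sD)
      also have "\<dots> \<le> e\<^sup>2 / (2 * C) * C"
        using N[of n N] n C sD by (intro mult_mono) (auto simp: Q.V_diff)
      also have "cmod (q (s N) (s n)) < e\<^sup>2 / 2" using N' n by simp
      finally have "(Q.nn (s n))\<^sup>2 < e\<^sup>2" using C by simp
      then have "Q.nn (s n) < e" by (rule power2_less_imp_less) (use e in simp)
      then show ?thesis using sD by simp
    qed
    then show "\<exists>no. \<forall>n\<ge>no. norm (Q.nn (s n) - 0) < e" by blast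
  qed
qed

lemma q_diff_tendsto:
  assumes s: "fc s u" "fc s' u" and t: "fc t v" "fc t' v"
  shows "(\<lambda>n. q (s n) (t n) - q (s' n) (t' n)) \<longlonglongrightarrow> 0"
proof -
  have sD: "s n \<in> D" "s' n \<in> D" "t n \<in> D" "t' n \<in> D" for n using s t by (auto simp: fc_D)
  obtain C where C: "C > 0" "\<And>n. Q.nn (t n) \<le> C" using Q.cauchy_seq_bounded t(1) fc_iff by metis
  obtain C' where C': "C' > 0" "\<And>n. Q.nn (s' n) \<le> C'" using Q.cauchy_seq_bounded s(2) fc_iff by metis
  have eq: "q (s n) (t n) - q (s' n) (t' n) = q (\<lambda>x. s n x - s' n x) (t n) + q (s' n) (\<lambda>x. t n x - t' n x)" for n
    using sD by (simp add: Q.B_diff_left Q.B_diff_right)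
  have lims: "(\<lambda>n. Q.nn (\<lambda>x. s n x - s' n x)) \<longlonglongrightarrow> 0" "(\<lambda>n. Q.nn (\<lambda>x. t n x - t' n x)) \<longlonglongrightarrow> 0"
    using fc_null[of "\<lambda>n x. s n x - s' n x"] fc_null[of "\<lambda>n x. t n x - t' n x"]
      fc_diff[OF s] fc_diff[OF t] by auto
  have lim: "(\<lambda>n. Q.nn (\<lambda>x. s n x - s' n x) * C + C' * Q.nn (\<lambda>x. t n x - t' n x)) \<longlonglongrightarrow> 0"
    using lims by (auto intro!: tendsto_add_zero tendsto_mult_left_zero tendsto_mult_right_zero)
  show ?thesis
  proof (rule Lim_null_comparison[OF always_eventually lim], rule allI)
    fix n
    have "cmod (q (\<lambda>x. s n x - s' n x) (t n)) \<le> Q.nn (\<lambda>x. s n x - s' n x) * Q.nn (t n)"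
      by (intro Q.cauchy_schwarz Q.V_diff sD)
    also have "\<dots> \<le> Q.nn (\<lambda>x. s n x - s' n x) * C"
      using C sD by (intro mult_left_mono) (auto simp: Q.V_diff)
    finally have 1: "cmod (q (\<lambda>x. s n x - s' n x) (t n)) \<le> Q.nn (\<lambda>x. s n x - s' n x) * C" .
    have "cmod (q (s' n) (\<lambda>x. t n x - t' n x)) \<le> Q.nn (s' n) * Q.nn (\<lambda>x. t n x - t' n x)"
      by (intro Q.cauchy_schwarz Q.V_diff sD)
    also have "\<dots> \<le> C' * Q.nn (\<lambda>x. t n x - t' n x)"
      using C' sD by (intro mult_right_mono) (auto simp: Q.V_diff)
    finally show "norm (q (s n) (t n) - q (s' n) (t' n)) \<le> Q.nn (\<lambda>x. s n x - s' n x) * C + C' * Q.nn (\<lambda>x. t n x - t' n x)"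
      unfolding eq using 1 by (intro norm_triangle_le) linarith
  qed
qed

lemma q_Cauchy:
  assumes s: "fc s u" and t: "fc t v"
  shows "convergent (\<lambda>n. q (s n) (t n))"
proof -
  have sD: "s n \<in> D" "t n \<in> D" for n using s t by (auto simp: fc_D)
  have cs: "Q.cauchy_seq s" and ct: "Q.cauchy_seq t" using s t by (auto simp: fc_iff)
  obtain C where C: "C > 0" "\<And>n. Q.nn (t n) \<le> C" using Q.cauchy_seq_bounded[OF ct] by blast
  obtain C' where C': "C' > 0" "\<And>n. Q.nn (s n) \<le> C'" using Q.cauchy_seq_bounded[OF cs] by blast
  have "Cauchy (\<lambda>n. q (s n) (t n))"
  proof (rule metric_CauchyI)
    fix e :: real assume "e > 0"
    then have pos: "e / (2 * C) > 0" "e / (2 * C') > 0" using C C' by auto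
    obtain N1 where N1: "\<And>m n. m \<ge> N1 \<Longrightarrow> n \<ge> N1 \<Longrightarrow> Q.nn (\<lambda>x. s m x - s n x) < e / (2 * C)"
      using cs pos(1) unfolding Q.cauchy_seq_def by blast
    obtain N2 where N2: "\<And>m n. m \<ge> N2 \<Longrightarrow> n \<ge> N2 \<Longrightarrow> Q.nn (\<lambda>x. t m x - t n x) < e / (2 * C')"
      using ct pos(2) unfolding Q.cauchy_seq_def by blast
    have "dist (q (s m) (t m)) (q (s n) (t n)) < e" if mn: "m \<ge> max N1 N2" "n \<ge> max N1 N2" for m n
    proof -
      have eq: "q (s m) (t m) - q (s n) (t n) = q (\<lambda>x. s m x - s n x) (t m) + q (s n) (\<lambda>x. t m x - t n x)"
        using sD by (simp add: Q.B_diff_left Q.B_diff_right)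
      have "cmod (q (\<lambda>x. s m x - s n x) (t m)) \<le> Q.nn (\<lambda>x. s m x - s n x) * Q.nn (t m)"
        by (intro Q.cauchy_schwarz Q.V_diff sD)
      also have "\<dots> \<le> Q.nn (\<lambda>x. s m x - s n x) * C"
        using C sD by (intro mult_left_mono) (auto simp: Q.V_diff)
      also have "\<dots> < e / (2 * C) * C"
        using N1[of m n] mn C by (intro mult_strict_right_mono) auto
      finally have 1: "cmod (q (\<lambda>x. s m x - s n x) (t m)) < e / 2" using C by simp
      have "cmod (q (s n) (\<lambda>x. t m x - t n x)) \<le> Q.nn (s n) * Q.nn (\<lambda>x. t m x - t n x)"
        by (intro Q.cauchy_schwarz Q.V_diff sD)
      also have "\<dots> \<le> C' * Q.nn (\<lambda>x. t m x - t n x)"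
        using C' sD by (intro mult_right_mono) (auto simp: Q.V_diff)
      also have "\<dots> < C' * (e / (2 * C'))"
        using N2[of m n] mn C' by (intro mult_strict_left_mono) auto
      finally have 2: "cmod (q (s n) (\<lambda>x. t m x - t n x)) < e / 2" using C' by simp
      show ?thesis
        unfolding dist_norm eq using norm_triangle_ineq[of "q (\<lambda>x. s m x - s n x) (t m)" "q (s n) (\<lambda>x. t m x - t n x)"] 1 2
        by linarith
    qed
    then show "\<exists>M. \<forall>m\<ge>M. \<forall>n\<ge>M. dist (q (s m) (t m)) (q (s n) (t n)) < e" by blast
  qed
  then show ?thesis by (rule Cauchy_convergent)
qed

text \<open>Unlocks the definite description in \<open>form_closure\<close>: the limit exists by
  \<open>q_Cauchy\<close>, and it does not depend on the approximating sequences by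
  \<open>q_diff_tendsto\<close>.\<close>

lemma qc_tendsto:
  assumes s: "fc s u" and t: "fc t v"
  shows "(\<lambda>n. q (s n) (t n)) \<longlonglongrightarrow> qc u v"
proof -
  obtain c where c: "(\<lambda>n. q (s n) (t n)) \<longlonglongrightarrow> c" using q_Cauchy[OF s t] by (auto simp: convergent_def)
  have all: "(\<lambda>n. q (s' n) (t' n)) \<longlonglongrightarrow> c" if "fc s' u" "fc t' v" for s' t'
    using Lim_transform[OF c q_diff_tendsto[OF that(1) s that(2) t]] by simp
  have "qc u v = c"
    unfolding form_closure_def
  proof (rule the_equality)
    show "\<forall>s t. fc s u \<longrightarrow> fc t v \<longrightarrow> (\<lambda>n. q (s n) (t n)) \<longlonglongrightarrow> c" using all by blast
    show "d = c" if "\<forall>s t. fc s u \<longrightarrow> fc t v \<longrightarrow> (\<lambda>n. q (s n) (t n)) \<longlonglongrightarrow> d" for d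
      using that s t c LIMSEQ_unique by blast
  qed
  with c show ?thesis by simp
qed

lemma domI: "fc s u \<Longrightarrow> u \<in> dom" by (auto simp: form_closure_dom_def)

lemma domE:
  assumes "u \<in> dom" obtains s where "fc s u"
  using assms by (auto simp: form_closure_dom_def)

lemma dom_L2: "u \<in> dom \<Longrightarrow> u \<in> L2 M" using domE fc_L2 by metis
lemma D_dom: "u \<in> D \<Longrightarrow> u \<in> dom" using domI fc_const by blast

lemma qc_eqI: "fc s u \<Longrightarrow> fc t v \<Longrightarrow> (\<lambda>n. q (s n) (t n)) \<longlonglongrightarrow> c \<Longrightarrow> qc u v = c"
  using qc_tendsto LIMSEQ_unique by blast

lemma qc_D: "u \<in> D \<Longrightarrow> v \<in> D \<Longrightarrow> qc u v = q u v"
  by (rule qc_eqI[OF fc_const fc_const]) auto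

lemma closure_sesquilinear: "sesquilinear dom qc"
proof
  show "(\<lambda>x. 0) \<in> dom" by (intro D_dom Q.V_zero)
  fix u assume "u \<in> dom"
  then obtain s where s: "fc s u" by (rule domE)
  note sD = fc_D[OF s]
  show "(\<lambda>x. c * u x) \<in> dom" for c by (rule domI[OF fc_scale[OF s]])
  have "(\<lambda>n. Re (q (s n) (s n))) \<longlonglongrightarrow> Re (qc u u)"
    by (intro tendsto_Re qc_tendsto s)
  then show "0 \<le> Re (qc u u)"
    using Q.B_pos[OF sD] by (intro LIMSEQ_le_const) auto
  fix v assume "v \<in> dom"
  then obtain t where t: "fc t v" by (rule domE)
  note tD = fc_D[OF t]
  show "(\<lambda>x. u x + v x) \<in> dom" by (rule domI[OF fc_add[OF s t]])
  show "qc (\<lambda>x. c * u x) v = c * qc u v" for c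
  proof (rule qc_eqI[OF fc_scale[OF s] t])
    have "(\<lambda>n. c * q (s n) (t n)) \<longlonglongrightarrow> c * qc u v" by (intro tendsto_intros qc_tendsto s t)
    then show "(\<lambda>n. q (\<lambda>x. c * s n x) (t n)) \<longlonglongrightarrow> c * qc u v" by (simp add: Q.B_scale_left[OF sD tD])
  qed
  show "qc v u = cnj (qc u v)"
  proof (rule qc_eqI[OF t s])
    have "(\<lambda>n. cnj (q (s n) (t n))) \<longlonglongrightarrow> cnj (qc u v)" by (intro tendsto_cnj qc_tendsto s t)
    then show "(\<lambda>n. q (t n) (s n)) \<longlonglongrightarrow> cnj (qc u v)" by (simp add: Q.B_herm[OF sD tD])
  qed
  fix w assume "w \<in> dom"
  then obtain r where r: "fc r w" by (rule domE)
  note rD = fc_D[OF r]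
  show "qc (\<lambda>x. u x + v x) w = qc u w + qc v w"
  proof (rule qc_eqI[OF fc_add[OF s t] r])
    have "(\<lambda>n. q (s n) (r n) + q (t n) (r n)) \<longlonglongrightarrow> qc u w + qc v w" by (intro tendsto_intros qc_tendsto s t r)
    then show "(\<lambda>n. q (\<lambda>x. s n x + t n x) (r n)) \<longlonglongrightarrow> qc u w + qc v w" by (simp add: Q.B_add_left[OF sD tD rD])
  qed
qed

sublocale C: sesquilinear dom qc by (rule closure_sesquilinear)

lemma closure_nn_tendsto:
  assumes "fc s u"
  shows "(\<lambda>n. Q.nn (s n)) \<longlonglongrightarrow> C.nn u"
  unfolding Q.nn_def C.nn_def by (intro tendsto_real_sqrt tendsto_Re qc_tendsto assms)

lemma closure_nn_D: "u \<in> D \<Longrightarrow> C.nn u = Q.nn u"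
  by (simp add: C.nn_def Q.nn_def qc_D)

lemma fc_converges_to:
  assumes s: "fc s u"
  shows "C.converges_to s u"
proof -
  note sD = fc_D[OF s]
  have u: "u \<in> dom" by (rule domI[OF s])
  have cau: "Q.cauchy_seq s" using s by (simp add: fc_iff)
  have "(\<lambda>n. C.nn (\<lambda>x. s n x - u x)) \<longlonglongrightarrow> 0"
  proof (rule LIMSEQ_I)
    fix e :: real assume "e > 0"
    then have "e / 2 > 0" by simp
    then obtain N where N: "\<And>m n. m \<ge> N \<Longrightarrow> n \<ge> N \<Longrightarrow> Q.nn (\<lambda>x. s m x - s n x) < e / 2"
      using cau unfolding Q.cauchy_seq_def by blast
    have "norm (C.nn (\<lambda>x. s n x - u x) - 0) < e" if n: "n \<ge> N" for n
    proof -
      have "(\<lambda>m. Q.nn (\<lambda>x. s n x - s m x)) \<longlonglongrightarrow> C.nn (\<lambda>x. s n x - u x)"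
        by (rule closure_nn_tendsto[OF fc_diff[OF fc_const[OF sD] s]])
      moreover have "\<exists>K. \<forall>m\<ge>K. Q.nn (\<lambda>x. s n x - s m x) \<le> e / 2"
        using N[OF n] by (intro exI[of _ N]) (auto intro: less_imp_le)
      ultimately have "C.nn (\<lambda>x. s n x - u x) \<le> e / 2" by (rule LIMSEQ_le_const2)
      moreover have "0 \<le> C.nn (\<lambda>x. s n x - u x)" by (intro C.nn_nonneg C.V_diff D_dom sD u)
      ultimately show ?thesis using \<open>e > 0\<close> by simp
    qed
    then show "\<exists>no. \<forall>n\<ge>no. norm (C.nn (\<lambda>x. s n x - u x) - 0) < e" by blast
  qed
  with u show ?thesis by (simp add: C.converges_to_def D_dom sD)
qed

text \<open>The form norm, which makes the domain of the closure a Hilbert space.\<close>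

definition energy :: "('a \<Rightarrow> complex) \<Rightarrow> ('a \<Rightarrow> complex) \<Rightarrow> complex" where
  "energy u v = qc u v + L2_inner M u v"

sublocale E: sesquilinear dom energy
  by unfold_locales
    (simp_all add: energy_def C.V_zero C.V_add C.V_scale C.B_add_left C.B_scale_left
      L.B_add_left L.B_scale_left dom_L2 distrib_left C.B_pos L.B_pos
      C.B_herm[symmetric] L.B_herm[symmetric])

lemma energy_nn: "u \<in> dom \<Longrightarrow> (E.nn u)\<^sup>2 = (C.nn u)\<^sup>2 + (L.nn u)\<^sup>2"
  by (simp add: E.nn_sq C.nn_sq L.nn_sq dom_L2) (simp add: energy_def)

lemma closure_nn_le: "u \<in> dom \<Longrightarrow> C.nn u \<le> E.nn u"
  by (rule power2_le_imp_le) (simp_all add: energy_nn)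

lemma L2_nn_le: "u \<in> dom \<Longrightarrow> L.nn u \<le> E.nn u"
  by (rule power2_le_imp_le) (simp_all add: energy_nn)

lemma energy_nn_le: "u \<in> dom \<Longrightarrow> E.nn u \<le> C.nn u + L.nn u"
  by (rule power2_le_imp_le) (simp_all add: energy_nn dom_L2 power2_sum)

lemma fc_converges_to_energy:
  assumes s: "fc s u"
  shows "E.converges_to s u"
proof -
  have V: "s n \<in> dom" "u \<in> dom" for n using s by (auto intro: D_dom fc_D domI)
  have lim: "(\<lambda>n. C.nn (\<lambda>x. s n x - u x) + L.nn (\<lambda>x. s n x - u x)) \<longlonglongrightarrow> 0"
    using fc_converges_to[OF s] s unfolding fc_iff C.converges_to_def L.converges_to_def
    by (intro tendsto_add_zero) auto
  have "(\<lambda>n. E.nn (\<lambda>x. s n x - u x)) \<longlonglongrightarrow> 0"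
    by (rule tendsto_sandwich[OF always_eventually always_eventually tendsto_const lim])
      (auto intro!: E.nn_nonneg energy_nn_le C.V_diff V)
  then show ?thesis using V by (simp add: E.converges_to_def)
qed

text \<open>The closure is defined through sequences in \<open>D\<close>, so each member of a Cauchy
  sequence is first replaced by an element of \<open>D\<close> at distance below 1/(k+1). The L2
  limit of the replacements lies in \<open>dom\<close> and is also the limit of the original
  sequence in the form norm.\<close>

sublocale E: complete_sesquilinear dom energy
proof
  fix s assume cau: "E.cauchy_seq s"
  then have sV: "s n \<in> dom" for n by (simp add: E.cauchy_seq_def)
  have "\<exists>d\<in>D. E.nn (\<lambda>x. s k x - d x) < inverse (real (Suc k))" for k
  proof -
    obtain t where t: "fc t (s k)" using domE[OF sV] .
    have "(\<lambda>n. E.nn (\<lambda>x. t n x - s k x)) \<longlonglongrightarrow> 0"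
      using fc_converges_to_energy[OF t] by (simp add: E.converges_to_def)
    from order_tendstoD(2)[OF this, of "inverse (real (Suc k))"]
    obtain n where "E.nn (\<lambda>x. t n x - s k x) < inverse (real (Suc k))"
      by (auto simp: eventually_sequentially)
    then have "E.nn (\<lambda>x. s k x - t n x) < inverse (real (Suc k))"
      using E.nn_diff_commute[OF sV D_dom[OF fc_D[OF t]]] by simp
    then show ?thesis using fc_D[OF t] by blast
  qed
  then obtain d where d: "\<And>k. d k \<in> D" "\<And>k. E.nn (\<lambda>x. s k x - d k x) < inverse (real (Suc k))"
    by metis
  have dV: "d k \<in> dom" for k by (rule D_dom[OF d(1)])
  have cau_d: "\<exists>N. \<forall>m\<ge>N. \<forall>n\<ge>N. E.nn (\<lambda>x. d m x - d n x) < e" if e: "e > 0" for e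
  proof -
    have e3: "e / 3 > 0" using e by simp
    obtain N1 where N1: "\<And>m n. m \<ge> N1 \<Longrightarrow> n \<ge> N1 \<Longrightarrow> E.nn (\<lambda>x. s m x - s n x) < e / 3"
      using cau e3 unfolding E.cauchy_seq_def by blast
    obtain N2 where N2: "inverse (real (Suc N2)) < e / 3" using reals_Archimedean[OF e3] by blast
    have small: "E.nn (\<lambda>x. s k x - d k x) < e / 3" if "k \<ge> N2" for k
    proof -
      have "inverse (real (Suc k)) \<le> inverse (real (Suc N2))" using that by (auto intro!: le_imp_inverse_le)
      then show ?thesis using d(2)[of k] N2 by (meson less_le_trans less_trans)
    qed
    have "E.nn (\<lambda>x. d m x - d n x) < e" if "m \<ge> max N1 N2" "n \<ge> max N1 N2" for m n
    proof -
      have "E.nn (\<lambda>x. d m x - d n x) \<le> E.nn (\<lambda>x. d m x - s m x) + E.nn (\<lambda>x. s m x - d n x)"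
        by (rule E.nn_triangle) (rule dV sV)+
      also have "E.nn (\<lambda>x. s m x - d n x) \<le> E.nn (\<lambda>x. s m x - s n x) + E.nn (\<lambda>x. s n x - d n x)"
        by (rule E.nn_triangle) (rule dV sV)+
      also have "E.nn (\<lambda>x. d m x - s m x) = E.nn (\<lambda>x. s m x - d m x)"
        by (rule E.nn_diff_commute) (rule dV sV)+
      finally show ?thesis using small[of m] small[of n] N1[of m n] that by auto
    qed
    then show ?thesis by blast
  qed
  have Q_le: "Q.nn (\<lambda>x. d m x - d n x) \<le> E.nn (\<lambda>x. d m x - d n x)" for m n
    using closure_nn_le[OF C.V_diff[OF dV dV]] closure_nn_D[OF Q.V_diff[OF d(1) d(1)]] by metis
  have cauQ: "Q.cauchy_seq d"
    unfolding Q.cauchy_seq_def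
  proof (intro conjI allI impI d)
    fix e :: real assume "e > 0"
    then show "\<exists>N. \<forall>m\<ge>N. \<forall>n\<ge>N. Q.nn (\<lambda>x. d m x - d n x) < e"
      using cau_d Q_le le_less_trans by meson
  qed
  have dL2: "d k \<in> L2 M" for k by (rule dom_L2[OF dV])
  have "\<exists>u\<in>L2 M. (\<lambda>n. L2_norm M (\<lambda>x. d n x - u x)) \<longlonglongrightarrow> 0"
  proof (rule L2_complete[OF dL2])
    fix e :: real assume "e > 0"
    moreover have "L2_norm M (\<lambda>x. d m x - d n x) \<le> E.nn (\<lambda>x. d m x - d n x)" for m n
      using L2_nn_le[OF C.V_diff[OF dV dV]] L2_norm_nn[OF L.V_diff[OF dL2 dL2]] by metis
    ultimately show "\<exists>N. \<forall>m\<ge>N. \<forall>n\<ge>N. L2_norm M (\<lambda>x. d m x - d n x) < e"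
      using cau_d le_less_trans by meson
  qed
  then obtain u where u: "u \<in> L2 M" "(\<lambda>n. L2_norm M (\<lambda>x. d n x - u x)) \<longlonglongrightarrow> 0" by blast
  have "L.converges_to d u"
    using u dL2 L2_norm_nn[OF L.V_diff[OF dL2 u(1)]] by (simp add: L.converges_to_def)
  with cauQ have fc: "fc d u" by (simp add: fc_iff)
  have uV: "u \<in> dom" by (rule domI[OF fc])
  have "(\<lambda>n. E.nn (\<lambda>x. s n x - u x)) \<longlonglongrightarrow> 0"
  proof (rule tendsto_sandwich[OF always_eventually always_eventually tendsto_const])
    have "(\<lambda>n. inverse (real (Suc n)) + E.nn (\<lambda>x. d n x - u x)) \<longlonglongrightarrow> 0 + 0"
      using fc_converges_to_energy[OF fc]
      by (intro tendsto_add LIMSEQ_inverse_real_of_nat) (simp add: E.converges_to_def)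
    then show "(\<lambda>n. inverse (real (Suc n)) + E.nn (\<lambda>x. d n x - u x)) \<longlonglongrightarrow> 0" by simp
    show "\<forall>n. E.nn (\<lambda>x. s n x - u x) \<le> inverse (real (Suc n)) + E.nn (\<lambda>x. d n x - u x)"
      using E.nn_triangle[OF sV dV uV] d(2) by (meson add_le_cancel_right less_imp_le order_trans)
    show "\<forall>n. 0 \<le> E.nn (\<lambda>x. s n x - u x)" by (intro allI E.nn_nonneg C.V_diff sV uV)
  qed
  then show "\<exists>u. E.converges_to s u" using sV uV by (auto simp: E.converges_to_def)
qed

end

text \<open>For s = q(u,u) and t = |u|^2 the values s - z t fill the cone spanned by 1 and -z. When
  z lies off [0, infinity), this cone without its apex can be rotated by e into the open right half
  plane, and the rotated form is coercive as \<open>lax_milgram\<close> demands.\<close>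

lemma shifted_coercive:
  assumes "z \<notin> complex_of_real ` {0..}"
  shows "\<exists>(e :: complex) c. 0 < c \<and>
    (\<forall>s t. 0 \<le> s \<longrightarrow> 0 \<le> t \<longrightarrow> c * (s + t) \<le> Re (e * (of_real s - z * of_real t)))"
proof (cases "Im z = 0")
  case True
  have neg: "Re z < 0"
  proof (rule ccontr)
    assume "\<not> Re z < 0"
    then have "z = complex_of_real (Re z)" "Re z \<in> {0..}" using True by (auto simp: complex_eq_iff)
    with assms show False by blast
  qed
  define c where "c = min 1 (- Re z)"
  have c: "c \<le> 1" "c \<le> - Re z" by (auto simp: c_def)
  show ?thesis
  proof (rule exI[of _ "1 :: complex"], rule exI[of _ c], intro conjI allI impI)
    show "c > 0" using neg by (simp add: c_def)
    fix s t :: real assume "0 \<le> s" "0 \<le> t"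
    then have "c * s \<le> 1 * s" "c * t \<le> - Re z * t"
      using c by (intro mult_right_mono; simp)+
    then show "c * (s + t) \<le> Re (1 * (of_real s - z * of_real t))"
      by (simp add: algebra_simps)
  qed
next
  case False
  \<comment> \<open>Small enough that \<eta> Re z <= |Im z| / 2; the summand 1 avoids a zero
    denominator.\<close>
  define \<eta> where "\<eta> = \<bar>Im z\<bar> / (2 * (\<bar>Re z\<bar> + 1))"
  define e where "e = Complex \<eta> (sgn (Im z))"
  define c where "c = min \<eta> (\<bar>Im z\<bar> / 2)"
  have \<eta>: "\<eta> > 0" using False by (simp add: \<eta>_def)
  have c: "c \<le> \<eta>" "c \<le> \<bar>Im z\<bar> / 2" by (auto simp: c_def)
  have "\<eta> * Re z \<le> \<eta> * (\<bar>Re z\<bar> + 1)" using \<eta> by (intro mult_left_mono) auto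
  also have "\<dots> = \<bar>Im z\<bar> / 2" by (simp add: \<eta>_def field_simps add_nonneg_eq_0_iff)
  finally have 1: "\<eta> * Re z \<le> \<bar>Im z\<bar> / 2" .
  have 2: "Re (e * z) \<le> - (\<bar>Im z\<bar> / 2)"
    using 1 by (simp add: e_def linordered_idom_class.abs_sgn mult.commute)
  show ?thesis
  proof (intro exI[of _ e] exI[of _ c] conjI allI impI)
    show "c > 0" using \<eta> False by (simp add: c_def)
    fix s t :: real assume st: "0 \<le> s" "0 \<le> t"
    define p where "p = Re (e * z)"
    have "c * s \<le> \<eta> * s" "c * t \<le> - p * t"
      using c 2 st by (intro mult_right_mono; simp add: p_def)+
    moreover have "Re (e * (of_real s - z * of_real t)) = \<eta> * s - p * t"
      by (simp add: p_def e_def algebra_simps)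
    ultimately show "c * (s + t) \<le> Re (e * (of_real s - z * of_real t))"
      by (simp add: distrib_left)
  qed
qed

section \<open>Resolvent of the Friedrichs extension and Weyl's criterion\<close>

context nonneg_symmetric
begin

lemma friedrichs_iff:
  "(u, f) \<in> friedrichs_extension M D T \<longleftrightarrow>
     u \<in> dom \<and> f \<in> L2 M \<and> (\<forall>v\<in>dom. qc u v = L2_inner M f v)"
  by (simp add: friedrichs_extension_def Let_def)

text \<open>Lax-Milgram for the rotated form in the energy space gives the weak solution; testing it
  with v = u gives the L2 bound with constant |e| / c.\<close>

lemma resolvent_exists:
  assumes z: "z \<notin> complex_of_real ` {0..}"
  shows "\<exists>K. \<forall>f\<in>L2 M. \<exists>u\<in>dom. (\<forall>v\<in>dom. qc u v - z * L2_inner M u v = L2_inner M f v) \<and>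
    L2_norm M u \<le> K * L2_norm M f"
proof -
  obtain e c where c: "c > 0"
    and coer: "\<And>s t. 0 \<le> s \<Longrightarrow> 0 \<le> t \<Longrightarrow> c * (s + t) \<le> Re (e * (of_real s - z * of_real t))"
    using shifted_coercive[OF z] by blast
  have e0: "e \<noteq> 0" using coer[of 1 1] c by auto
  define b where "b u v = e * (qc u v - z * L2_inner M u v)" for u v
  have coercive: "c * (E.nn u)\<^sup>2 \<le> Re (b u u)" if u: "u \<in> dom" for u
    using coer[of "(C.nn u)\<^sup>2" "(L.nn u)\<^sup>2"] energy_nn[OF u] C.B_self'[OF u] L.B_self'[OF dom_L2[OF u]]
    by (simp add: b_def)
  have b_bound: "cmod (b u v) \<le> (cmod e * (1 + cmod z)) * E.nn u * E.nn v" if u: "u \<in> dom" and v: "v \<in> dom" for u v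
  proof -
    have "cmod (qc u v) \<le> C.nn u * C.nn v" by (rule C.cauchy_schwarz[OF u v])
    also have "\<dots> \<le> E.nn u * E.nn v"
      using u v by (intro mult_mono closure_nn_le) auto
    finally have 1: "cmod (qc u v) \<le> E.nn u * E.nn v" .
    have "cmod (L2_inner M u v) \<le> L.nn u * L.nn v" by (rule L.cauchy_schwarz[OF dom_L2[OF u] dom_L2[OF v]])
    also have "\<dots> \<le> E.nn u * E.nn v"
      using u v dom_L2 by (intro mult_mono L2_nn_le) auto
    finally have "cmod z * cmod (L2_inner M u v) \<le> cmod z * (E.nn u * E.nn v)"
      by (intro mult_left_mono) auto
    then have "cmod (qc u v - z * L2_inner M u v) \<le> E.nn u * E.nn v + cmod z * (E.nn u * E.nn v)"
      using norm_triangle_ineq4[of "qc u v" "z * L2_inner M u v"] 1 by (simp add: norm_mult)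
    then have "cmod e * cmod (qc u v - z * L2_inner M u v) \<le> cmod e * (E.nn u * E.nn v + cmod z * (E.nn u * E.nn v))"
      by (intro mult_left_mono) auto
    then show ?thesis unfolding b_def norm_mult by (simp add: algebra_simps)
  qed
  show ?thesis
  proof (intro exI[of _ "cmod e / c"] ballI)
    fix f assume f: "f \<in> L2 M"
    have "\<exists>u\<in>dom. \<forall>v\<in>dom. b u v = e * L2_inner M f v"
    proof (rule E.lax_milgram[of b "cmod e * (1 + cmod z)" c "\<lambda>v. e * L2_inner M f v" "cmod e * L.nn f"])
      show "cmod (e * L2_inner M f u) \<le> cmod e * L.nn f * E.nn u" if u: "u \<in> dom" for u
      proof -
        have "cmod (L2_inner M f u) \<le> L.nn f * L.nn u" by (rule L.cauchy_schwarz[OF f dom_L2[OF u]])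
        also have "\<dots> \<le> L.nn f * E.nn u" using L2_nn_le[OF u] f by (intro mult_left_mono) auto
        finally show ?thesis by (simp add: norm_mult mult.assoc mult_left_mono)
      qed
    qed (use coercive b_bound c f in \<open>simp_all add: b_def C.B_add_left C.B_add_right C.B_scale_left C.B_scale_right
          L.B_add_left L.B_add_right L.B_scale_left L.B_scale_right dom_L2 algebra_simps\<close>)
    then obtain u where u: "u \<in> dom" "\<And>v. v \<in> dom \<Longrightarrow> b u v = e * L2_inner M f v" by blast
    have uL: "u \<in> L2 M" by (rule dom_L2[OF u(1)])
    have "c * (L.nn u)\<^sup>2 \<le> c * (E.nn u)\<^sup>2"
      using c L2_nn_le[OF u(1)] uL by (intro mult_left_mono power_mono) auto
    also have "\<dots> \<le> cmod (b u u)" using coercive[OF u(1)] complex_Re_le_cmod[of "b u u"] by linarith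
    also have "\<dots> = cmod e * cmod (L2_inner M f u)" using u by (simp add: norm_mult)
    also have "\<dots> \<le> cmod e * (L.nn f * L.nn u)"
      by (intro mult_left_mono L.cauchy_schwarz f uL) auto
    finally have le: "(c * L.nn u) * L.nn u \<le> (cmod e * L.nn f) * L.nn u"
      by (simp add: power2_eq_square mult_ac)
    have "c * L.nn u \<le> cmod e * L.nn f"
    proof (cases "L.nn u = 0")
      case True
      then show ?thesis using f by simp
    next
      case False
      then have "L.nn u > 0" using L.nn_nonneg[OF uL] by linarith
      with le show ?thesis by simp
    qed
    then have "L2_norm M u \<le> cmod e / c * L2_norm M f"
      using c f uL by (simp add: L2_norm_nn field_simps)
    moreover have "\<forall>v\<in>dom. qc u v - z * L2_inner M u v = L2_inner M f v"
      using u(2) e0 by (simp add: b_def)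
    ultimately show "\<exists>u\<in>dom. (\<forall>v\<in>dom. qc u v - z * L2_inner M u v = L2_inner M f v) \<and>
        L2_norm M u \<le> cmod e / c * L2_norm M f"
      using u(1) by blast
  qed
qed

lemma resolvent_unique:
  assumes z: "z \<notin> complex_of_real ` {0..}" and w: "w \<in> dom"
    and eq: "\<And>v. v \<in> dom \<Longrightarrow> qc w v = z * L2_inner M w v"
  shows "L2_norm M w = 0"
proof -
  obtain e c where c: "c > 0"
    and coer: "\<And>s t. 0 \<le> s \<Longrightarrow> 0 \<le> t \<Longrightarrow> c * (s + t) \<le> Re (e * (of_real s - z * of_real t))"
    using shifted_coercive[OF z] by blast
  have "c * ((C.nn w)\<^sup>2 + (L.nn w)\<^sup>2) \<le> Re (e * (qc w w - z * L2_inner M w w))"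
    using coer[of "(C.nn w)\<^sup>2" "(L.nn w)\<^sup>2"] C.B_self'[OF w] L.B_self'[OF dom_L2[OF w]] by simp
  also have "\<dots> = 0" using eq[OF w] by simp
  finally have "(C.nn w)\<^sup>2 + (L.nn w)\<^sup>2 \<le> 0" using c by (simp add: mult_le_0_iff)
  then have "(L.nn w)\<^sup>2 \<le> 0" using zero_le_power2[of "C.nn w"] by linarith
  then show ?thesis using L2_norm_nn[OF dom_L2[OF w]] by simp
qed

text \<open>Provides the inclusion of the spectrum in [0, infinity). Uniqueness of weak solutions
  holds in seminorm only, which is why R inverts H - z almost everywhere and not pointwise.\<close>

theorem resolvent_set_friedrichs:
  assumes z: "z \<notin> complex_of_real ` {0..}"
  shows "z \<in> resolvent_set M (friedrichs_extension M D T)"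
proof -
  obtain K where K: "\<And>f. f \<in> L2 M \<Longrightarrow> \<exists>u\<in>dom. (\<forall>v\<in>dom. qc u v - z * L2_inner M u v = L2_inner M f v) \<and>
    L2_norm M u \<le> K * L2_norm M f"
    using resolvent_exists[OF z] by blast
  then obtain R where R: "\<And>f. f \<in> L2 M \<Longrightarrow> R f \<in> dom"
    "\<And>f v. f \<in> L2 M \<Longrightarrow> v \<in> dom \<Longrightarrow> qc (R f) v - z * L2_inner M (R f) v = L2_inner M f v"
    "\<And>f. f \<in> L2 M \<Longrightarrow> L2_norm M (R f) \<le> K * L2_norm M f"
    by metis
  have in_H: "(R f, \<lambda>x. f x + z * R f x) \<in> friedrichs_extension M D T" if f: "f \<in> L2 M" for f
    unfolding friedrichs_iff
  proof (intro conjI ballI)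
    show "R f \<in> dom" by (rule R(1)[OF f])
    have RL: "R f \<in> L2 M" by (rule dom_L2[OF R(1)[OF f]])
    show "(\<lambda>x. f x + z * R f x) \<in> L2 M" by (intro L.V_add L.V_scale f RL)
    fix v assume v: "v \<in> dom"
    have "L2_inner M (\<lambda>x. f x + z * R f x) v = L2_inner M f v + z * L2_inner M (R f) v"
      using f RL dom_L2[OF v] by (simp add: L.B_add_left L.B_scale_left L.V_scale)
    then show "qc (R f) v = L2_inner M (\<lambda>x. f x + z * R f x) v"
      using R(2)[OF f v] by (simp add: algebra_simps)
  qed
  have left_inverse: "AE x in M. R (\<lambda>y. h y - z * u y) x = u x" if uh: "(u, h) \<in> friedrichs_extension M D T" for u h
  proof -
    have u: "u \<in> dom" and h: "h \<in> L2 M" and qu: "\<And>v. v \<in> dom \<Longrightarrow> qc u v = L2_inner M h v"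
      using uh by (auto simp: friedrichs_iff)
    have uL: "u \<in> L2 M" by (rule dom_L2[OF u])
    define f where "f = (\<lambda>y. h y - z * u y)"
    have f: "f \<in> L2 M" unfolding f_def by (intro L.V_diff L.V_scale h uL)
    define w where "w = (\<lambda>x. R f x - u x)"
    have w: "w \<in> dom" unfolding w_def by (intro C.V_diff R f u)
    have "qc w v = z * L2_inner M w v" if v: "v \<in> dom" for v
    proof -
      have vL: "v \<in> L2 M" by (rule dom_L2[OF v])
      have "L2_inner M f v = L2_inner M h v - z * L2_inner M u v"
        unfolding f_def using h uL vL by (simp add: L.B_diff_left L.B_scale_left L.V_scale)
      then show ?thesis
        unfolding w_def using R(2)[OF f v] qu[OF v] R(1)[OF f] u v vL uL dom_L2[OF R(1)[OF f]]
        by (simp add: C.B_diff_left L.B_diff_left algebra_simps)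
    qed
    then have "L2_norm M w = 0" by (rule resolvent_unique[OF z w])
    then have "AE x in M. w x = 0" by (rule L2_norm_eq_0_AE[OF dom_L2[OF w]])
    then show ?thesis by (simp add: w_def f_def)
  qed
  show ?thesis
    unfolding resolvent_set_def
    using in_H R(3) left_inverse by (intro CollectI exI[of _ R] exI[of _ K]) auto
qed

text \<open>
  Weyl's criterion in form sense: it suffices to control \<open>\<langle>(T - \<mu>) u, v\<rangle>\<close> by the form norm of \<open>v\<close>.
\<close>

theorem weyl_criterion:
  fixes \<mu> :: real
  assumes approx: "\<And>\<delta>. \<delta> > 0 \<Longrightarrow> \<exists>u\<in>D. L2_norm M u > 0 \<and>
    (\<forall>v\<in>D. cmod (q u v - of_real \<mu> * L2_inner M u v) \<le> \<delta> * L2_norm M u * (L2_norm M v + Q.nn v))"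
  shows "complex_of_real \<mu> \<in> op_spectrum M (friedrichs_extension M D T)"
proof (rule ccontr)
  assume "complex_of_real \<mu> \<notin> op_spectrum M (friedrichs_extension M D T)"
  then obtain R K where R: "\<And>f. f \<in> L2 M \<Longrightarrow> (R f, \<lambda>x. f x + of_real \<mu> * R f x) \<in> friedrichs_extension M D T"
    and K: "\<And>f. f \<in> L2 M \<Longrightarrow> L2_norm M (R f) \<le> K * L2_norm M f"
    by (auto simp: op_spectrum_def resolvent_set_def)
  define K' where "K' = max K 0"
  have K': "K' \<ge> 0" "\<And>f. f \<in> L2 M \<Longrightarrow> L2_norm M (R f) \<le> K' * L2_norm M f"
  proof -
    show "L2_norm M (R f) \<le> K' * L2_norm M f" if "f \<in> L2 M" for f
      using K[OF that] mult_right_mono[of K K' "L2_norm M f"] by (simp add: K'_def)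
  qed (simp add: K'_def)
  \<comment> \<open>For w = R u, the sum of the L2 norm and the form seminorm of w is at most B |u|.
    Testing the approximate eigenvalue equation with v = w gives |u|^2 <= \<delta> B |u|^2, which
    \<delta> = 1/(2 B) contradicts.\<close>
  define B where "B = K' + sqrt ((1 + \<bar>\<mu>\<bar> * K') * K') + 1"
  have B: "B > 0" using K' by (simp add: B_def add_nonneg_pos)
  define \<delta> where "\<delta> = 1 / (2 * B)"
  have "\<delta> > 0" using B by (simp add: \<delta>_def)
  then obtain u where u: "u \<in> D" "L2_norm M u > 0"
    and est: "\<And>v. v \<in> D \<Longrightarrow> cmod (q u v - of_real \<mu> * L2_inner M u v) \<le> \<delta> * L2_norm M u * (L2_norm M v + Q.nn v)"
    using approx by blast
  note uL = D_in_L2[OF u(1)]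
  \<comment> \<open>The test vector R u is only known to lie in the form domain, so the estimate is
    carried over from \<open>D\<close> to the closure.\<close>
  have est': "cmod (qc u v - of_real \<mu> * L2_inner M u v) \<le> \<delta> * L2_norm M u * (L.nn v + C.nn v)" if v: "v \<in> dom" for v
  proof -
    obtain t where t: "fc t v" using domE[OF v] .
    then have tL: "L.converges_to t v" by (simp add: fc_iff)
    have "(\<lambda>n. cmod (q u (t n) - of_real \<mu> * L2_inner M u (t n))) \<longlonglongrightarrow> cmod (qc u v - of_real \<mu> * L2_inner M u v)"
      by (intro tendsto_intros qc_tendsto[OF fc_const[OF u(1)] t] L.converges_to_B[OF L.converges_to_const[OF uL] tL])
    moreover have "(\<lambda>n. \<delta> * L2_norm M u * (L.nn (t n) + Q.nn (t n))) \<longlonglongrightarrow> \<delta> * L2_norm M u * (L.nn v + C.nn v)"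
      by (intro tendsto_intros L.converges_to_nn[OF tL] closure_nn_tendsto[OF t])
    moreover have "cmod (q u (t n) - of_real \<mu> * L2_inner M u (t n)) \<le> \<delta> * L2_norm M u * (L.nn (t n) + Q.nn (t n))" for n
      using est[OF fc_D[OF t]] L2_norm_nn[OF D_in_L2[OF fc_D[OF t]]] by simp
    ultimately show ?thesis by (intro LIMSEQ_le) auto
  qed
  define w where "w = R u"
  have w: "w \<in> dom" "\<And>v. v \<in> dom \<Longrightarrow> qc w v = L2_inner M (\<lambda>x. u x + of_real \<mu> * w x) v"
    using R[OF uL] by (auto simp: friedrichs_iff w_def)
  note wL = dom_L2[OF w(1)]
  have inner: "L2_inner M (\<lambda>x. u x + of_real \<mu> * w x) v = L2_inner M u v + of_real \<mu> * L2_inner M w v" if "v \<in> L2 M" for v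
    using uL wL that by (simp add: L.B_add_left L.B_scale_left L.V_scale)
  define N where "N = L.nn u"
  have N: "N > 0" using u(2) L2_norm_nn[OF uL] by (simp add: N_def)
  have wN: "L.nn w \<le> K' * N"
    using K'(2)[OF uL] L2_norm_nn[OF uL] L2_norm_nn[OF wL] by (simp add: w_def N_def)
  have w0: "0 \<le> L.nn w" using wL by simp
  have "(C.nn w)\<^sup>2 \<le> cmod (qc w w)" using C.nn_sq[OF w(1)] complex_Re_le_cmod[of "qc w w"] by simp
  also have "\<dots> \<le> cmod (L2_inner M u w) + \<bar>\<mu>\<bar> * cmod (L2_inner M w w)"
    using w(2)[OF w(1)] inner[OF wL] norm_triangle_ineq[of "L2_inner M u w" "of_real \<mu> * L2_inner M w w"]
    by (simp add: norm_mult)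
  also have "\<dots> \<le> N * L.nn w + \<bar>\<mu>\<bar> * (L.nn w * L.nn w)"
    unfolding N_def by (intro add_mono mult_left_mono L.cauchy_schwarz uL wL) auto
  also have "\<dots> \<le> N * (K' * N) + \<bar>\<mu>\<bar> * ((K' * N) * (K' * N))"
    using wN w0 N K' by (intro add_mono mult_left_mono mult_mono) auto
  also have "\<dots> = (sqrt ((1 + \<bar>\<mu>\<bar> * K') * K') * N)\<^sup>2"
    using K' by (simp add: power_mult_distrib) (simp add: power2_eq_square algebra_simps)
  finally have Cw: "C.nn w \<le> sqrt ((1 + \<bar>\<mu>\<bar> * K') * K') * N"
    by (rule power2_le_imp_le) (use N K' in simp)
  have "L2_inner M u u = qc w u - of_real \<mu> * L2_inner M w u"
    using w(2)[OF D_dom[OF u(1)]] inner[OF uL] by simp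
  also have "\<dots> = cnj (qc u w - of_real \<mu> * L2_inner M u w)"
    using C.B_herm[OF D_dom[OF u(1)] w(1)] L.B_herm[OF uL wL] by simp
  finally have "cmod (L2_inner M u u) = cmod (qc u w - of_real \<mu> * L2_inner M u w)"
    by (metis complex_mod_cnj)
  moreover have "cmod (L2_inner M u u) = N\<^sup>2"
    using L.B_self'[OF uL] by (simp add: N_def del: of_real_power)
  ultimately have "N\<^sup>2 \<le> \<delta> * N * (L.nn w + C.nn w)"
    using est'[OF w(1)] L2_norm_nn[OF uL] by (simp add: N_def)
  also have "\<dots> \<le> \<delta> * N * (B * N)"
  proof (intro mult_left_mono)
    show "L.nn w + C.nn w \<le> B * N" using wN Cw N by (simp add: B_def distrib_right)
  qed (use N \<open>\<delta> > 0\<close> in auto)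
  also have "\<dots> = N\<^sup>2 / 2" using B by (simp add: \<delta>_def power2_eq_square)
  finally show False using N by simp
qed

end

section \<open>Smooth functions\<close>

text \<open>A localised form of \<open>times_cont_differentiable\<close>: smoothness on the whole
  space is later proved on the members of an open cover and glued with
  \<open>Ck_on_Un\<close>.\<close>

primrec Ck_on :: "nat \<Rightarrow> 'a::euclidean_space set \<Rightarrow> ('a \<Rightarrow> 'b::real_normed_vector) \<Rightarrow> bool" where
  "Ck_on 0 U f \<longleftrightarrow> continuous_on U f"
| "Ck_on (Suc k) U f \<longleftrightarrow>
     (\<forall>x\<in>U. f differentiable at x) \<and> (\<forall>b\<in>Basis. Ck_on k U (partial_deriv b f))"

definition smooth_on :: "'a::euclidean_space set \<Rightarrow> ('a \<Rightarrow> 'b::real_normed_vector) \<Rightarrow> bool" where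
  "smooth_on U f \<longleftrightarrow> (\<forall>k. Ck_on k U f)"

lemma Ck_on_UNIV: "Ck_on k UNIV f \<longleftrightarrow> times_cont_differentiable k f"
  by (induction k arbitrary: f) (auto simp: differentiable_on_def)

lemma partial_deriv_eqI: "(f has_derivative f') (at x) \<Longrightarrow> partial_deriv b f x = f' b"
  unfolding partial_deriv_def by (metis frechet_derivative_at)

lemma has_derivative_frechet: "f differentiable at x \<Longrightarrow> (f has_derivative frechet_derivative f (at x)) (at x)"
  by (simp add: frechet_derivative_works)

lemma partial_deriv_cong_open:
  assumes "open U" "x \<in> U" "f differentiable at x" "\<And>y. y \<in> U \<Longrightarrow> f y = g y"
  shows "partial_deriv b f x = partial_deriv b g x"
  unfolding partial_deriv_def using frechet_derivative_transform_within_open[OF assms(3,1,2,4)] by simp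

lemma differentiable_cong_open:
  assumes "open U" "x \<in> U" "f differentiable at x" "\<And>y. y \<in> U \<Longrightarrow> f y = g y"
  shows "g differentiable at x"
  using assms has_derivative_transform_within_open unfolding differentiable_def by metis

lemma Ck_on_continuous: "Ck_on k U f \<Longrightarrow> continuous_on U f"
  by (cases k) (auto intro!: differentiable_imp_continuous_on simp: differentiable_on_def differentiable_at_withinI)

lemma Ck_on_Suc: "Ck_on (Suc k) U f \<Longrightarrow> Ck_on k U f"
proof (induction k arbitrary: f)
  case 0
  then show ?case using Ck_on_continuous[of "Suc 0" U f] by simp
next
  case (Suc k)
  then show ?case by (metis Ck_on.simps(2))
qed

lemma Ck_on_cong:
  assumes "open U"
  shows "Ck_on k U f \<Longrightarrow> (\<And>x. x \<in> U \<Longrightarrow> f x = g x) \<Longrightarrow> Ck_on k U g"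
proof (induction k arbitrary: f g)
  case 0
  then show ?case by (simp cong: continuous_on_cong)
next
  case (Suc k)
  have d: "f differentiable at x" if "x \<in> U" for x using Suc.prems that by simp
  have "Ck_on k U (partial_deriv b g)" if "b \<in> Basis" for b
  proof (rule Suc.IH[of "partial_deriv b f"])
    show "Ck_on k U (partial_deriv b f)" using Suc.prems that by simp
    show "partial_deriv b f x = partial_deriv b g x" if "x \<in> U" for x
      using partial_deriv_cong_open[OF assms that d[OF that] Suc.prems(2)] .
  qed
  moreover have "g differentiable at x" if "x \<in> U" for x
    using differentiable_cong_open[OF assms that d[OF that] Suc.prems(2)] .
  ultimately show ?case by simp
qed

lemma Ck_on_subset: "Ck_on k U f \<Longrightarrow> V \<subseteq> U \<Longrightarrow> Ck_on k V f"
  by (induction k arbitrary: f) (auto intro: continuous_on_subset)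

lemma Ck_on_Un: "open U \<Longrightarrow> open V \<Longrightarrow> Ck_on k U f \<Longrightarrow> Ck_on k V f \<Longrightarrow> Ck_on k (U \<union> V) f"
  by (induction k arbitrary: f) (auto intro: continuous_on_open_Un)

lemma Ck_on_add:
  assumes "open U"
  shows "Ck_on k U f \<Longrightarrow> Ck_on k U g \<Longrightarrow> Ck_on k U (\<lambda>x. f x + g x)"
proof (induction k arbitrary: f g)
  case (Suc k)
  have d: "f differentiable at x" "g differentiable at x" if "x \<in> U" for x using Suc.prems that by auto
  have "Ck_on k U (partial_deriv b (\<lambda>x. f x + g x))" if b: "b \<in> Basis" for b
  proof (rule Ck_on_cong[OF assms])
    show "Ck_on k U (\<lambda>x. partial_deriv b f x + partial_deriv b g x)"
      by (rule Suc.IH) (use Suc.prems b in auto)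
    show "partial_deriv b f x + partial_deriv b g x = partial_deriv b (\<lambda>x. f x + g x) x" if "x \<in> U" for x
      using partial_deriv_eqI[OF has_derivative_add[OF d[OF that, THEN has_derivative_frechet]], of b]
      by (simp add: partial_deriv_def)
  qed
  then show ?case using d by simp
qed (auto intro: continuous_on_add)

lemma Ck_on_mult:
  fixes f g :: "'a::euclidean_space \<Rightarrow> 'b::real_normed_algebra"
  assumes "open U"
  shows "Ck_on k U f \<Longrightarrow> Ck_on k U g \<Longrightarrow> Ck_on k U (\<lambda>x. f x * g x)"
proof (induction k arbitrary: f g)
  case (Suc k)
  have d: "f differentiable at x" "g differentiable at x" if "x \<in> U" for x using Suc.prems that by auto
  have "Ck_on k U (partial_deriv b (\<lambda>x. f x * g x))" if b: "b \<in> Basis" for b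
  proof (rule Ck_on_cong[OF assms])
    show "Ck_on k U (\<lambda>x. f x * partial_deriv b g x + partial_deriv b f x * g x)"
      using Suc.prems b Suc.prems[THEN Ck_on_Suc] by (intro Ck_on_add[OF assms] Suc.IH) auto
    show "f x * partial_deriv b g x + partial_deriv b f x * g x = partial_deriv b (\<lambda>x. f x * g x) x" if "x \<in> U" for x
      using partial_deriv_eqI[OF has_derivative_mult[OF d[OF that, THEN has_derivative_frechet]], of b]
      by (simp add: partial_deriv_def)
  qed
  then show ?case using d by (auto intro!: differentiable_mult)
qed (auto intro: continuous_on_mult)

lemma Ck_on_linear:
  assumes "open U" and L: "bounded_linear L"
  shows "Ck_on k U f \<Longrightarrow> Ck_on k U (\<lambda>x. L (f x))"
proof (induction k arbitrary: f)
  case 0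
  then show ?case using bounded_linear.continuous_on[OF L] by auto
next
  case (Suc k)
  have d: "((\<lambda>x. L (f x)) has_derivative (\<lambda>h. L (frechet_derivative f (at x) h))) (at x)" if "x \<in> U" for x
    using Suc.prems that by (intro bounded_linear.has_derivative[OF L] has_derivative_frechet) auto
  have "Ck_on k U (partial_deriv b (\<lambda>x. L (f x)))" if b: "b \<in> Basis" for b
  proof (rule Ck_on_cong[OF assms(1)])
    show "Ck_on k U (\<lambda>x. L (partial_deriv b f x))"
      by (rule Suc.IH) (use Suc.prems b in auto)
    show "L (partial_deriv b f x) = partial_deriv b (\<lambda>x. L (f x)) x" if "x \<in> U" for x
      using partial_deriv_eqI[OF d[OF that]] by (simp add: partial_deriv_def)
  qed
  then show ?case using d by (auto simp: differentiable_def)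
qed

lemma Ck_on_const: "Ck_on k U (\<lambda>x. c)"
proof (induction k arbitrary: c)
  case (Suc k)
  have "partial_deriv b (\<lambda>x. c) = (\<lambda>x. 0)" for b :: 'a
    by (rule ext, rule partial_deriv_eqI[THEN trans]) auto
  with Suc show ?case by simp
qed simp

text \<open>F is a family closed under differentiation, and the induction on k generalises over its
  index p. This replaces a formula for higher derivatives of a composition; the instance is
  \<open>flat_fun\<close>.\<close>

lemma Ck_on_compose_real:
  fixes F :: "'i \<Rightarrow> real \<Rightarrow> real" and f :: "'a::euclidean_space \<Rightarrow> real"
  assumes "open U" and F: "\<And>p t. (F p has_real_derivative F (nx p) t) (at t)"
  shows "Ck_on k U f \<Longrightarrow> Ck_on k U (\<lambda>x. F p (f x))"
proof (induction k arbitrary: p)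
  case 0
  have "continuous_on UNIV (F p)" using F by (auto intro!: DERIV_continuous_on)
  with 0 show ?case by (auto intro: continuous_on_compose2)
next
  case (Suc k)
  have d: "((\<lambda>x. F p (f x)) has_derivative (\<lambda>h. frechet_derivative f (at x) h * F (nx p) (f x))) (at x)" if "x \<in> U" for x
  proof -
    have "(f has_derivative frechet_derivative f (at x)) (at x)"
      using Suc.prems that by (intro has_derivative_frechet) simp
    from has_derivative_compose[OF this F[of p, THEN has_field_derivative_imp_has_derivative]]
    show ?thesis by (simp add: mult.commute)
  qed
  have "Ck_on k U (partial_deriv b (\<lambda>x. F p (f x)))" if b: "b \<in> Basis" for b
  proof (rule Ck_on_cong[OF assms(1)])
    show "Ck_on k U (\<lambda>x. partial_deriv b f x * F (nx p) (f x))"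
      using Suc.prems b Ck_on_Suc[OF Suc.prems] by (intro Ck_on_mult[OF assms(1)] Suc.IH) auto
    show "partial_deriv b f x * F (nx p) (f x) = partial_deriv b (\<lambda>x. F p (f x)) x" if "x \<in> U" for x
      using partial_deriv_eqI[OF d[OF that]] by (simp add: partial_deriv_def)
  qed
  then show ?case using d by (auto simp: differentiable_def)
qed

lemma Ck_on_exp:
  fixes f :: "'a::euclidean_space \<Rightarrow> complex"
  assumes "open U"
  shows "Ck_on k U f \<Longrightarrow> Ck_on k U (\<lambda>x. exp (f x))"
proof (induction k)
  case 0
  then show ?case by (auto intro: continuous_on_exp)
next
  case (Suc k)
  have d: "((\<lambda>x. exp (f x)) has_derivative (\<lambda>h. frechet_derivative f (at x) h * exp (f x))) (at x)" if "x \<in> U" for x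
  proof -
    have "(f has_derivative frechet_derivative f (at x)) (at x)"
      using Suc.prems that by (intro has_derivative_frechet) simp
    from has_derivative_compose[OF this has_field_derivative_imp_has_derivative[OF DERIV_exp]]
    show ?thesis by (simp add: mult.commute)
  qed
  have "Ck_on k U (partial_deriv b (\<lambda>x. exp (f x)))" if b: "b \<in> Basis" for b
  proof (rule Ck_on_cong[OF assms(1)])
    show "Ck_on k U (\<lambda>x. partial_deriv b f x * exp (f x))"
      using Suc.prems b Ck_on_Suc[OF Suc.prems] by (intro Ck_on_mult[OF assms(1)] Suc.IH) auto
    show "partial_deriv b f x * exp (f x) = partial_deriv b (\<lambda>x. exp (f x)) x" if "x \<in> U" for x
      using partial_deriv_eqI[OF d[OF that]] by (simp add: partial_deriv_def)
  qed
  then show ?case using d by (auto simp: differentiable_def)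
qed

lemma Ck_on_holomorphic:
  assumes "open U"
  shows "g holomorphic_on U \<Longrightarrow> Ck_on k U g"
proof (induction k arbitrary: g)
  case 0
  then show ?case by (simp add: holomorphic_on_imp_continuous_on)
next
  case (Suc k)
  have d: "(g has_derivative (\<lambda>h. deriv g x * h)) (at x)" if "x \<in> U" for x
    using holomorphic_derivI[OF Suc.prems assms that] by (simp add: has_field_derivative_def)
  have "Ck_on k U (partial_deriv b g)" if b: "b \<in> Basis" for b
  proof (rule Ck_on_cong[OF assms(1)])
    show "Ck_on k U (\<lambda>x. deriv g x * b)"
      by (intro Suc.IH holomorphic_intros holomorphic_deriv Suc.prems assms)
    show "deriv g x * b = partial_deriv b g x" if "x \<in> U" for x
      using partial_deriv_eqI[OF d[OF that]] by simp
  qed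
  then show ?case using d by (auto simp: differentiable_def)
qed

lemma smooth_on_partial_deriv:
  assumes "smooth_on U f" "b \<in> Basis" shows "smooth_on U (partial_deriv b f)"
  using assms unfolding smooth_on_def by (metis Ck_on.simps(2))

lemma smooth_on_differentiable:
  assumes "smooth_on U f" "x \<in> U" shows "f differentiable at x"
  using assms unfolding smooth_on_def by (metis Ck_on.simps(2))

lemma smooth_on_continuous: "smooth_on U f \<Longrightarrow> continuous_on U f"
  unfolding smooth_on_def by (metis Ck_on.simps(1))

lemma smooth_onI_partial:
  assumes "\<And>x. x \<in> U \<Longrightarrow> f differentiable at x" "\<And>b. b \<in> Basis \<Longrightarrow> smooth_on U (partial_deriv b f)"
  shows "smooth_on U f"
  unfolding smooth_on_def
proof
  fix k
  show "Ck_on k U f"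
    using assms Ck_on_Suc[of k U f] by (simp add: smooth_on_def)
qed

lemma smooth_on_cong: "open U \<Longrightarrow> smooth_on U f \<Longrightarrow> (\<And>x. x \<in> U \<Longrightarrow> f x = g x) \<Longrightarrow> smooth_on U g"
  unfolding smooth_on_def using Ck_on_cong by blast

lemma smooth_on_subset: "smooth_on U f \<Longrightarrow> V \<subseteq> U \<Longrightarrow> smooth_on V f"
  unfolding smooth_on_def using Ck_on_subset by blast

lemma smooth_on_Un: "open U \<Longrightarrow> open V \<Longrightarrow> smooth_on U f \<Longrightarrow> smooth_on V f \<Longrightarrow> smooth_on (U \<union> V) f"
  unfolding smooth_on_def using Ck_on_Un by blast

lemma smooth_on_const: "smooth_on U (\<lambda>x. c)"
  unfolding smooth_on_def using Ck_on_const by blast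

lemma smooth_on_add: "open U \<Longrightarrow> smooth_on U f \<Longrightarrow> smooth_on U g \<Longrightarrow> smooth_on U (\<lambda>x. f x + g x)"
  unfolding smooth_on_def using Ck_on_add by blast

lemma smooth_on_mult:
  fixes f g :: "'a::euclidean_space \<Rightarrow> 'b::real_normed_algebra"
  shows "open U \<Longrightarrow> smooth_on U f \<Longrightarrow> smooth_on U g \<Longrightarrow> smooth_on U (\<lambda>x. f x * g x)"
  unfolding smooth_on_def using Ck_on_mult by blast

lemma smooth_on_linear: "open U \<Longrightarrow> bounded_linear L \<Longrightarrow> smooth_on U f \<Longrightarrow> smooth_on U (\<lambda>x. L (f x))"
  unfolding smooth_on_def using Ck_on_linear by blast

lemma smooth_on_exp:
  fixes f :: "'a::euclidean_space \<Rightarrow> complex"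
  shows "open U \<Longrightarrow> smooth_on U f \<Longrightarrow> smooth_on U (\<lambda>x. exp (f x))"
  unfolding smooth_on_def using Ck_on_exp by blast

lemma smooth_on_holomorphic: "open U \<Longrightarrow> g holomorphic_on U \<Longrightarrow> smooth_on U g"
  unfolding smooth_on_def using Ck_on_holomorphic by blast

text \<open>Any compact set outside which u vanishes may stand for the closed support, and such a
  set is easier to exhibit.\<close>

lemma test_functions_iff:
  "u \<in> test_functions U \<longleftrightarrow> smooth_on UNIV u \<and> (\<exists>K. compact K \<and> K \<subseteq> U \<and> (\<forall>x. x \<notin> K \<longrightarrow> u x = 0))"
proof
  assume "u \<in> test_functions U"
  then show "smooth_on UNIV u \<and> (\<exists>K. compact K \<and> K \<subseteq> U \<and> (\<forall>x. x \<notin> K \<longrightarrow> u x = 0))"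
    unfolding test_functions_def smooth_on_def Ck_on_UNIV
    using closure_subset[of "{x. u x \<noteq> 0}"] by blast
next
  assume "smooth_on UNIV u \<and> (\<exists>K. compact K \<and> K \<subseteq> U \<and> (\<forall>x. x \<notin> K \<longrightarrow> u x = 0))"
  then obtain K where u: "smooth_on UNIV u" and K: "compact K" "K \<subseteq> U" "\<And>x. x \<notin> K \<Longrightarrow> u x = 0" by blast
  have sub: "closure {x. u x \<noteq> 0} \<subseteq> K"
    using K by (intro closure_minimal) (auto intro: compact_imp_closed)
  then have "compact (closure {x. u x \<noteq> 0})"
    using K(1) by (metis closed_closure compact_Int_closed inf.absorb2)
  with sub K(2) u show "u \<in> test_functions U"
    unfolding test_functions_def smooth_on_def Ck_on_UNIV by auto
qed

section \<open>Integrals of compactly supported functions and of their derivatives\<close>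

lemma continuous_compact_support_integrable:
  fixes f :: "'a::euclidean_space \<Rightarrow> 'b::{banach, second_countable_topology}"
  assumes "continuous_on UNIV f" "compact K" "\<And>x. x \<notin> K \<Longrightarrow> f x = 0"
  shows "integrable lborel f"
proof -
  have "integrable lborel (\<lambda>x. indicator K x *\<^sub>R f x)"
    using assms by (intro borel_integrable_compact continuous_on_subset[OF assms(1)]) auto
  also have "(\<lambda>x. indicator K x *\<^sub>R f x) = f"
    using assms(3) by (auto simp: indicator_def fun_eq_iff)
  finally show ?thesis .
qed

lemma partial_deriv_eq_0:
  assumes "closed K" "\<And>x. x \<notin> K \<Longrightarrow> f x = 0" "x \<notin> K"
  shows "partial_deriv b f x = 0"
proof -
  have "(f has_derivative (\<lambda>h. 0)) (at x)"
    by (rule has_derivative_transform_within_open[of "\<lambda>_. 0" "\<lambda>_. 0" x UNIV "- K"]) (use assms in auto)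
  then show ?thesis by (rule partial_deriv_eqI)
qed

text \<open>By translation invariance the difference quotients of \<open>f\<close> integrate to zero.\<close>

lemma integral_partial_deriv_eq_0:
  fixes f :: "'a::euclidean_space \<Rightarrow> complex"
  assumes diff: "\<And>x. f differentiable at x" and cont: "continuous_on UNIV (partial_deriv b f)"
    and K: "compact K" "\<And>x. x \<notin> K \<Longrightarrow> f x = 0" and b: "b \<in> Basis"
  shows "(\<integral>x. partial_deriv b f x \<partial>lborel) = 0"
proof -
  have fcont: "continuous_on UNIV f"
    using diff by (auto intro!: differentiable_imp_continuous_on simp: differentiable_on_def)
  have fint: "integrable lborel f"
    by (rule continuous_compact_support_integrable[OF fcont K])
  have [measurable]: "f \<in> borel_measurable borel"
    using fcont by (rule borel_measurable_continuous_onI)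
  have [measurable]: "partial_deriv b f \<in> borel_measurable borel"
    using cont by (rule borel_measurable_continuous_onI)
  have pd0: "partial_deriv b f x = 0" if "x \<notin> K" for x
    using partial_deriv_eq_0[OF compact_imp_closed[OF K(1)] K(2) that] .
  have "compact (partial_deriv b f ` K)"
    using K(1) cont by (intro compact_continuous_image continuous_on_subset[OF cont]) auto
  then obtain C where C: "C > 0" "\<And>x. x \<in> K \<Longrightarrow> norm (partial_deriv b f x) \<le> C"
    using bounded_pos compact_imp_bounded by (metis imageI)
  then have C': "norm (partial_deriv b f x) \<le> C" for x
    using pd0[of x] by (cases "x \<in> K") auto
  obtain r where "\<And>x. x \<in> K \<Longrightarrow> norm x \<le> r"
    using compact_imp_bounded[OF K(1)] unfolding bounded_iff by blast
  then have r: "K \<subseteq> cball 0 r" by auto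
  have line: "((\<lambda>s. f (x + s *\<^sub>R b)) has_derivative (\<lambda>h. h *\<^sub>R partial_deriv b f (x + s *\<^sub>R b))) (at s within S)" for x s S
  proof -
    have "((\<lambda>s. f (x + s *\<^sub>R b)) has_derivative (\<lambda>h. frechet_derivative f (at (x + s *\<^sub>R b)) (h *\<^sub>R b))) (at s within S)"
      by (rule has_derivative_compose[of "\<lambda>s. x + s *\<^sub>R b" "\<lambda>h. h *\<^sub>R b" s S f])
        (auto intro!: derivative_eq_intros has_derivative_frechet diff)
    moreover have "frechet_derivative f (at (x + s *\<^sub>R b)) (h *\<^sub>R b) = h *\<^sub>R partial_deriv b f (x + s *\<^sub>R b)" for h
      unfolding partial_deriv_def
      by (rule linear_scale) (rule has_derivative_linear[OF has_derivative_frechet[OF diff]])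
    ultimately show ?thesis by simp
  qed
  define t where "t n = inverse (real (Suc n))" for n
  have t: "0 < t n" "t n \<le> 1" for n by (auto simp: t_def field_simps)
  define g where "g n x = (f (x + t n *\<^sub>R b) - f x) /\<^sub>R t n" for n x
  have [measurable]: "g n \<in> borel_measurable borel" for n
    unfolding g_def by measurable
  have g_int: "(\<integral>x. g n x \<partial>lborel) = 0" for n
  proof -
    have "integrable (distr lborel borel ((+) (t n *\<^sub>R b))) f" "integral\<^sup>L (distr lborel borel ((+) (t n *\<^sub>R b))) f = integral\<^sup>L lborel f"
      using fint by (simp_all add: lborel_distr_plus)
    then have 1: "integrable lborel (\<lambda>x. f (t n *\<^sub>R b + x))" "(\<integral>x. f (t n *\<^sub>R b + x) \<partial>lborel) = integral\<^sup>L lborel f"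
      by (simp_all add: integrable_distr_eq integral_distr)
    show ?thesis
      unfolding g_def using 1 fint by (simp add: add.commute)
  qed
  \<comment> \<open>The steps \<open>t n\<close> are at most 1, so all difference quotients vanish
    outside the ball of radius r + 1; inside, the mean value inequality bounds them by C.\<close>
  have "(\<lambda>n. \<integral>x. g n x \<partial>lborel) \<longlonglongrightarrow> (\<integral>x. partial_deriv b f x \<partial>lborel)"
  proof (rule integral_dominated_convergence[where w = "\<lambda>x. indicator (cball 0 (r + 1)) x * C"])
    have "integrable lborel (\<lambda>x :: 'a. indicator (cball 0 (r + 1)) x *\<^sub>R C)"
      by (intro borel_integrable_compact) auto
    then show "integrable lborel (\<lambda>x :: 'a. indicator (cball 0 (r + 1)) x * C)" by simp
    show "AE x in lborel. (\<lambda>n. g n x) \<longlonglongrightarrow> partial_deriv b f x"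
    proof (rule AE_I2)
      fix x
      have "((\<lambda>s. f (x + s *\<^sub>R b)) has_derivative (\<lambda>h. h *\<^sub>R partial_deriv b f x)) (at 0)"
        using line[of x 0 UNIV] by simp
      then have lim: "((\<lambda>h. norm (f (x + h *\<^sub>R b) - f x - h *\<^sub>R partial_deriv b f x) / norm h) \<longlongrightarrow> 0) (at 0)"
        by (simp add: has_derivative_at)
      have "t \<longlonglongrightarrow> 0" unfolding t_def by (rule LIMSEQ_inverse_real_of_nat)
      moreover have "\<forall>\<^sub>F n in sequentially. t n \<noteq> 0" using t by (auto intro!: always_eventually simp: less_le)
      ultimately have "filterlim t (at 0) sequentially" by (simp add: filterlim_at)
      from filterlim_compose[OF lim this]
      have "(\<lambda>n. norm (f (x + t n *\<^sub>R b) - f x - t n *\<^sub>R partial_deriv b f x) / norm (t n)) \<longlonglongrightarrow> 0" .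
      also have "(\<lambda>n. norm (f (x + t n *\<^sub>R b) - f x - t n *\<^sub>R partial_deriv b f x) / norm (t n)) = (\<lambda>n. norm (g n x - partial_deriv b f x))"
      proof
        fix n
        have "g n x - partial_deriv b f x = (f (x + t n *\<^sub>R b) - f x - t n *\<^sub>R partial_deriv b f x) /\<^sub>R t n"
          using t[of n] by (simp add: g_def scaleR_diff_right)
        then show "norm (f (x + t n *\<^sub>R b) - f x - t n *\<^sub>R partial_deriv b f x) / norm (t n) = norm (g n x - partial_deriv b f x)"
          by (simp add: divide_inverse mult.commute)
      qed
      finally show "(\<lambda>n. g n x) \<longlonglongrightarrow> partial_deriv b f x"
        by (simp add: tendsto_norm_zero_iff LIM_zero_iff)
    qed
    show "AE x in lborel. norm (g n x) \<le> indicator (cball 0 (r + 1)) x * C" for n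
    proof (rule AE_I2)
      fix x
      show "norm (g n x) \<le> indicator (cball 0 (r + 1)) x * C"
      proof (cases "x \<in> cball 0 (r + 1)")
        case True
        have "norm (f (x + t n *\<^sub>R b) - f (x + 0 *\<^sub>R b)) \<le> C * norm (t n - 0)"
        proof (rule differentiable_bound[of UNIV])
          fix s :: real
          show "((\<lambda>s. f (x + s *\<^sub>R b)) has_derivative (\<lambda>h. h *\<^sub>R partial_deriv b f (x + s *\<^sub>R b))) (at s within UNIV)"
            by (rule line)
          show "onorm (\<lambda>h. h *\<^sub>R partial_deriv b f (x + s *\<^sub>R b)) \<le> C"
            by (rule onorm_le) (simp add: mult.commute[of C] mult_left_mono C')
        qed auto
        then have "norm (f (x + t n *\<^sub>R b) - f x) / t n \<le> C"
          using t[of n] by (simp add: field_simps)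
        then show ?thesis using True t[of n] by (simp add: g_def divide_inverse mult.commute)
      next
        case False
        then have nx: "norm x > r + 1" by simp
        have "norm x \<le> norm (x + t n *\<^sub>R b) + norm (t n *\<^sub>R b)"
          using norm_triangle_ineq4[of "x + t n *\<^sub>R b" "t n *\<^sub>R b"] by simp
        moreover have "norm (t n *\<^sub>R b) \<le> 1" using t[of n] b by simp
        ultimately have "norm (x + t n *\<^sub>R b) > r" "norm x > r" using nx by linarith+
        then have "x + t n *\<^sub>R b \<notin> K" "x \<notin> K" using r by auto
        then have "g n x = 0" using K(2) by (simp add: g_def)
        then show ?thesis using False by simp
      qed
    qed
  qed measurable
  then show ?thesis using g_int LIMSEQ_unique[OF _ tendsto_const] by (simp add: LIMSEQ_const_iff)
qed

section \<open>Magnetic derivatives\<close>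

lemma smooth_on_minus:
  fixes f g :: "'a::euclidean_space \<Rightarrow> 'b::real_normed_vector"
  assumes "open U" "smooth_on U f" "smooth_on U g"
  shows "smooth_on U (\<lambda>x. f x - g x)"
  using smooth_on_add[OF assms(1,2) smooth_on_linear[OF assms(1) bounded_linear_minus[OF bounded_linear_ident] assms(3)]]
  by simp

lemma partial_deriv_add:
  assumes "f differentiable at x" "g differentiable at x"
  shows "partial_deriv b (\<lambda>x. f x + g x) x = partial_deriv b f x + partial_deriv b g x"
  using partial_deriv_eqI[OF has_derivative_add[OF assms[THEN has_derivative_frechet]]]
  by (simp add: partial_deriv_def)

lemma partial_deriv_mult:
  fixes f g :: "'a::euclidean_space \<Rightarrow> 'b::real_normed_algebra"
  assumes "f differentiable at x" "g differentiable at x"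
  shows "partial_deriv b (\<lambda>x. f x * g x) x = f x * partial_deriv b g x + partial_deriv b f x * g x"
  using partial_deriv_eqI[OF has_derivative_mult[OF assms[THEN has_derivative_frechet]]]
  by (simp add: partial_deriv_def)

lemma partial_deriv_linear:
  assumes "bounded_linear L" "f differentiable at x"
  shows "partial_deriv b (\<lambda>x. L (f x)) x = L (partial_deriv b f x)"
  using partial_deriv_eqI[OF bounded_linear.has_derivative[OF assms(1) has_derivative_frechet[OF assms(2)]]]
  by (simp add: partial_deriv_def)

lemma test_functionsE:
  assumes "u \<in> test_functions U"
  obtains K where "smooth_on UNIV u" "compact K" "K \<subseteq> U" "\<And>x. x \<notin> K \<Longrightarrow> u x = 0"
  using assms unfolding test_functions_iff by blast

lemma test_functionsI:
  assumes "smooth_on UNIV u" "compact K" "K \<subseteq> U" "\<And>x. x \<notin> K \<Longrightarrow> u x = 0"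
  shows "u \<in> test_functions U"
  using assms unfolding test_functions_iff by blast

lemma test_functions_differentiable: "u \<in> test_functions U \<Longrightarrow> u differentiable at x"
  unfolding test_functions_iff using smooth_on_differentiable by blast

lemma test_functions_zero: "(\<lambda>x. 0) \<in> test_functions U"
  by (rule test_functionsI[OF smooth_on_const, of "{}"]) auto

lemma test_functions_add:
  assumes "u \<in> test_functions U" "v \<in> test_functions U"
  shows "(\<lambda>x. u x + v x) \<in> test_functions U"
proof -
  obtain K where K: "smooth_on UNIV u" "compact K" "K \<subseteq> U" "\<And>x. x \<notin> K \<Longrightarrow> u x = 0"
    using assms(1) by (rule test_functionsE) blast
  obtain L where L: "smooth_on UNIV v" "compact L" "L \<subseteq> U" "\<And>x. x \<notin> L \<Longrightarrow> v x = 0"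
    using assms(2) by (rule test_functionsE) blast
  show ?thesis
    by (rule test_functionsI[of _ "K \<union> L"]) (use K L in \<open>auto intro: smooth_on_add\<close>)
qed

lemma test_functions_mult:
  assumes "u \<in> test_functions U" "smooth_on UNIV v"
  shows "(\<lambda>x. u x * v x) \<in> test_functions U"
proof -
  obtain K where K: "smooth_on UNIV u" "compact K" "K \<subseteq> U" "\<And>x. x \<notin> K \<Longrightarrow> u x = 0"
    using assms(1) by (rule test_functionsE) blast
  show ?thesis
    by (rule test_functionsI[of _ K]) (use K assms(2) in \<open>auto intro: smooth_on_mult\<close>)
qed

lemma test_functions_scale: "u \<in> test_functions U \<Longrightarrow> (\<lambda>x. c * u x) \<in> test_functions U"
  using test_functions_mult[OF _ smooth_on_const, of u U c] by (simp add: mult.commute)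

lemma test_functions_sum:
  "(\<And>i. i \<in> I \<Longrightarrow> f i \<in> test_functions U) \<Longrightarrow> (\<lambda>x. \<Sum>i\<in>I. f i x) \<in> test_functions U"
  by (induction I rule: infinite_finite_induct) (auto intro: test_functions_zero test_functions_add)

lemma test_functions_smooth: "u \<in> test_functions U \<Longrightarrow> smooth_on UNIV u"
  unfolding test_functions_iff by blast

lemma test_functions_L2:
  assumes "u \<in> test_functions U"
  shows "u \<in> L2 lborel"
proof -
  obtain K where K: "smooth_on UNIV u" "compact K" "K \<subseteq> U" "\<And>x. x \<notin> K \<Longrightarrow> u x = 0"
    using assms by (rule test_functionsE) blast
  have c: "continuous_on UNIV u" by (rule smooth_on_continuous[OF K(1)])
  have "integrable lborel (\<lambda>x. (cmod (u x))\<^sup>2)"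
    by (rule continuous_compact_support_integrable[of _ K]) (use K c in \<open>auto intro!: continuous_intros\<close>)
  moreover have "u \<in> borel_measurable lborel"
    using borel_measurable_continuous_onI[OF c] by simp
  ultimately show ?thesis by (simp add: L2_def)
qed

lemma test_functions_integral_partial_deriv:
  assumes "u \<in> test_functions U" "b \<in> Basis"
  shows "(\<integral>x. partial_deriv b u x \<partial>lborel) = 0"
proof -
  obtain K where K: "smooth_on UNIV u" "compact K" "K \<subseteq> U" "\<And>x. x \<notin> K \<Longrightarrow> u x = 0"
    using assms(1) by (rule test_functionsE) blast
  show ?thesis
    by (rule integral_partial_deriv_eq_0[of u b K])
      (use K assms in \<open>auto intro: smooth_on_continuous smooth_on_partial_deriv test_functions_differentiable\<close>)
qed

locale smooth_potential =
  fixes U :: "'a::euclidean_space set" and a :: "'a \<Rightarrow> 'a"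
  assumes open_U: "open U"
    and smooth_a: "b \<in> Basis \<Longrightarrow> smooth_on U (\<lambda>x. complex_of_real (a x \<bullet> b))"
begin

text \<open>\<open>a\<close> is smooth only on U, but the result is zero off the compact set K that
  supports u, and U together with the complement of K covers the space.\<close>

lemma magnetic_deriv_test:
  assumes u: "u \<in> test_functions U" and b: "b \<in> Basis"
  shows "magnetic_deriv a b u \<in> test_functions U"
proof -
  obtain K where K: "smooth_on UNIV u" "compact K" "K \<subseteq> U" "\<And>x. x \<notin> K \<Longrightarrow> u x = 0"
    using u by (rule test_functionsE) blast
  have closed: "closed K" by (rule compact_imp_closed[OF K(2)])
  have zero: "magnetic_deriv a b u x = 0" if "x \<notin> K" for x
    using partial_deriv_eq_0[OF closed K(4) that] K(4)[OF that] by (simp add: magnetic_deriv_def)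
  have "smooth_on U (magnetic_deriv a b u)"
    unfolding magnetic_deriv_def[abs_def]
    by (intro smooth_on_minus smooth_on_mult smooth_on_const open_U smooth_a b smooth_on_partial_deriv)
      (rule smooth_on_subset[OF K(1)]; simp)+
  moreover have "smooth_on (- K) (magnetic_deriv a b u)"
    by (rule smooth_on_cong[OF _ smooth_on_const[of _ 0]]) (use closed zero in auto)
  ultimately have "smooth_on (U \<union> - K) (magnetic_deriv a b u)"
    by (intro smooth_on_Un open_U) (use closed in auto)
  also have "U \<union> - K = UNIV" using K(3) by auto
  finally show ?thesis using K(2,3) zero by (rule test_functionsI)
qed

lemma magnetic_schroedinger_test:
  "u \<in> test_functions U \<Longrightarrow> magnetic_schroedinger a u \<in> test_functions U"
  unfolding magnetic_schroedinger_def[abs_def]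
  by (intro test_functions_sum magnetic_deriv_test)

lemma magnetic_deriv_add:
  "u \<in> test_functions U \<Longrightarrow> v \<in> test_functions U \<Longrightarrow>
    magnetic_deriv a b (\<lambda>x. u x + v x) = (\<lambda>x. magnetic_deriv a b u x + magnetic_deriv a b v x)"
  unfolding magnetic_deriv_def by (simp add: partial_deriv_add test_functions_differentiable algebra_simps)

lemma magnetic_deriv_scale:
  "u \<in> test_functions U \<Longrightarrow>
    magnetic_deriv a b (\<lambda>x. c * u x) = (\<lambda>x. c * magnetic_deriv a b u x)"
  unfolding magnetic_deriv_def
  by (simp add: partial_deriv_linear[OF bounded_linear_mult_right] test_functions_differentiable algebra_simps)

text \<open>The potential is real, so its terms cancel. The difference of the integrands is (1/i)
  times a partial derivative of the test function \<open>u x * cnj (v x)\<close>, which integrates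
  to zero.\<close>

lemma magnetic_deriv_symmetric:
  assumes u: "u \<in> test_functions U" and v: "v \<in> test_functions U" and b: "b \<in> Basis"
  shows "L2_inner lborel (magnetic_deriv a b u) v = L2_inner lborel u (magnetic_deriv a b v)"
proof -
  let ?p = "\<lambda>x. u x * cnj (v x)"
  have p: "?p \<in> test_functions U"
    using test_functions_mult[OF u smooth_on_linear[OF open_UNIV bounded_linear_cnj test_functions_smooth[OF v]]] .
  have eq: "magnetic_deriv a b u x * cnj (v x) - u x * cnj (magnetic_deriv a b v x) = (1 / \<i>) * partial_deriv b ?p x" for x
  proof -
    have du: "u differentiable at x" and dv: "v differentiable at x"
      by (rule test_functions_differentiable; fact)+
    have dcv: "(\<lambda>x. cnj (v x)) differentiable at x"
      using bounded_linear.has_derivative[OF bounded_linear_cnj has_derivative_frechet[OF dv]]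
      by (auto simp: differentiable_def)
    have "partial_deriv b ?p x = u x * cnj (partial_deriv b v x) + partial_deriv b u x * cnj (v x)"
      by (simp add: partial_deriv_mult[OF du dcv] partial_deriv_linear[OF bounded_linear_cnj dv])
    then show ?thesis by (simp add: magnetic_deriv_def algebra_simps)
  qed
  have "L2_inner lborel (magnetic_deriv a b u) v - L2_inner lborel u (magnetic_deriv a b v) =
      (\<integral>x. magnetic_deriv a b u x * cnj (v x) - u x * cnj (magnetic_deriv a b v x) \<partial>lborel)"
    unfolding L2_inner_def
    by (rule Bochner_Integration.integral_diff[symmetric])
      (intro L2_integrable_inner test_functions_L2[of _ U] magnetic_deriv_test u v b)+
  also have "\<dots> = 0"
    unfolding eq using test_functions_integral_partial_deriv[OF p b] by simp
  finally show ?thesis by simp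
qed

text \<open>Moves one first-order factor across the inner product. Positivity of the form and all
  energy estimates work with this first-order expression.\<close>

lemma magnetic_form:
  assumes u: "u \<in> test_functions U" and v: "v \<in> test_functions U"
  shows "L2_inner lborel (magnetic_schroedinger a u) v =
    (\<Sum>b\<in>Basis. L2_inner lborel (magnetic_deriv a b u) (magnetic_deriv a b v))"
proof -
  have "L2_inner lborel (magnetic_schroedinger a u) v =
      (\<integral>x. (\<Sum>b\<in>Basis. magnetic_deriv a b (magnetic_deriv a b u) x * cnj (v x)) \<partial>lborel)"
    by (simp add: L2_inner_def magnetic_schroedinger_def sum_distrib_right)
  also have "\<dots> = (\<Sum>b\<in>Basis. L2_inner lborel (magnetic_deriv a b (magnetic_deriv a b u)) v)"
    unfolding L2_inner_def
    by (rule Bochner_Integration.integral_sum)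
      (intro L2_integrable_inner test_functions_L2[of _ U] magnetic_deriv_test u v)
  also have "\<dots> = (\<Sum>b\<in>Basis. L2_inner lborel (magnetic_deriv a b u) (magnetic_deriv a b v))"
    by (intro sum.cong refl magnetic_deriv_symmetric magnetic_deriv_test u v)
  finally show ?thesis .
qed

lemma nonneg_symmetric_magnetic: "nonneg_symmetric lborel (test_functions U) (magnetic_schroedinger a)"
proof (rule nonneg_symmetric.intro)
  show "test_functions U \<subseteq> L2 lborel" using test_functions_L2 by blast
  show "magnetic_schroedinger a u \<in> L2 lborel" if "u \<in> test_functions U" for u
    by (rule test_functions_L2[OF magnetic_schroedinger_test[OF that]])
  interpret L: sesquilinear "L2 lborel" "L2_inner lborel" by (rule L2_inner_sesquilinear)
  note md = test_functions_L2[OF magnetic_deriv_test]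
  show "sesquilinear (test_functions U) (\<lambda>u v. L2_inner lborel (magnetic_schroedinger a u) v)"
  proof
    fix u v w :: "'a \<Rightarrow> complex" and c
    assume u: "u \<in> test_functions U"
    show "(\<lambda>x. c * u x) \<in> test_functions U" by (rule test_functions_scale[OF u])
    have "0 \<le> Re (L2_inner lborel (magnetic_deriv a b u) (magnetic_deriv a b u))" if "b \<in> Basis" for b
      by (rule L.B_pos[OF md[OF u that]])
    then show "0 \<le> Re (L2_inner lborel (magnetic_schroedinger a u) u)"
      by (simp add: magnetic_form u sum_nonneg)
    assume v: "v \<in> test_functions U"
    show "(\<lambda>x. u x + v x) \<in> test_functions U" by (rule test_functions_add[OF u v])
    show "L2_inner lborel (magnetic_schroedinger a (\<lambda>x. c * u x)) v = c * L2_inner lborel (magnetic_schroedinger a u) v"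
      by (simp add: magnetic_form u v test_functions_scale magnetic_deriv_scale L.B_scale_left md sum_distrib_left)
    have "L2_inner lborel (magnetic_deriv a b v) (magnetic_deriv a b u) =
        cnj (L2_inner lborel (magnetic_deriv a b u) (magnetic_deriv a b v))" if "b \<in> Basis" for b
      by (rule L.B_herm[OF md[OF u that] md[OF v that]])
    then show "L2_inner lborel (magnetic_schroedinger a v) u = cnj (L2_inner lborel (magnetic_schroedinger a u) v)"
      by (simp add: magnetic_form u v)
    assume w: "w \<in> test_functions U"
    show "L2_inner lborel (magnetic_schroedinger a (\<lambda>x. u x + v x)) w =
        L2_inner lborel (magnetic_schroedinger a u) w + L2_inner lborel (magnetic_schroedinger a v) w"
      by (simp add: magnetic_form u v w test_functions_add magnetic_deriv_add L.B_add_left md sum.distrib)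
  qed (rule test_functions_zero)
qed

sublocale nonneg_symmetric lborel "test_functions U" "magnetic_schroedinger a"
  by (rule nonneg_symmetric_magnetic)

lemma magnetic_deriv_norm_le:
  assumes v: "v \<in> test_functions U" and b: "b \<in> Basis"
  shows "L2_norm lborel (magnetic_deriv a b v) \<le> Q.nn v"
proof (rule power2_le_imp_le)
  have md: "magnetic_deriv a c v \<in> L2 lborel" if "c \<in> Basis" for c
    by (rule test_functions_L2[OF magnetic_deriv_test[OF v that]])
  have "(Q.nn v)\<^sup>2 = (\<Sum>c\<in>Basis. (L2_norm lborel (magnetic_deriv a c v))\<^sup>2)"
    using Q.nn_sq[OF v] by (simp add: magnetic_form[OF v v] L2_norm_nn[OF md] L.nn_sq[OF md])
  also have "(L2_norm lborel (magnetic_deriv a b v))\<^sup>2 \<le> \<dots>"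
    by (rule member_le_sum) (use b in auto)
  finally show "(L2_norm lborel (magnetic_deriv a b v))\<^sup>2 \<le> (Q.nn v)\<^sup>2" .
qed (use v in simp)

text \<open>
  Since \<open>(1/\<i>) \<nabla> - a\<close> is symmetric, approximate plane waves of momentum \<open>\<xi>\<close> satisfy
  Weyl's criterion for the energy \<open>|\<xi>|\<^sup>2\<close>, without any control of second derivatives.
\<close>

lemma approximate_plane_waves:
  assumes approx: "\<And>\<delta>. \<delta> > 0 \<Longrightarrow> \<exists>u\<in>test_functions U. L2_norm lborel u > 0 \<and>
    (\<forall>b\<in>Basis. L2_norm lborel (\<lambda>x. magnetic_deriv a b u x - of_real (\<xi> \<bullet> b) * u x) \<le> \<delta> * L2_norm lborel u)"
  shows "complex_of_real ((norm \<xi>)\<^sup>2) \<in>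
    op_spectrum lborel (friedrichs_extension lborel (test_functions U) (magnetic_schroedinger a))"
proof (rule weyl_criterion)
  fix \<delta> :: real assume \<delta>: "\<delta> > 0"
  \<comment> \<open>Absorbs the sum over the coordinates and the factor 1 + |\<xi>| from the bound
    on each summand.\<close>
  define n where "n = DIM('a) * (1 + norm \<xi>)"
  have n: "n > 0" by (simp add: n_def add_pos_nonneg)
  obtain u where u: "u \<in> test_functions U" "L2_norm lborel u > 0"
    and small: "\<And>b. b \<in> Basis \<Longrightarrow>
      L2_norm lborel (\<lambda>x. magnetic_deriv a b u x - of_real (\<xi> \<bullet> b) * u x) \<le> \<delta> / n * L2_norm lborel u"
    using approx[of "\<delta> / n"] \<delta> n by auto
  have "cmod (q u v - of_real ((norm \<xi>)\<^sup>2) * L2_inner lborel u v) \<le> \<delta> * L2_norm lborel u * (L2_norm lborel v + Q.nn v)"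
    if v: "v \<in> test_functions U" for v
  proof -
    define w where "w b = (\<lambda>x. magnetic_deriv a b u x - of_real (\<xi> \<bullet> b) * u x)" for b
    have uL: "u \<in> L2 lborel" and vL: "v \<in> L2 lborel" by (rule test_functions_L2; fact)+
    have duL: "magnetic_deriv a b u \<in> L2 lborel" and dvL: "magnetic_deriv a b v \<in> L2 lborel" if "b \<in> Basis" for b
      using that by (auto intro!: test_functions_L2[of _ U] magnetic_deriv_test u v)
    have wL: "w b \<in> L2 lborel" if "b \<in> Basis" for b
      unfolding w_def by (intro L.V_diff L.V_scale duL that uL)
    have w_inner: "L2_inner lborel (magnetic_deriv a b u) f = L2_inner lborel (w b) f + of_real (\<xi> \<bullet> b) * L2_inner lborel u f"
      if "b \<in> Basis" "f \<in> L2 lborel" for b f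
      unfolding w_def using that duL uL by (simp add: L.B_diff_left L.B_scale_left L.V_scale)
    \<comment> \<open>Write p_b u = w_b + \<xi>_b u for the magnetic derivative p_b, move p_b from v
      to u in <u, p_b v> by symmetry, and substitute again. No derivative ever falls on w_b, whose
      smallness is known in L2 only.\<close>
    have "L2_inner lborel (magnetic_deriv a b u) (magnetic_deriv a b v) =
        L2_inner lborel (w b) (magnetic_deriv a b v) + of_real (\<xi> \<bullet> b) * L2_inner lborel (w b) v
        + of_real ((\<xi> \<bullet> b)\<^sup>2) * L2_inner lborel u v" if b: "b \<in> Basis" for b
      using w_inner[OF b dvL[OF b]] w_inner[OF b vL] magnetic_deriv_symmetric[OF u(1) v b]
      by (simp add: algebra_simps power2_eq_square)
    then have "q u v = (\<Sum>b\<in>Basis. L2_inner lborel (w b) (magnetic_deriv a b v) + of_real (\<xi> \<bullet> b) * L2_inner lborel (w b) v)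
        + of_real (\<Sum>b\<in>Basis. (\<xi> \<bullet> b)\<^sup>2) * L2_inner lborel u v"
      by (simp add: magnetic_form[OF u(1) v] sum.distrib sum_distrib_right)
    also have "(\<Sum>b\<in>Basis. (\<xi> \<bullet> b)\<^sup>2) = (norm \<xi>)\<^sup>2"
      unfolding power2_norm_eq_inner euclidean_inner[of \<xi> \<xi>] by (simp add: power2_eq_square)
    finally have "cmod (q u v - of_real ((norm \<xi>)\<^sup>2) * L2_inner lborel u v) =
        cmod (\<Sum>b\<in>Basis. L2_inner lborel (w b) (magnetic_deriv a b v) + of_real (\<xi> \<bullet> b) * L2_inner lborel (w b) v)"
      by simp
    also have "\<dots> \<le> (\<Sum>b\<in>(Basis :: 'a set). \<delta> / n * L2_norm lborel u * ((1 + norm \<xi>) * (L2_norm lborel v + Q.nn v)))"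
    proof (rule sum_norm_le)
      fix b :: 'a assume b: "b \<in> Basis"
      have w: "L2_norm lborel (w b) \<le> \<delta> / n * L2_norm lborel u"
        using small[OF b] by (simp add: w_def)
      have 1: "cmod (L2_inner lborel (w b) (magnetic_deriv a b v)) \<le> L2_norm lborel (w b) * Q.nn v"
        using L.cauchy_schwarz[OF wL[OF b] dvL[OF b]] magnetic_deriv_norm_le[OF v b]
          mult_left_mono[OF magnetic_deriv_norm_le[OF v b], of "L2_norm lborel (w b)"]
        by (simp add: L2_norm_nn[OF wL[OF b]] L2_norm_nn[OF dvL[OF b]] wL[OF b])
      have "cmod (of_real (\<xi> \<bullet> b) * L2_inner lborel (w b) v) \<le> norm \<xi> * (L2_norm lborel (w b) * L2_norm lborel v)"
        unfolding norm_mult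
        using L.cauchy_schwarz[OF wL[OF b] vL] Basis_le_norm[OF b, of \<xi>]
        by (intro mult_mono) (simp_all add: L2_norm_nn[OF wL[OF b]] L2_norm_nn[OF vL])
      then have "cmod (L2_inner lborel (w b) (magnetic_deriv a b v) + of_real (\<xi> \<bullet> b) * L2_inner lborel (w b) v)
          \<le> L2_norm lborel (w b) * (Q.nn v + norm \<xi> * L2_norm lborel v)"
        using 1 by (intro norm_triangle_le) (simp add: algebra_simps)
      also have "\<dots> \<le> L2_norm lborel (w b) * ((1 + norm \<xi>) * (L2_norm lborel v + Q.nn v))"
        using v by (intro mult_left_mono) (simp_all add: algebra_simps)
      also have "\<dots> \<le> \<delta> / n * L2_norm lborel u * ((1 + norm \<xi>) * (L2_norm lborel v + Q.nn v))"
        using v by (intro mult_right_mono[OF w]) simp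
      finally show "cmod (L2_inner lborel (w b) (magnetic_deriv a b v) + of_real (\<xi> \<bullet> b) * L2_inner lborel (w b) v)
          \<le> \<delta> / n * L2_norm lborel u * ((1 + norm \<xi>) * (L2_norm lborel v + Q.nn v))" .
    qed
    also have "\<dots> = \<delta> / n * n * L2_norm lborel u * (L2_norm lborel v + Q.nn v)"
      by (simp add: n_def)
    also have "\<dots> = \<delta> * L2_norm lborel u * (L2_norm lborel v + Q.nn v)" using n by simp
    finally show ?thesis .
  qed
  with u show "\<exists>u\<in>test_functions U. L2_norm lborel u > 0 \<and>
      (\<forall>v\<in>test_functions U. cmod (q u v - of_real ((norm \<xi>)\<^sup>2) * L2_inner lborel u v)
        \<le> \<delta> * L2_norm lborel u * (L2_norm lborel v + Q.nn v))" by blast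
qed

end

section \<open>Flat functions\<close>

text \<open>The polynomial factor makes this family closed under differentiation.\<close>

definition flat_fun :: "real poly \<Rightarrow> real \<Rightarrow> real" where
  "flat_fun p t = (if 0 < t then poly p (1 / t) * exp (- 1 / t) else 0)"

text \<open>Chain rule in s = 1/t: the derivative in t of p(s) exp(-s) is s^2 (p(s) - p'(s))
  exp(-s).\<close>

definition flat_next :: "real poly \<Rightarrow> real poly" where
  "flat_next p = [:0, 0, 1:] * (p - pderiv p)"

lemma poly_div_exp_tendsto_0: "((\<lambda>x. poly p x / exp x) \<longlongrightarrow> (0 :: real)) at_top"
proof -
  have "((\<lambda>x. \<Sum>i\<le>degree p. coeff p i * (x ^ i / exp x)) \<longlongrightarrow> (\<Sum>i\<le>degree p. coeff p i * 0)) at_top"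
    by (intro tendsto_sum tendsto_mult tendsto_const tendsto_power_div_exp_0)
  then show ?thesis by (simp add: poly_altdef sum_divide_distrib)
qed

lemma flat_fun_deriv: "(flat_fun p has_real_derivative flat_fun (flat_next p) t) (at t)"
proof -
  consider "t > 0" | "t < 0" | "t = 0" by linarith
  then show ?thesis
  proof cases
    case 1
    have "((\<lambda>t. poly p (1 / t) * exp (- 1 / t)) has_real_derivative flat_fun (flat_next p) t) (at t)"
      using 1 by (auto intro!: derivative_eq_intros simp: flat_fun_def flat_next_def)
        (simp add: field_simps power2_eq_square)
    then show ?thesis
      by (rule has_field_derivative_transform_within_open[of _ _ _ "{0<..}"]) (use 1 in \<open>auto simp: flat_fun_def\<close>)
  next
    case 2
    have "((\<lambda>t. 0) has_real_derivative flat_fun (flat_next p) t) (at t)"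
      using 2 by (simp add: flat_fun_def)
    then show ?thesis
      by (rule has_field_derivative_transform_within_open[of _ _ _ "{..<0}"]) (use 2 in \<open>auto simp: flat_fun_def\<close>)
  next
    case 3
    \<comment> \<open>The additional factor from \<open>pCons 0\<close> is the 1/h of the difference
      quotient at 0.\<close>
    have "((\<lambda>h. poly (pCons 0 p) (inverse h) / exp (inverse h)) \<longlongrightarrow> 0) (at_right (0 :: real))"
      by (rule filterlim_compose[OF poly_div_exp_tendsto_0 filterlim_inverse_at_top_right])
    moreover have "\<forall>\<^sub>F h in at_right (0 :: real). poly (pCons 0 p) (inverse h) / exp (inverse h) = flat_fun p h / h"
      using eventually_at_right_less[of 0]
      by eventually_elim (simp add: flat_fun_def exp_minus divide_simps)
    ultimately have right: "((\<lambda>h. flat_fun p h / h) \<longlongrightarrow> 0) (at_right 0)"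
      by (rule Lim_transform_eventually)
    have "\<forall>\<^sub>F h in at_left (0 :: real). 0 = flat_fun p h / h"
      by (auto simp: eventually_at_left_field flat_fun_def intro!: exI[of _ "-1"])
    then have "((\<lambda>h. flat_fun p h / h) \<longlongrightarrow> 0) (at_left 0)"
      by (rule Lim_transform_eventually[OF tendsto_const])
    with right have "((\<lambda>h. flat_fun p h / h) \<longlongrightarrow> 0) (at 0)"
      by (simp add: filterlim_split_at_real)
    then show ?thesis using 3 by (simp add: DERIV_def flat_fun_def)
  qed
qed

definition bump :: "real \<Rightarrow> real" where "bump = flat_fun 1"
definition bump' :: "real \<Rightarrow> real" where "bump' = flat_fun [:0, 0, 1:]"

lemma flat_next_1: "flat_next 1 = [:0, 0, 1:]"
  by (simp add: flat_next_def one_pCons)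

lemma bump_deriv: "(bump has_real_derivative bump' t) (at t)"
  using flat_fun_deriv[of 1 t] by (simp add: bump_def bump'_def flat_next_1)

lemma bump_eq: "bump t = (if 0 < t then exp (- 1 / t) else 0)"
  by (simp add: bump_def flat_fun_def)

lemma bump'_eq: "bump' t = (if 0 < t then (1 / t)\<^sup>2 * exp (- 1 / t) else 0)"
  by (simp add: bump'_def flat_fun_def power2_eq_square)

lemma bump_nonneg: "0 \<le> bump t" and bump'_nonneg: "0 \<le> bump' t"
  by (auto simp: bump_eq bump'_eq)

lemma bump_le_1: "bump t \<le> 1"
  by (simp add: bump_eq)

text \<open>In terms of s = 1/t this is s^2 <= exp s, which follows by squaring s <= 1 + s/2 + s^2/8
  <= exp (s/2).\<close>

lemma bump'_le_1: "bump' t \<le> 1"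
proof (cases "0 < t")
  case True
  define s where "s = 1 / t"
  have s: "s > 0" using True by (simp add: s_def)
  have "0 \<le> (s - 2)\<^sup>2 + 4" by simp
  then have "s \<le> 1 + s / 2 + (s / 2)\<^sup>2 / 2" by (simp add: power2_eq_square field_simps)
  also have "\<dots> \<le> exp (s / 2)" using s by (intro exp_lower_Taylor_quadratic) simp
  finally have "s\<^sup>2 \<le> (exp (s / 2))\<^sup>2" using s by (intro power_mono) auto
  also have "\<dots> = exp s" by (simp flip: exp_double)
  finally have "s\<^sup>2 * exp (- s) \<le> exp s * exp (- s)" by (intro mult_right_mono) auto
  then show ?thesis using True by (simp add: bump'_eq s_def flip: exp_add)
qed (simp add: bump'_eq)

text \<open>Lets terms with the squared cutoff be absorbed by the density that contains its
  derivative. For 0 < t <= 1 it combines \<open>bump t\<close> <= 1 with \<open>bump' t\<close> =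
  \<open>bump t\<close> / t^2; the argument 1 + W stays in this range because W is nonpositive on
  the disc.\<close>

lemma bump_sq_le: "t \<le> 1 \<Longrightarrow> (bump t)\<^sup>2 \<le> bump' t"
proof (cases "0 < t")
  case True
  assume t: "t \<le> 1"
  have "(bump t)\<^sup>2 \<le> bump t"
    using bump_nonneg[of t] bump_le_1[of t] by (simp add: power2_eq_square mult_left_le)
  also have "bump t \<le> (1 / t)\<^sup>2 * bump t"
    using True t bump_nonneg[of t] mult_right_mono[of 1 "(1 / t)\<^sup>2" "bump t"] by (simp add: one_le_power)
  finally show ?thesis using True by (simp add: bump_eq bump'_eq)
qed (simp add: bump_eq bump'_eq)

lemma bump_mono: "s \<le> t \<Longrightarrow> bump s \<le> bump t"
  by (auto simp: bump_eq divide_left_mono frac_le)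

lemma bump_pos: "0 < t \<Longrightarrow> 0 < bump t"
  by (simp add: bump_eq)

section \<open>Logarithmic potentials\<close>

text \<open>The scale 3 R makes every logarithm nonpositive when z lies within R and \<gamma> within
  2 R of the same centre.\<close>

definition log_pot :: "complex set \<Rightarrow> (complex \<Rightarrow> real) \<Rightarrow> real \<Rightarrow> complex \<Rightarrow> real" where
  "log_pot A w R z = (\<Sum>\<gamma>\<in>A. w \<gamma> * ln (cmod (z - \<gamma>) / (3 * R)))"

definition cauchy_sum :: "complex set \<Rightarrow> (complex \<Rightarrow> real) \<Rightarrow> complex \<Rightarrow> complex" where
  "cauchy_sum A w z = (\<Sum>\<gamma>\<in>A. of_real (w \<gamma>) / (z - \<gamma>))"

lemma cauchy_sum_holomorphic: "cauchy_sum A w holomorphic_on - A"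
  unfolding cauchy_sum_def[abs_def] by (intro holomorphic_intros) auto

lemma log_pot_has_derivative:
  assumes "finite A" "R > 0" "z \<notin> A"
  shows "(log_pot A w R has_derivative (\<lambda>h. Re (cauchy_sum A w z * h))) (at z)"
proof -
  have "((\<lambda>z. ln (cmod (z - \<gamma>) / (3 * R))) has_derivative (\<lambda>h. Re (h / (z - \<gamma>)))) (at z)" if "\<gamma> \<in> A" for \<gamma>
  proof -
    have ne: "z - \<gamma> \<noteq> 0" using that assms by auto
    have "((\<lambda>z. cmod (z - \<gamma>)) has_derivative (\<lambda>h. h \<bullet> ((z - \<gamma>) /\<^sub>R cmod (z - \<gamma>)))) (at z)"
    proof -
      have "((\<lambda>z. z - \<gamma>) has_derivative (\<lambda>h. h)) (at z)" by (auto intro!: derivative_eq_intros)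
      from has_derivative_compose[OF this has_derivative_norm[OF ne]]
      show ?thesis by (simp add: sgn_div_norm)
    qed
    then have "((\<lambda>z. ln (cmod (z - \<gamma>) / (3 * R))) has_derivative
        (\<lambda>h. (h \<bullet> ((z - \<gamma>) /\<^sub>R cmod (z - \<gamma>))) / cmod (z - \<gamma>))) (at z)"
      using ne assms(2) by (auto intro!: derivative_eq_intros simp: field_simps)
    moreover have "(h \<bullet> ((z - \<gamma>) /\<^sub>R cmod (z - \<gamma>))) / cmod (z - \<gamma>) = Re (h / (z - \<gamma>))" for h
    proof -
      have "cmod (z - \<gamma>) * cmod (z - \<gamma>) = (Re (z - \<gamma>))\<^sup>2 + (Im (z - \<gamma>))\<^sup>2"
        using cmod_power2[of "z - \<gamma>"] by (simp add: power2_eq_square)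
      then show ?thesis
        by (simp add: inner_complex_def Re_divide divide_inverse algebra_simps flip: inverse_mult_distrib)
    qed
    ultimately show ?thesis by simp
  qed
  then have "(log_pot A w R has_derivative (\<lambda>h. \<Sum>\<gamma>\<in>A. w \<gamma> * Re (h / (z - \<gamma>)))) (at z)"
    unfolding log_pot_def[abs_def] by (intro has_derivative_sum has_derivative_mult_right) auto
  moreover have "(\<Sum>\<gamma>\<in>A. w \<gamma> * Re (h / (z - \<gamma>))) = Re (cauchy_sum A w z * h)" for h
    unfolding cauchy_sum_def sum_distrib_right Re_sum
  proof (intro sum.cong refl)
    fix \<gamma>
    have "of_real (w \<gamma>) / (z - \<gamma>) * h = w \<gamma> *\<^sub>R (h / (z - \<gamma>))" by (simp add: scaleR_conv_of_real)
    then show "w \<gamma> * Re (h / (z - \<gamma>)) = Re (of_real (w \<gamma>) / (z - \<gamma>) * h)" by (simp only: scaleR_complex.simps)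
  qed
  ultimately show ?thesis by simp
qed

text \<open>The value on A is set by hand, because the logarithm has only a conventional value at 0.
  For positive weights it is the right one, as the potential tends to minus infinity at these
  points.\<close>

definition cutoff :: "real poly \<Rightarrow> complex set \<Rightarrow> (complex \<Rightarrow> real) \<Rightarrow> real \<Rightarrow> complex \<Rightarrow> real" where
  "cutoff p A w R z = (if z \<in> A then 0 else flat_fun p (1 + log_pot A w R z))"

text \<open>Near \<gamma> its own logarithm tends to minus infinity while the others stay bounded
  above, so 1 + W <= 0 there. The open set N serves all p at once, hence it also serves the cutoffs
  that occur in derivatives.\<close>

lemma cutoff_vanishes:
  assumes A: "finite A" and R: "R > 0" and w: "\<And>\<gamma>. \<gamma> \<in> A \<Longrightarrow> 0 < w \<gamma>"
  obtains N where "open N" "A \<subseteq> N" "\<And>p z. z \<in> N \<Longrightarrow> cutoff p A w R z = 0"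
proof -
  have "\<exists>d>0. \<forall>z\<in>ball \<gamma> d. \<forall>p. cutoff p A w R z = 0" if g: "\<gamma> \<in> A" for \<gamma>
  proof -
    \<comment> \<open>C bounds the contribution of the other points on the unit disc around
      \<gamma>; d is then small enough for the term of \<gamma> to be at most -(1 + C).\<close>
    define C where "C = (\<Sum>\<gamma>'\<in>A - {\<gamma>}. w \<gamma>' * \<bar>ln ((cmod (\<gamma> - \<gamma>') + 1) / (3 * R))\<bar>)"
    define d where "d = min 1 (3 * R * exp (- (1 + C) / w \<gamma>))"
    have "cutoff p A w R z = 0" if z: "z \<in> ball \<gamma> d" for z p
    proof (cases "z \<in> A")
      case False
      have dist: "cmod (z - \<gamma>) < d" using z by (simp add: dist_norm norm_minus_commute)
      have ne: "z \<noteq> \<gamma>" using False g by auto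
      have "log_pot A w R z = w \<gamma> * ln (cmod (z - \<gamma>) / (3 * R)) + (\<Sum>\<gamma>'\<in>A - {\<gamma>}. w \<gamma>' * ln (cmod (z - \<gamma>') / (3 * R)))"
        unfolding log_pot_def using A g by (rule sum.remove)
      also have "(\<Sum>\<gamma>'\<in>A - {\<gamma>}. w \<gamma>' * ln (cmod (z - \<gamma>') / (3 * R))) \<le> C"
        unfolding C_def
      proof (intro sum_mono mult_left_mono)
        fix \<gamma>' assume g': "\<gamma>' \<in> A - {\<gamma>}"
        have "cmod (z - \<gamma>') \<le> cmod (z - \<gamma>) + cmod (\<gamma> - \<gamma>')"
          using norm_triangle_ineq[of "z - \<gamma>" "\<gamma> - \<gamma>'"] by simp
        also have "\<dots> \<le> cmod (\<gamma> - \<gamma>') + 1" using dist by (simp add: d_def)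
        finally have "ln (cmod (z - \<gamma>') / (3 * R)) \<le> ln ((cmod (\<gamma> - \<gamma>') + 1) / (3 * R))"
          using False g' R by (intro ln_mono divide_right_mono) (auto intro!: divide_pos_pos)
        then show "ln (cmod (z - \<gamma>') / (3 * R)) \<le> \<bar>ln ((cmod (\<gamma> - \<gamma>') + 1) / (3 * R))\<bar>" by simp
        show "0 \<le> w \<gamma>'" using w[of \<gamma>'] g' by simp
      qed
      also have "w \<gamma> * ln (cmod (z - \<gamma>) / (3 * R)) \<le> w \<gamma> * (- (1 + C) / w \<gamma>)"
      proof (intro mult_left_mono)
        have "cmod (z - \<gamma>) / (3 * R) \<le> exp (- (1 + C) / w \<gamma>)"
          using dist R by (simp add: d_def field_simps)
        then show "ln (cmod (z - \<gamma>) / (3 * R)) \<le> - (1 + C) / w \<gamma>"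
          using ne R ln_mono[of "cmod (z - \<gamma>) / (3 * R)" "exp (- (1 + C) / w \<gamma>)"] by simp
      qed (use w[OF g] in simp)
      finally have "log_pot A w R z \<le> - 1" using w[OF g] by simp
      then show ?thesis by (simp add: cutoff_def flat_fun_def)
    qed (simp add: cutoff_def)
    moreover have "d > 0" using R by (simp add: d_def)
    ultimately show ?thesis by blast
  qed
  then obtain d where d: "\<And>\<gamma>. \<gamma> \<in> A \<Longrightarrow> d \<gamma> > 0" "\<And>\<gamma> z p. \<gamma> \<in> A \<Longrightarrow> z \<in> ball \<gamma> (d \<gamma>) \<Longrightarrow> cutoff p A w R z = 0"
    by metis
  show thesis
    by (rule that[of "\<Union>\<gamma>\<in>A. ball \<gamma> (d \<gamma>)"]) (use d in \<open>auto 4 3\<close>)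
qed

text \<open>Already the first partial derivatives are real parts of holomorphic functions.\<close>

lemma log_pot_smooth:
  assumes "finite A" "R > 0"
  shows "smooth_on (- A) (log_pot A w R)"
proof (rule smooth_onI_partial)
  have opn: "open (- A)" using assms(1) by (simp add: finite_imp_closed open_Compl)
  show "log_pot A w R differentiable at x" if "x \<in> - A" for x
    using log_pot_has_derivative[OF assms, of x w] that by (auto simp: differentiable_def)
  show "smooth_on (- A) (partial_deriv b (log_pot A w R))" for b
  proof (rule smooth_on_cong[OF opn])
    show "smooth_on (- A) (\<lambda>z. Re (cauchy_sum A w z * b))"
      by (intro smooth_on_linear[OF opn bounded_linear_Re] smooth_on_holomorphic opn holomorphic_intros cauchy_sum_holomorphic)
    show "Re (cauchy_sum A w x * b) = partial_deriv b (log_pot A w R) x" if "x \<in> - A" for x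
      using partial_deriv_eqI[OF log_pot_has_derivative[OF assms, of x w]] that by simp
  qed
qed

lemma smooth_on_flat_fun:
  fixes f :: "'a::euclidean_space \<Rightarrow> real"
  assumes "open U" "smooth_on U f"
  shows "smooth_on U (\<lambda>x. flat_fun p (f x))"
  using assms unfolding smooth_on_def
  by (auto intro!: Ck_on_compose_real[of U flat_fun flat_next] flat_fun_deriv)

lemma cutoff_smooth:
  assumes A: "finite A" and R: "R > 0" and w: "\<And>\<gamma>. \<gamma> \<in> A \<Longrightarrow> 0 < w \<gamma>"
  shows "smooth_on UNIV (cutoff p A w R)"
proof -
  obtain N where N: "open N" "A \<subseteq> N" "\<And>p z. z \<in> N \<Longrightarrow> cutoff p A w R z = 0"
    using cutoff_vanishes[of A R w] A R w by blast
  have opn: "open (- A)" using A by (simp add: finite_imp_closed open_Compl)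
  have "smooth_on (- A) (cutoff p A w R)"
    by (rule smooth_on_cong[OF opn smooth_on_flat_fun[OF opn smooth_on_add[OF opn smooth_on_const[of _ 1] log_pot_smooth[OF A R]]]])
      (simp add: cutoff_def)
  moreover have "smooth_on N (cutoff p A w R)"
    by (rule smooth_on_cong[OF N(1) smooth_on_const[of _ 0]]) (simp add: N)
  ultimately have "smooth_on (- A \<union> N) (cutoff p A w R)"
    by (intro smooth_on_Un opn N)
  also have "- A \<union> N = UNIV" using N(2) by auto
  finally show ?thesis .
qed

text \<open>Off A this is the chain rule, with the Cauchy sum encoding the gradient of the
  potential. On A both sides are zero, since the cutoff vanishes nearby.\<close>

lemma cutoff_has_derivative:
  assumes A: "finite A" and R: "R > 0" and w: "\<And>\<gamma>. \<gamma> \<in> A \<Longrightarrow> 0 < w \<gamma>"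
  shows "(cutoff p A w R has_derivative
    (\<lambda>h. Re (of_real (cutoff (flat_next p) A w R z) * cauchy_sum A w z * h))) (at z)"
proof (cases "z \<in> A")
  case True
  obtain N where N: "open N" "A \<subseteq> N" "\<And>p z. z \<in> N \<Longrightarrow> cutoff p A w R z = 0"
    using cutoff_vanishes[of A R w] A R w by blast
  have "(cutoff p A w R has_derivative (\<lambda>h. 0)) (at z)"
    by (rule has_derivative_transform_within_open[of "\<lambda>_. 0" "\<lambda>_. 0" z UNIV N]) (use N True in auto)
  then show ?thesis using True by (simp add: cutoff_def)
next
  case False
  have opn: "open (- A)" using A by (simp add: finite_imp_closed open_Compl)
  have "((\<lambda>z. flat_fun p (1 + log_pot A w R z)) has_derivative
      (\<lambda>h. flat_fun (flat_next p) (1 + log_pot A w R z) * Re (cauchy_sum A w z * h))) (at z)"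
    by (rule has_derivative_compose[OF _ has_field_derivative_imp_has_derivative[OF flat_fun_deriv]])
      (auto intro!: derivative_eq_intros log_pot_has_derivative A R False)
  then have "((\<lambda>z. flat_fun p (1 + log_pot A w R z)) has_derivative
      (\<lambda>h. Re (of_real (cutoff (flat_next p) A w R z) * cauchy_sum A w z * h))) (at z)"
    using False by (simp add: cutoff_def mult.assoc)
  then show ?thesis
    by (rule has_derivative_transform_within_open[OF _ opn]) (use False in \<open>auto simp: cutoff_def\<close>)
qed

section \<open>The Caccioppoli estimate\<close>

definition radial :: "complex \<Rightarrow> real \<Rightarrow> complex \<Rightarrow> real" where
  "radial c R z = bump (1 - (cmod (z - c))\<^sup>2 / R\<^sup>2)"

text \<open>Gradients are encoded so that the derivative of \<open>f\<close> at \<open>z\<close> is \<open>h \<mapsto> Re (g z * h)\<close>.\<close>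

definition radial_grad :: "complex \<Rightarrow> real \<Rightarrow> complex \<Rightarrow> complex" where
  "radial_grad c R z = of_real (- 2 / R\<^sup>2 * bump' (1 - (cmod (z - c))\<^sup>2 / R\<^sup>2)) * cnj (z - c)"

lemma radial_nonneg: "0 \<le> radial c R z"
  by (simp add: radial_def bump_nonneg)

lemma bump_outside: "R > 0 \<Longrightarrow> z \<notin> cball c R \<Longrightarrow> 1 - (cmod (z - c))\<^sup>2 / R\<^sup>2 \<le> 0"
proof -
  assume R: "R > 0" and "z \<notin> cball c R"
  then have "R \<le> cmod (z - c)" by (simp add: dist_norm norm_minus_commute)
  then have "R\<^sup>2 \<le> (cmod (z - c))\<^sup>2" using R by (intro power_mono) auto
  then show ?thesis using R by simp
qed

lemma bump_nonpos: "t \<le> 0 \<Longrightarrow> bump t = 0" and bump'_nonpos: "t \<le> 0 \<Longrightarrow> bump' t = 0"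
  by (simp_all add: bump_eq bump'_eq)

lemma radial_outside: "R > 0 \<Longrightarrow> z \<notin> cball c R \<Longrightarrow> radial c R z = 0"
  unfolding radial_def by (rule bump_nonpos[OF bump_outside])

lemma radial_grad_outside: "R > 0 \<Longrightarrow> z \<notin> cball c R \<Longrightarrow> radial_grad c R z = 0"
  unfolding radial_grad_def by (subst bump'_nonpos[OF bump_outside]) auto

lemma radial_has_derivative:
  "(radial c R has_derivative (\<lambda>h. Re (radial_grad c R z * h))) (at z)"
proof -
  define k where "k = 1 / R\<^sup>2"
  have "((\<lambda>z. 1 - k * ((z - c) \<bullet> (z - c))) has_derivative (\<lambda>h. - k * (2 * ((z - c) \<bullet> h)))) (at z)"
    by (auto intro!: derivative_eq_intros simp: inner_commute)
  from has_derivative_compose[OF this has_field_derivative_imp_has_derivative[OF bump_deriv]]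
  have "((\<lambda>z. bump (1 - k * ((z - c) \<bullet> (z - c)))) has_derivative
      (\<lambda>h. bump' (1 - k * ((z - c) \<bullet> (z - c))) * (- k * (2 * ((z - c) \<bullet> h))))) (at z)" .
  moreover have "k * (w \<bullet> w) = (cmod w)\<^sup>2 / R\<^sup>2" for w :: complex by (simp add: power2_norm_eq_inner k_def)
  moreover have "bump' t * (- k * (2 * ((z - c) \<bullet> h))) = Re (of_real (- 2 / R\<^sup>2 * bump' t) * cnj (z - c) * h)" for h t
    by (simp add: inner_complex_def k_def algebra_simps add_divide_distrib diff_divide_distrib)
  ultimately show ?thesis by (simp add: radial_def[abs_def] radial_grad_def)
qed

lemma radial_smooth: "smooth_on UNIV (radial c R)"
proof -
  \<comment> \<open>The squared modulus is written as a product, which is smooth also at the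
    centre.\<close>
  have "smooth_on UNIV (\<lambda>z. Re ((z - c) * cnj (z - c)))"
    by (intro smooth_on_linear[OF open_UNIV bounded_linear_Re] smooth_on_mult open_UNIV smooth_on_holomorphic
        smooth_on_linear[OF open_UNIV bounded_linear_cnj] holomorphic_intros)
  then have "smooth_on UNIV (\<lambda>z. 1 + (- 1 / R\<^sup>2) * Re ((z - c) * cnj (z - c)))"
    by (intro smooth_on_add smooth_on_mult smooth_on_const open_UNIV)
  then have "smooth_on UNIV (\<lambda>z. flat_fun 1 (1 + (- 1 / R\<^sup>2) * Re ((z - c) * cnj (z - c))))"
    by (intro smooth_on_flat_fun open_UNIV)
  moreover have "flat_fun 1 (1 + (- 1 / R\<^sup>2) * Re ((z - c) * cnj (z - c))) = radial c R z" for z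
    by (simp only: complex_norm_square[symmetric] Re_complex_of_real radial_def bump_def) simp
  ultimately show ?thesis by (rule smooth_on_cong[OF open_UNIV])
qed

lemma continuous_bump': "continuous_on UNIV bump'"
  unfolding bump'_def using flat_fun_deriv by (auto intro!: DERIV_continuous_on)

lemma continuous_radial_grad: "continuous_on UNIV (radial_grad c R)"
  unfolding radial_grad_def divide_inverse
  by (intro continuous_intros continuous_on_compose2[OF continuous_bump']) auto

lemma cmod_radial_grad_le:
  assumes "R > 0"
  shows "(cmod (radial_grad c R z))\<^sup>2 \<le> 4 / R\<^sup>2 * indicator (cball c R) z"
proof (cases "z \<in> cball c R")
  case True
  then have d: "cmod (z - c) \<le> R" by (simp add: dist_norm norm_minus_commute)
  have "cmod (radial_grad c R z) = 2 / R\<^sup>2 * bump' (1 - (cmod (z - c))\<^sup>2 / R\<^sup>2) * cmod (z - c)"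
    unfolding radial_grad_def norm_mult norm_of_real complex_mod_cnj
    using bump'_nonneg by (simp add: abs_mult)
  also have "\<dots> \<le> 2 / R\<^sup>2 * 1 * R"
    using d assms bump'_le_1 bump'_nonneg by (intro mult_mono) auto
  also have "\<dots> = 2 / R" using assms by (simp add: power2_eq_square)
  finally have "(cmod (radial_grad c R z))\<^sup>2 \<le> (2 / R)\<^sup>2" by (intro power_mono) auto
  then show ?thesis using True by (simp add: power_divide)
qed (simp add: radial_grad_outside assms)

lemma integrable_radial_grad:
  assumes "R > 0"
  shows "integrable lborel (\<lambda>z. (cmod (radial_grad c R z))\<^sup>2)"
  by (rule continuous_compact_support_integrable[of _ "cball c R"])
    (auto intro!: continuous_intros continuous_radial_grad simp: radial_grad_outside[OF assms])

lemma content_ball_complex: "R \<ge> 0 \<Longrightarrow> measure lborel (ball (c :: complex) R) = pi * R\<^sup>2"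
  by (simp add: content_ball unit_ball_vol_2)

lemma content_cball_complex: "R \<ge> 0 \<Longrightarrow> measure lborel (cball (c :: complex) R) = pi * R\<^sup>2"
  by (simp add: content_cball unit_ball_vol_2)

text \<open>The Dirichlet integral is scale invariant in the plane: the pointwise bound 4 / R^2 is
  compensated by the area pi R^2.\<close>

lemma integral_radial_grad_le:
  assumes "R > 0"
  shows "(\<integral>z. (cmod (radial_grad c R z))\<^sup>2 \<partial>lborel) \<le> 4 * pi"
proof -
  have "(\<integral>z. (cmod (radial_grad c R z))\<^sup>2 \<partial>lborel) \<le> (\<integral>z. 4 / R\<^sup>2 * indicator (cball c R) z \<partial>lborel)"
  proof (rule integral_mono)
    show "integrable lborel (\<lambda>z. 4 / R\<^sup>2 * indicator (cball c R) z :: real)"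
      using emeasure_lborel_cball_finite[of c R] by (intro integrable_mult_right integrable_real_indicator) auto
  qed (use assms integrable_radial_grad cmod_radial_grad_le in auto)
  also have "\<dots> = 4 / R\<^sup>2 * measure lborel (cball c R)" by simp
  also have "\<dots> = 4 * pi" using assms by (simp add: content_cball_complex)
  finally show ?thesis .
qed

lemma log_pot_nonpos:
  assumes "R > 0" "A \<subseteq> ball c (2 * R)" "\<And>\<gamma>. \<gamma> \<in> A \<Longrightarrow> 0 \<le> w \<gamma>" "z \<in> cball c R" "z \<notin> A"
  shows "log_pot A w R z \<le> 0"
  unfolding log_pot_def
proof (rule sum_nonpos)
  fix \<gamma> assume g: "\<gamma> \<in> A"
  then have "cmod (\<gamma> - c) < 2 * R" "cmod (z - c) \<le> R"
    using assms by (auto simp: dist_norm norm_minus_commute)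
  then have "cmod (z - \<gamma>) \<le> 3 * R"
    using norm_triangle_ineq4[of "z - c" "\<gamma> - c"] by simp
  moreover have "cmod (z - \<gamma>) > 0" using g assms by auto
  ultimately have "ln (cmod (z - \<gamma>) / (3 * R)) \<le> 0" using assms(1) by simp
  then show "w \<gamma> * ln (cmod (z - \<gamma>) / (3 * R)) \<le> 0"
    using assms(3)[OF g] by (simp add: mult_nonneg_nonpos)
qed

lemma cutoff_1: "cutoff 1 A w R z = (if z \<in> A then 0 else bump (1 + log_pot A w R z))"
  by (simp add: cutoff_def bump_def)

lemma cutoff_next: "cutoff (flat_next 1) A w R z = (if z \<in> A then 0 else bump' (1 + log_pot A w R z))"
  by (simp add: cutoff_def bump'_def flat_next_1)

text \<open>\<open>(\<partial>\<^sub>1 + \<i> \<partial>\<^sub>2) (f \<phi>) = \<phi> (\<partial>\<^sub>1 + \<i> \<partial>\<^sub>2) f\<close> for holomorphic \<open>\<phi>\<close>.\<close>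

lemma dbar_mult:
  assumes f: "(f has_derivative (\<lambda>h. Re (g * h))) (at z)" and p: "(\<phi> has_field_derivative p') (at z)"
  shows "partial_deriv 1 (\<lambda>z. of_real (f z) * \<phi> z) z + \<i> * partial_deriv \<i> (\<lambda>z. of_real (f z) * \<phi> z) z
    = cnj g * \<phi> z"
proof -
  have "((\<lambda>z. of_real (f z) * \<phi> z) has_derivative (\<lambda>h. of_real (f z) * (p' * h) + of_real (Re (g * h)) * \<phi> z)) (at z)"
    by (rule has_derivative_mult[OF bounded_linear.has_derivative[OF bounded_linear_of_real f] has_field_derivative_imp_has_derivative[OF p]])
  note pd = partial_deriv_eqI[OF this]
  have cnj_g: "cnj g = of_real (Re g) - \<i> * of_real (Im g)" by (simp add: complex_eq_iff)
  show ?thesis unfolding pd cnj_g by (simp add: algebra_simps)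
qed

locale weighted_points =
  fixes A :: "complex set" and w :: "complex \<Rightarrow> real" and c :: complex and R :: real
  assumes finite_A: "finite A" and R_pos: "R > 0" and A_ball: "A \<subseteq> ball c (2 * R)"
    and w_pos: "\<And>\<gamma>. \<gamma> \<in> A \<Longrightarrow> 0 < w \<gamma>"
begin

abbreviation cut where "cut \<equiv> cutoff 1 A w R"
abbreviation cut' where "cut' \<equiv> cutoff (flat_next 1) A w R"
abbreviation fld where "fld \<equiv> cauchy_sum A w"
abbreviation chi where "chi \<equiv> radial c R"

lemma cut_bounds: "0 \<le> cut z" "cut z \<le> 1" "0 \<le> cut' z" "cut' z \<le> 1"
  by (simp_all add: cutoff_1 cutoff_next bump_nonneg bump'_nonneg bump_le_1 bump'_le_1)

lemma cut_sq_le: "z \<in> cball c R \<Longrightarrow> (cut z)\<^sup>2 \<le> cut' z"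
  using log_pot_nonpos[of R A c w z] R_pos A_ball w_pos
  by (auto simp: cutoff_1 cutoff_next less_imp_le intro!: bump_sq_le)

text \<open>The density chi^2 E'(1+W) |grad W|^2, to which every energy term without the gradient of
  \<open>chi\<close> is reduced.\<close>

definition weight :: "complex \<Rightarrow> real" where
  "weight z = (chi z)\<^sup>2 * (cut' z * (cmod (fld z))\<^sup>2)"

lemma open_compl_A: "open (- A)"
  using finite_A by (simp add: finite_imp_closed open_Compl)

text \<open>\<open>fld\<close> has poles on A, but \<open>cut'\<close> vanishes in a neighbourhood
  of them.\<close>

lemma continuous_weight: "continuous_on UNIV weight"
proof -
  obtain N where N: "open N" "A \<subseteq> N" "\<And>p z. z \<in> N \<Longrightarrow> cutoff p A w R z = 0"
    using cutoff_vanishes[of A R w] finite_A R_pos w_pos by blast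
  have sm: "smooth_on UNIV cut'" by (rule cutoff_smooth[OF finite_A R_pos w_pos])
  have "continuous_on (- A) (\<lambda>z. cut' z * (cmod (fld z))\<^sup>2)"
    by (intro continuous_intros continuous_on_subset[OF smooth_on_continuous[OF sm]]
        holomorphic_on_imp_continuous_on cauchy_sum_holomorphic) auto
  moreover have "continuous_on N (\<lambda>z. cut' z * (cmod (fld z))\<^sup>2)"
    by (rule continuous_on_eq[of _ "\<lambda>_. 0"]) (auto simp: N)
  ultimately have "continuous_on (- A \<union> N) (\<lambda>z. cut' z * (cmod (fld z))\<^sup>2)"
    by (intro continuous_on_open_Un open_compl_A N)
  also have "- A \<union> N = UNIV" using N(2) by auto
  finally have "continuous_on UNIV (\<lambda>z. cut' z * (cmod (fld z))\<^sup>2)" .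
  then show ?thesis
    unfolding weight_def[abs_def]
    by (rule continuous_on_mult[OF continuous_on_power[OF smooth_on_continuous[OF radial_smooth]]])
qed

lemma integrable_weight: "integrable lborel weight"
  by (rule continuous_compact_support_integrable[OF continuous_weight, of "cball c R"])
    (auto simp: weight_def radial_outside[OF R_pos])

text \<open>Let g encode the gradient of f = chi^2 cut. Then (d_1 + i d_2) (f fld) = cnj g fld
  integrates to zero. Its real part is \<open>weight\<close> plus a cross term with the gradient of
  \<open>chi\<close>; Young's inequality absorbs half of \<open>weight\<close>, so that the integral
  is at most four times the Dirichlet integral of \<open>chi\<close>.\<close>

lemma caccioppoli: "(\<integral>z. weight z \<partial>lborel) \<le> 16 * pi"
proof -
  obtain N where N: "open N" "A \<subseteq> N" "\<And>p z. z \<in> N \<Longrightarrow> cutoff p A w R z = 0"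
    using cutoff_vanishes[of A R w] finite_A R_pos w_pos by blast
  define f where "f z = (chi z)\<^sup>2 * cut z" for z
  define g where "g z = of_real (2 * chi z * cut z) * radial_grad c R z + of_real ((chi z)\<^sup>2 * cut' z) * fld z" for z
  have f_deriv: "(f has_derivative (\<lambda>h. Re (g z * h))) (at z)" for z
  proof -
    have "((\<lambda>z. chi z * (chi z * cut z)) has_derivative
        (\<lambda>h. chi z * (chi z * Re (of_real (cut' z) * fld z * h) + Re (radial_grad c R z * h) * cut z)
          + Re (radial_grad c R z * h) * (chi z * cut z))) (at z)"
      by (intro has_derivative_mult radial_has_derivative cutoff_has_derivative finite_A R_pos w_pos)
    moreover have "chi z * (chi z * Re (of_real (cut' z) * fld z * h) + Re (radial_grad c R z * h) * cut z)
          + Re (radial_grad c R z * h) * (chi z * cut z) = Re (g z * h)" for h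
      by (simp add: g_def algebra_simps power2_eq_square)
    ultimately show ?thesis by (simp add: f_def[abs_def] power2_eq_square mult.assoc)
  qed
  \<comment> \<open>The poles of \<open>fld\<close> do no harm: \<open>cut\<close> is zero near
    them, so F is smooth on the whole plane.\<close>
  define F where "F z = of_real (f z) * fld z" for z
  have F_N: "F z = 0" if "z \<in> N" for z using that by (simp add: F_def f_def N)
  have f_smooth: "smooth_on UNIV f"
    unfolding f_def[abs_def] power2_eq_square
    by (intro smooth_on_mult open_UNIV radial_smooth cutoff_smooth finite_A R_pos w_pos)
  have "smooth_on (- A) F"
    unfolding F_def[abs_def]
    by (intro smooth_on_mult open_compl_A smooth_on_linear[OF open_compl_A bounded_linear_of_real]
        smooth_on_subset[OF f_smooth] smooth_on_holomorphic cauchy_sum_holomorphic) auto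
  moreover have "smooth_on N F"
    by (rule smooth_on_cong[OF N(1) smooth_on_const[of _ 0]]) (simp add: F_N)
  ultimately have "smooth_on (- A \<union> N) F"
    by (intro smooth_on_Un open_compl_A N)
  also have "- A \<union> N = UNIV" using N(2) by auto
  finally have F_smooth: "smooth_on UNIV F" .
  have F_test: "F \<in> test_functions UNIV"
    by (rule test_functionsI[OF F_smooth, of "cball c R"]) (auto simp: F_def f_def radial_outside[OF R_pos])
  have F_int: "integrable lborel (partial_deriv b F)" if "b \<in> Basis" for b
    by (rule continuous_compact_support_integrable[of _ "cball c R"])
      (use that in \<open>auto intro!: smooth_on_continuous smooth_on_partial_deriv F_smooth
        partial_deriv_eq_0[of "cball c R"] simp: F_def f_def radial_outside[OF R_pos]\<close>)
  have dbar: "partial_deriv 1 F z + \<i> * partial_deriv \<i> F z = cnj (g z) * fld z" for z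
  proof (cases "z \<in> A")
    case True
    have "(F has_derivative (\<lambda>h. 0)) (at z)"
      by (rule has_derivative_transform_within_open[of "\<lambda>_. 0" "\<lambda>_. 0" z UNIV N]) (use N True F_N in auto)
    then have "partial_deriv b F z = 0" for b by (rule partial_deriv_eqI)
    then show ?thesis using True by (simp add: g_def cutoff_def)
  next
    case False
    have "(fld has_field_derivative deriv fld z) (at z)"
      by (rule holomorphic_derivI[OF cauchy_sum_holomorphic open_compl_A]) (use False in auto)
    from dbar_mult[OF f_deriv this] show ?thesis by (simp add: F_def[abs_def])
  qed
  have int0: "(\<integral>z. cnj (g z) * fld z \<partial>lborel) = 0" and int: "integrable lborel (\<lambda>z. cnj (g z) * fld z)"
  proof -
    have B: "(1 :: complex) \<in> Basis" "\<i> \<in> Basis" by (auto simp: Basis_complex_def)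
    show "(\<integral>z. cnj (g z) * fld z \<partial>lborel) = 0"
      unfolding dbar[symmetric] using F_int[OF B(1)] F_int[OF B(2)]
        test_functions_integral_partial_deriv[OF F_test B(1)] test_functions_integral_partial_deriv[OF F_test B(2)]
      by simp
    show "integrable lborel (\<lambda>z. cnj (g z) * fld z)"
      unfolding dbar[symmetric] using F_int[OF B(1)] F_int[OF B(2)] by simp
  qed
  \<comment> \<open>Young's inequality in the form 2 m r <= m^2 / 2 + 2 r^2, followed by m^2 <=
    weight, which is where \<open>cut_sq_le\<close> is used.\<close>
  have lower: "weight z / 2 - 2 * (cmod (radial_grad c R z))\<^sup>2 \<le> Re (cnj (g z) * fld z)" for z
  proof -
    define r where "r = cmod (radial_grad c R z)"
    define m where "m = chi z * cut z * cmod (fld z)"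
    have "Re (cnj (g z) * fld z) = weight z + 2 * chi z * cut z * Re (cnj (radial_grad c R z) * fld z)"
    proof -
      have "cnj (g z) * fld z = of_real (2 * chi z * cut z) * (cnj (radial_grad c R z) * fld z)
          + of_real ((chi z)\<^sup>2 * cut' z * (cmod (fld z))\<^sup>2)"
        using complex_norm_square[of "fld z"] by (simp add: g_def algebra_simps)
      then have "Re (cnj (g z) * fld z) = Re (of_real (2 * chi z * cut z) * (cnj (radial_grad c R z) * fld z)) + weight z"
        by (simp only: plus_complex.simps Re_complex_of_real weight_def mult.assoc)
      also have "Re (of_real (2 * chi z * cut z) * (cnj (radial_grad c R z) * fld z)) =
          2 * chi z * cut z * Re (cnj (radial_grad c R z) * fld z)"
        unfolding scaleR_conv_of_real[symmetric] by (rule scaleR_complex.simps)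
      finally show ?thesis by simp
    qed
    moreover have "- (r * cmod (fld z)) \<le> Re (cnj (radial_grad c R z) * fld z)"
      using abs_Re_le_cmod[of "cnj (radial_grad c R z) * fld z"] by (simp add: norm_mult r_def)
    then have "2 * chi z * cut z * (- (r * cmod (fld z))) \<le> 2 * chi z * cut z * Re (cnj (radial_grad c R z) * fld z)"
      using radial_nonneg cut_bounds by (intro mult_left_mono) auto
    moreover have "2 * chi z * cut z * (- (r * cmod (fld z))) = - (2 * m * r)" by (simp add: m_def)
    moreover have "0 \<le> (m - 2 * r)\<^sup>2" by simp
    then have "2 * m * r \<le> m\<^sup>2 / 2 + 2 * r\<^sup>2" by (simp add: power2_diff power_mult_distrib)
    moreover have "m\<^sup>2 \<le> weight z"
    proof (cases "z \<in> cball c R")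
      case True
      have "m\<^sup>2 = (chi z)\<^sup>2 * ((cut z)\<^sup>2 * (cmod (fld z))\<^sup>2)" by (simp add: m_def power_mult_distrib)
      also have "\<dots> \<le> weight z"
        unfolding weight_def by (intro mult_left_mono mult_right_mono cut_sq_le True) auto
      finally show ?thesis .
    qed (simp add: m_def weight_def radial_outside[OF R_pos])
    ultimately show ?thesis unfolding r_def[symmetric] by linarith
  qed
  have "(\<integral>z. weight z / 2 - 2 * (cmod (radial_grad c R z))\<^sup>2 \<partial>lborel) \<le> (\<integral>z. Re (cnj (g z) * fld z) \<partial>lborel)"
  proof (rule integral_mono[OF _ _ lower])
    show "integrable lborel (\<lambda>z. weight z / 2 - 2 * (cmod (radial_grad c R z))\<^sup>2)"
      using integrable_weight integrable_radial_grad[OF R_pos] by auto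
    show "integrable lborel (\<lambda>z. Re (cnj (g z) * fld z))"
      by (rule integrable_bounded_linear[OF bounded_linear_Re int])
  qed
  also have "\<dots> = 0" using integral_Re[OF int] int0 by simp
  finally show ?thesis
    using integral_radial_grad_le[OF R_pos, of c] integrable_weight integrable_radial_grad[OF R_pos] by simp
qed

end

section \<open>Trial functions\<close>

text \<open>For x > 1, ln x is at most the number of n with 2^n < x. The logarithm is thus dominated
  by the indicators of the discs of radius 3 R / 2^n, whose areas form a geometric series with sum 9
  pi R^2 times 4/3.\<close>

lemma nn_integral_log:
  fixes \<gamma> :: complex
  assumes R: "R > 0"
  shows "(\<integral>\<^sup>+z. ennreal (ln (3 * R / cmod (z - \<gamma>))) * indicator (ball \<gamma> (3 * R)) z \<partial>lborel) \<le> ennreal (12 * pi * R\<^sup>2)"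
proof -
  have pointwise: "ennreal (ln (3 * R / cmod (z - \<gamma>))) * indicator (ball \<gamma> (3 * R)) z
      \<le> (\<Sum>n. indicator (ball \<gamma> (3 * R / 2 ^ n)) z)" if ne: "z \<noteq> \<gamma>" for z
  proof (cases "z \<in> ball \<gamma> (3 * R)")
    case True
    define x where "x = 3 * R / cmod (z - \<gamma>)"
    have pos: "cmod (z - \<gamma>) > 0" using ne by simp
    have x: "x > 0" using pos R by (simp add: x_def)
    define k where "k = nat \<lceil>ln x\<rceil>"
    have in_ball: "z \<in> ball \<gamma> (3 * R / 2 ^ n)" if "n < k" for n
    proof -
      have "real n < ln x" using that unfolding k_def by linarith
      then have "exp (real n) < x" using x by (metis exp_less_cancel_iff exp_ln)
      moreover have "(2 :: real) ^ n \<le> exp 1 ^ n"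
        using exp_ge_add_one_self[of 1] by (intro power_mono) auto
      ultimately have "2 ^ n < x" by (simp add: exp_of_nat_mult[symmetric])
      then have "cmod (z - \<gamma>) < 3 * R / 2 ^ n"
        using pos by (simp add: x_def field_simps)
      then show ?thesis by (simp add: dist_norm norm_minus_commute)
    qed
    have "ennreal (ln x) \<le> ennreal (real k)" by (intro ennreal_leI) (simp add: k_def real_nat_ceiling_ge)
    also have "\<dots> = (\<Sum>n<k. indicator (ball \<gamma> (3 * R / 2 ^ n)) z)"
      using in_ball by (simp add: ennreal_of_nat_eq_real_of_nat)
    also have "\<dots> \<le> (\<Sum>n. indicator (ball \<gamma> (3 * R / 2 ^ n)) z)"
      by (intro sum_le_suminf) auto
    finally show ?thesis using True by (simp add: x_def)
  qed simp
  have "(\<integral>\<^sup>+z. ennreal (ln (3 * R / cmod (z - \<gamma>))) * indicator (ball \<gamma> (3 * R)) z \<partial>lborel)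
      \<le> (\<integral>\<^sup>+z. (\<Sum>n. indicator (ball \<gamma> (3 * R / 2 ^ n)) z) \<partial>lborel)"
    using AE_lborel_singleton[of \<gamma>]
    by (intro nn_integral_mono_AE) (auto elim!: eventually_mono intro: pointwise)
  also have "\<dots> = (\<Sum>n. emeasure lborel (ball \<gamma> (3 * R / 2 ^ n)))"
    by (subst nn_integral_suminf) (auto intro!: borel_measurable_indicator)
  also have "\<dots> = (\<Sum>n. ennreal (9 * pi * R\<^sup>2 * (1 / 4) ^ n))"
  proof (intro suminf_cong)
    fix n
    have "(3 * R / 2 ^ n)\<^sup>2 = 9 * R\<^sup>2 * (1 / 4) ^ n"
    proof -
      have "((2 :: real) ^ n)\<^sup>2 = 4 ^ n" by (simp add: power2_eq_square flip: power_mult_distrib)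
      then show ?thesis by (simp add: power_divide power_mult_distrib)
    qed
    then show "emeasure lborel (ball \<gamma> (3 * R / 2 ^ n)) = ennreal (9 * pi * R\<^sup>2 * (1 / 4) ^ n)"
      using R by (simp add: emeasure_ball unit_ball_vol_2 mult_ac)
  qed
  also have "\<dots> = ennreal (12 * pi * R\<^sup>2)"
  proof (rule suminf_ennreal_eq)
    have "(\<lambda>n. 9 * pi * R\<^sup>2 * (1 / 4) ^ n) sums (9 * pi * R\<^sup>2 * (1 / (1 - 1 / 4)))"
      by (intro sums_mult geometric_sums) simp
    then show "(\<lambda>n. 9 * pi * R\<^sup>2 * (1 / 4) ^ n) sums (12 * pi * R\<^sup>2)" by (simp add: mult.assoc)
  qed (simp add: R)
  finally show ?thesis .
qed

context weighted_points
begin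

text \<open>The exceptional set of the disc: off it and off A, the cutoff is at least
  \<open>bump (1 / 2)\<close>.\<close>

definition bad :: "complex set" where
  "bad = {z \<in> ball c R. z \<notin> A \<and> log_pot A w R z < - (1 / 2)}"

lemma bad_sets [measurable]: "bad \<in> sets borel"
proof -
  have [measurable]: "log_pot A w R \<in> borel_measurable borel"
    unfolding log_pot_def[abs_def] by measurable
  have "A \<in> sets borel" using finite_A by (intro borel_closed finite_imp_closed)
  moreover have "bad = ball c R \<inter> {z. log_pot A w R z < - (1 / 2)} - A" by (auto simp: bad_def)
  ultimately show ?thesis by simp
qed

text \<open>Markov's inequality: on \<open>bad\<close> one has 1 <= -2 W, and -W is a weighted sum
  of logarithms that \<open>nn_integral_log\<close> integrates.\<close>

lemma emeasure_bad: "emeasure lborel bad \<le> ennreal (24 * pi * R\<^sup>2 * (\<Sum>\<gamma>\<in>A. w \<gamma>))"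
proof -
  let ?l = "\<lambda>\<gamma> z. ennreal (ln (3 * R / cmod (z - \<gamma>))) * indicator (ball \<gamma> (3 * R)) z"
  have pointwise: "indicator bad z \<le> (\<Sum>\<gamma>\<in>A. ennreal (2 * w \<gamma>) * ?l \<gamma> z)" for z
  proof (cases "z \<in> bad")
    case True
    then have z: "z \<in> ball c R" "z \<notin> A" "log_pot A w R z < - (1 / 2)" by (auto simp: bad_def)
    have pt: "z \<in> ball \<gamma> (3 * R) \<and> 0 \<le> ln (3 * R / cmod (z - \<gamma>)) \<and> ln (cmod (z - \<gamma>) / (3 * R)) = - ln (3 * R / cmod (z - \<gamma>))"
      if g: "\<gamma> \<in> A" for \<gamma>
    proof -
      have "cmod (\<gamma> - c) < 2 * R" "cmod (z - c) < R"
        using A_ball z g by (auto simp: dist_norm norm_minus_commute)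
      then have "cmod (z - \<gamma>) < 3 * R"
        using norm_triangle_ineq4[of "z - c" "\<gamma> - c"] by simp
      moreover have "cmod (z - \<gamma>) > 0" using g z by auto
      ultimately show ?thesis
        using R_pos by (auto simp: dist_norm norm_minus_commute ln_div)
    qed
    have "1 \<le> 2 * - log_pot A w R z" using z by simp
    also have "- log_pot A w R z = (\<Sum>\<gamma>\<in>A. w \<gamma> * ln (3 * R / cmod (z - \<gamma>)))"
      unfolding log_pot_def sum_negf[symmetric] by (intro sum.cong refl) (use pt in auto)
    also have "2 * \<dots> = (\<Sum>\<gamma>\<in>A. (2 * w \<gamma>) * ln (3 * R / cmod (z - \<gamma>)))"
      by (simp add: sum_distrib_left mult.assoc)
    finally have "ennreal 1 \<le> ennreal (\<Sum>\<gamma>\<in>A. (2 * w \<gamma>) * ln (3 * R / cmod (z - \<gamma>)))"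
      by (rule ennreal_leI)
    also have "\<dots> = (\<Sum>\<gamma>\<in>A. ennreal ((2 * w \<gamma>) * ln (3 * R / cmod (z - \<gamma>))))"
      using pt w_pos by (intro sum_ennreal[symmetric] mult_nonneg_nonneg) (simp_all add: less_imp_le)
    also have "\<dots> = (\<Sum>\<gamma>\<in>A. ennreal (2 * w \<gamma>) * ?l \<gamma> z)"
    proof (rule sum.cong[OF refl])
      fix \<gamma> assume g: "\<gamma> \<in> A"
      show "ennreal ((2 * w \<gamma>) * ln (3 * R / cmod (z - \<gamma>))) = ennreal (2 * w \<gamma>) * ?l \<gamma> z"
        using pt[OF g] w_pos[OF g] by (simp add: ennreal_mult del: mem_ball)
    qed
    finally show ?thesis using True by simp
  qed simp
  have [measurable]: "?l \<gamma> \<in> borel_measurable lborel" for \<gamma>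
    by (intro borel_measurable_times_ennreal borel_measurable_indicator) auto
  have w_nonneg: "0 \<le> w \<gamma>" if "\<gamma> \<in> A" for \<gamma> using w_pos[OF that] by simp
  have "emeasure lborel bad = (\<integral>\<^sup>+z. indicator bad z \<partial>lborel)" by simp
  also have "\<dots> \<le> (\<integral>\<^sup>+z. (\<Sum>\<gamma>\<in>A. ennreal (2 * w \<gamma>) * ?l \<gamma> z) \<partial>lborel)"
    by (rule nn_integral_mono) (rule pointwise)
  also have "\<dots> = (\<Sum>\<gamma>\<in>A. ennreal (2 * w \<gamma>) * (\<integral>\<^sup>+z. ?l \<gamma> z \<partial>lborel))"
    by (subst nn_integral_sum) (auto simp: nn_integral_cmult)
  also have "\<dots> \<le> (\<Sum>\<gamma>\<in>A. ennreal (2 * w \<gamma>) * ennreal (12 * pi * R\<^sup>2))"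
    by (intro sum_mono mult_left_mono nn_integral_log R_pos) auto
  also have "\<dots> = (\<Sum>\<gamma>\<in>A. ennreal (24 * pi * R\<^sup>2 * w \<gamma>))"
    using w_nonneg by (intro sum.cong refl) (subst ennreal_mult[symmetric], auto simp: mult_ac)
  also have "\<dots> = ennreal (24 * pi * R\<^sup>2 * (\<Sum>\<gamma>\<in>A. w \<gamma>))"
    using w_nonneg by (subst sum_ennreal) (auto simp: sum_distrib_left)
  finally show ?thesis .
qed

lemma cut_lower_bound: "z \<in> ball c R \<Longrightarrow> z \<notin> A \<Longrightarrow> z \<notin> bad \<Longrightarrow> bump (1 / 2) \<le> cut z"
  by (auto simp: bad_def cutoff_1 intro!: bump_mono)

end

section \<open>Local structure of the vector potential\<close>

lemma regular_part:
  assumes lim: "\<And>z. \<not> z islimpt \<Gamma>" and parts: "has_simple_principal_parts \<Gamma> \<alpha> \<phi>"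
    and A: "A = \<Gamma> \<inter> ball c r"
  shows "\<exists>h. h holomorphic_on ball c r \<and> (\<forall>z\<in>ball c r - A. \<phi> z = cauchy_sum A \<alpha> z + h z)"
proof -
  have fin: "finite A"
    unfolding A by (rule finite_subset[OF _ finite_not_islimpt_in_compact[of "cball c r" \<Gamma>]]) (use lim in auto)
  have ana: "\<phi> analytic_on - \<Gamma>" using parts by (simp add: has_simple_principal_parts_def)
  have "\<forall>\<gamma>\<in>A. \<exists>g. g analytic_on {\<gamma>} \<and> (\<forall>\<^sub>F z in at \<gamma>. \<phi> z = of_real (\<alpha> \<gamma>) / (z - \<gamma>) + g z)"
    using parts A by (auto simp: has_simple_principal_parts_def)
  then obtain g where g: "\<And>\<gamma>. \<gamma> \<in> A \<Longrightarrow> g \<gamma> analytic_on {\<gamma>}"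
    "\<And>\<gamma>. \<gamma> \<in> A \<Longrightarrow> \<forall>\<^sub>F z in at \<gamma>. \<phi> z = of_real (\<alpha> \<gamma>) / (z - \<gamma>) + g \<gamma> z"
    by metis
  \<comment> \<open>On A the value comes from the local regular part at z, minus the finite
    contributions of the other points; this is the continuation of h across its removable
    singularity.\<close>
  define h where "h z = (if z \<in> A then g z z - cauchy_sum (A - {z}) \<alpha> z else \<phi> z - cauchy_sum A \<alpha> z)" for z
  have "h field_differentiable (at z)" if z: "z \<in> ball c r" for z
  proof (cases "z \<in> A")
    case False
    then have "z \<in> - \<Gamma>" using z A by auto
    then have "\<phi> analytic_on {z}" using analytic_on_subset[OF ana, of "{z}"] by simp
    then have "\<phi> field_differentiable (at z)" by (rule analytic_on_imp_differentiable_at) simp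
    moreover have opn: "open (- A)" using fin by (simp add: finite_imp_closed open_Compl)
    then have "cauchy_sum A \<alpha> field_differentiable (at z)"
      using holomorphic_on_imp_differentiable_at[OF cauchy_sum_holomorphic] False by blast
    ultimately have "(\<lambda>z. \<phi> z - cauchy_sum A \<alpha> z) field_differentiable (at z)"
      by (rule field_differentiable_diff)
    then obtain D where "((\<lambda>z. \<phi> z - cauchy_sum A \<alpha> z) has_field_derivative D) (at z)"
      by (auto simp: field_differentiable_def)
    then have "(h has_field_derivative D) (at z)"
      by (rule has_field_derivative_transform_within_open[OF _ opn]) (use False in \<open>auto simp: h_def\<close>)
    then show ?thesis by (auto simp: field_differentiable_def)
  next
    case True
    have opn: "open (- (A - {z}))" using fin by (intro open_Compl finite_imp_closed) auto
    have "g z field_differentiable (at z)"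
      using g(1)[OF True] by (rule analytic_on_imp_differentiable_at) simp
    moreover have "cauchy_sum (A - {z}) \<alpha> field_differentiable (at z)"
      using holomorphic_on_imp_differentiable_at[OF cauchy_sum_holomorphic opn] by blast
    ultimately have "(\<lambda>x. g z x - cauchy_sum (A - {z}) \<alpha> x) field_differentiable (at z)"
      by (rule field_differentiable_diff)
    then obtain D where D: "((\<lambda>x. g z x - cauchy_sum (A - {z}) \<alpha> x) has_field_derivative D) (at z)"
      by (auto simp: field_differentiable_def)
    have "\<forall>\<^sub>F x in at z. x \<in> - (A - {z})"
      using eventually_at_in_open'[OF opn, of z] by simp
    with g(2)[OF True] have "\<forall>\<^sub>F x in at z. g z x - cauchy_sum (A - {z}) \<alpha> x = h x"
      using eventually_neq_at_within[of z z UNIV]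
    proof eventually_elim
      case (elim x)
      have "cauchy_sum A \<alpha> x = of_real (\<alpha> z) / (x - z) + cauchy_sum (A - {z}) \<alpha> x"
        unfolding cauchy_sum_def using fin True by (rule sum.remove)
      then show ?case using elim by (auto simp: h_def)
    qed
    then obtain S where S: "open S" "z \<in> S" "\<And>x. x \<in> S \<Longrightarrow> x \<noteq> z \<Longrightarrow> g z x - cauchy_sum (A - {z}) \<alpha> x = h x"
      by (auto simp: eventually_at_topological)
    have "(h has_field_derivative D) (at z)"
    proof (rule has_field_derivative_transform_within_open[OF D S(1,2)])
      fix x assume "x \<in> S"
      then show "g z x - cauchy_sum (A - {z}) \<alpha> x = h x"
        using S(3)[of x] True by (cases "x = z") (auto simp: h_def)
    qed
    then show ?thesis by (auto simp: field_differentiable_def)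
  qed
  then have "h holomorphic_on ball c r"
    by (auto simp: holomorphic_on_def intro: field_differentiable_at_within)
  moreover have "\<phi> z = cauchy_sum A \<alpha> z + h z" if "z \<in> ball c r - A" for z
    using that by (simp add: h_def)
  ultimately show ?thesis by blast
qed

text \<open>Treats both components uniformly, b = 1 giving Im \<phi> and b = i giving Re \<phi>, and
  exhibits each as the imaginary part of a function that is holomorphic wherever \<phi> is.\<close>

lemma vector_potential_inner: "b \<in> Basis \<Longrightarrow> vector_potential \<phi> z \<bullet> b = Im (\<phi> z * b)"
  by (auto simp: vector_potential_def Basis_complex_def inner_complex_def)

lemma smooth_potential_vector_potential:
  assumes lim: "\<And>z. \<not> z islimpt \<Gamma>" and parts: "has_simple_principal_parts \<Gamma> \<alpha> \<phi>"
  shows "smooth_potential (- \<Gamma>) (vector_potential \<phi>)"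
proof
  show opn: "open (- \<Gamma>)" using lim by (simp add: closed_limpt open_Compl)
  fix b :: complex assume b: "b \<in> Basis"
  have "\<phi> holomorphic_on - \<Gamma>"
    using parts by (auto simp: has_simple_principal_parts_def intro: analytic_imp_holomorphic)
  then have "smooth_on (- \<Gamma>) (\<lambda>z. complex_of_real (Im (\<phi> z * b)))"
    by (intro smooth_on_linear[OF opn bounded_linear_of_real] smooth_on_linear[OF opn bounded_linear_Im]
        smooth_on_holomorphic opn holomorphic_intros)
  then show "smooth_on (- \<Gamma>) (\<lambda>x. complex_of_real (vector_potential \<phi> x \<bullet> b))"
    by (simp add: vector_potential_inner b)
qed

text \<open>\<open>bump (3 / 4)\<close> bounds the radial factor from below on the half-radius disc,
  and each \<open>bump (1 / 2)\<close> bounds one cutoff off its exceptional set. The part of the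
  half-radius disc that is left has area at least pi R^2 / 8.\<close>

definition trial_const :: real where
  "trial_const = (bump (3 / 4) * (bump (1 / 2))\<^sup>2)\<^sup>2 * pi / 8"

lemma trial_const_pos: "trial_const > 0"
  using bump_pos[of "3 / 4"] bump_pos[of "1 / 2"] by (simp add: trial_const_def)

text \<open>
  The weights \<open>w\<close> give the factor whose magnetic energy the Caccioppoli estimate controls; the weights \<open>v\<close>
  make the trial function vanish also near the points of \<open>\<Gamma>\<close> that carry no flux.
\<close>

locale two_weights = W: weighted_points A1 w c R + V: weighted_points A v c R
  for A1 A :: "complex set" and w v :: "complex \<Rightarrow> real" and c :: complex and R :: real +
  assumes sub: "A1 \<subseteq> A"
    and w_small: "(\<Sum>\<gamma>\<in>A1. w \<gamma>) \<le> 1 / 400" and v_small: "(\<Sum>\<gamma>\<in>A. v \<gamma>) \<le> 1 / 400"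
begin

definition profile :: "complex \<Rightarrow> real" where
  "profile z = radial c R z * (W.cut z * V.cut z)"

definition profile_grad :: "complex \<Rightarrow> complex" where
  "profile_grad z = of_real (W.cut z * V.cut z) * radial_grad c R z
     + of_real (radial c R z * V.cut z * W.cut' z) * W.fld z
     + of_real (radial c R z * W.cut z * V.cut' z) * V.fld z"

text \<open>After the gauge transformation the gradient and the singular potential contribute an
  imaginary and a real part, up to a common phase, so their squares add without a cross
  term.\<close>

definition energy_density :: "complex \<Rightarrow> real" where
  "energy_density z = (cmod (profile_grad z))\<^sup>2 + (cmod (W.fld z))\<^sup>2 * (profile z)\<^sup>2"

lemma profile_has_derivative: "(profile has_derivative (\<lambda>h. Re (profile_grad z * h))) (at z)"
proof -
  have "((\<lambda>z. radial c R z * (W.cut z * V.cut z)) has_derivative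
      (\<lambda>h. radial c R z * (W.cut z * Re (of_real (V.cut' z) * V.fld z * h) + Re (of_real (W.cut' z) * W.fld z * h) * V.cut z)
        + Re (radial_grad c R z * h) * (W.cut z * V.cut z))) (at z)"
    by (intro has_derivative_mult radial_has_derivative cutoff_has_derivative W.finite_A V.finite_A W.R_pos W.w_pos V.w_pos)
  moreover have "radial c R z * (W.cut z * Re (of_real (V.cut' z) * V.fld z * h) + Re (of_real (W.cut' z) * W.fld z * h) * V.cut z)
        + Re (radial_grad c R z * h) * (W.cut z * V.cut z) = Re (profile_grad z * h)" for h
    by (simp add: profile_grad_def algebra_simps)
  ultimately show ?thesis by (simp add: profile_def[abs_def])
qed

lemma profile_smooth: "smooth_on UNIV profile"
  unfolding profile_def[abs_def]
  by (intro smooth_on_mult open_UNIV radial_smooth cutoff_smooth W.finite_A V.finite_A W.R_pos W.w_pos V.w_pos)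

lemma profile_outside: "z \<notin> cball c R \<Longrightarrow> profile z = 0"
  by (simp add: profile_def radial_outside[OF W.R_pos])

text \<open>The gradient has three terms, hence the factors 3. All cutoffs lie in [0, 1], so
  squaring may keep a single power of \<open>cut'\<close>; the magnetic term adds a fourth copy of
  \<open>W.weight\<close> through \<open>cut_sq_le\<close>.\<close>

lemma energy_density_le:
  "energy_density z \<le> 3 * (cmod (radial_grad c R z))\<^sup>2 + 4 * W.weight z + 3 * V.weight z"
proof -
  define x where "x = of_real (W.cut z * V.cut z) * radial_grad c R z"
  define y where "y = of_real (radial c R z * V.cut z * W.cut' z) * W.fld z"
  define t where "t = of_real (radial c R z * W.cut z * V.cut' z) * V.fld z"
  have grad: "profile_grad z = x + y + t" by (simp add: profile_grad_def x_def y_def t_def)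
  have bounds: "0 \<le> W.cut z" "W.cut z \<le> 1" "0 \<le> W.cut' z" "W.cut' z \<le> 1"
    "0 \<le> V.cut z" "V.cut z \<le> 1" "0 \<le> V.cut' z" "V.cut' z \<le> 1"
    by (rule W.cut_bounds V.cut_bounds)+
  have "(cmod (x + y + t))\<^sup>2 \<le> (cmod x + cmod y + cmod t)\<^sup>2"
    by (intro power_mono norm_triangle_le norm_triangle_ineq add_mono) auto
  also have "\<dots> \<le> 3 * ((cmod x)\<^sup>2 + (cmod y)\<^sup>2 + (cmod t)\<^sup>2)"
    using sum_squares_bound[of "cmod x" "cmod y"] sum_squares_bound[of "cmod x" "cmod t"] sum_squares_bound[of "cmod y" "cmod t"]
    by (simp add: power2_sum algebra_simps)
  finally have 1: "(cmod (profile_grad z))\<^sup>2 \<le> 3 * ((cmod x)\<^sup>2 + (cmod y)\<^sup>2 + (cmod t)\<^sup>2)" by (simp add: grad)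
  have sq_le: "(p * q)\<^sup>2 \<le> q" if "0 \<le> p" "p \<le> 1" "0 \<le> q" "q \<le> 1" for p q :: real
  proof -
    have "(p * q)\<^sup>2 = p\<^sup>2 * (q * q)" by (simp add: power2_eq_square)
    also have "\<dots> \<le> 1 * (1 * q)"
      using that by (intro mult_mono) (auto simp: power_le_one)
    finally show ?thesis by simp
  qed
  have "(W.cut z * V.cut z)\<^sup>2 \<le> 1" using bounds by (intro power_le_one mult_le_one) auto
  then have bx: "(cmod x)\<^sup>2 \<le> 1 * (cmod (radial_grad c R z))\<^sup>2"
    unfolding x_def norm_mult norm_of_real power_mult_distrib power2_abs
    by (intro mult_right_mono) (auto simp: power_mult_distrib)
  have b_y: "(cmod y)\<^sup>2 \<le> W.weight z"
  proof -
    have "(cmod y)\<^sup>2 = (radial c R z)\<^sup>2 * ((V.cut z * W.cut' z)\<^sup>2 * (cmod (W.fld z))\<^sup>2)"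
      unfolding y_def norm_mult norm_of_real power_mult_distrib power2_abs by simp
    also have "\<dots> \<le> W.weight z"
      unfolding W.weight_def using bounds by (intro mult_left_mono mult_right_mono sq_le) auto
    finally show ?thesis .
  qed
  have b_t: "(cmod t)\<^sup>2 \<le> V.weight z"
  proof -
    have "(cmod t)\<^sup>2 = (radial c R z)\<^sup>2 * ((W.cut z * V.cut' z)\<^sup>2 * (cmod (V.fld z))\<^sup>2)"
      unfolding t_def norm_mult norm_of_real power_mult_distrib power2_abs by simp
    also have "\<dots> \<le> V.weight z"
      unfolding V.weight_def using bounds by (intro mult_left_mono mult_right_mono sq_le) auto
    finally show ?thesis .
  qed
  have b_p: "(cmod (W.fld z))\<^sup>2 * (profile z)\<^sup>2 \<le> W.weight z"
  proof (cases "z \<in> cball c R")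
    case True
    have "(V.cut z)\<^sup>2 * (W.cut z)\<^sup>2 \<le> 1 * W.cut' z"
      using bounds W.cut_sq_le[OF True] by (intro mult_mono) (auto simp: power_le_one)
    then have "(radial c R z)\<^sup>2 * (((V.cut z)\<^sup>2 * (W.cut z)\<^sup>2) * (cmod (W.fld z))\<^sup>2) \<le> W.weight z"
      unfolding W.weight_def by (intro mult_left_mono mult_right_mono) auto
    then show ?thesis by (simp add: profile_def power_mult_distrib mult_ac)
  qed (simp add: profile_outside W.weight_def W.cut_bounds)
  have "a + b \<le> 3 * e + 4 * p + 3 * q"
    if "a \<le> 3 * (x + y + t)" "x \<le> 1 * e" "y \<le> p" "t \<le> q" "b \<le> p" for a b e p q x y t :: real
    using that by (simp add: algebra_simps)
  from this[OF 1 bx b_y b_t b_p] show ?thesis by (simp only: energy_density_def)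
qed

text \<open>Area count: the half-radius disc has area pi R^2 / 4, and the two exceptional sets
  remove at most 2 times 24/400, that is 12/100, of pi R^2. More than 1/8 of pi R^2 remains.\<close>

lemma profile_lower_bound:
  "trial_const * R\<^sup>2 \<le> (\<integral>z. (profile z)\<^sup>2 \<partial>lborel)"
proof -
  define k where "k = (bump (3 / 4) * (bump (1 / 2))\<^sup>2)\<^sup>2"
  define S where "S = ball c (R / 2) - A - (W.bad \<union> V.bad)"
  have R: "R > 0" by (rule W.R_pos)
  have A_null: "A \<in> null_sets lborel" by (rule finite_imp_null_set_lborel[OF V.finite_A])
  have S_sets: "S \<in> sets lborel"
    unfolding S_def using A_null W.bad_sets V.bad_sets by (auto intro!: sets.Diff sets.Un)
  have lower: "k * indicator S z \<le> (profile z)\<^sup>2" for z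
  proof (cases "z \<in> S")
    case True
    then have z: "z \<in> ball c (R / 2)" "z \<in> ball c R" "z \<notin> A" "z \<notin> A1" "z \<notin> W.bad" "z \<notin> V.bad"
      using sub R by (auto simp: S_def)
    have "cmod (z - c) \<le> R / 2" using z(1) by (simp add: dist_norm norm_minus_commute)
    then have "(cmod (z - c))\<^sup>2 \<le> (R / 2)\<^sup>2" by (intro power_mono) auto
    then have "(cmod (z - c))\<^sup>2 / R\<^sup>2 \<le> 1 / 4" using R by (simp add: power_divide divide_simps)
    then have "bump (3 / 4) \<le> radial c R z"
      unfolding radial_def by (intro bump_mono) simp
    moreover have "bump (1 / 2) * bump (1 / 2) \<le> W.cut z * V.cut z"
      using z by (intro mult_mono W.cut_lower_bound V.cut_lower_bound) (auto simp: bump_nonneg W.cut_bounds)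
    ultimately have "bump (3 / 4) * (bump (1 / 2))\<^sup>2 \<le> profile z"
      unfolding profile_def power2_eq_square by (rule mult_mono) (auto simp: bump_nonneg radial_nonneg)
    then have "k \<le> (profile z)\<^sup>2"
      unfolding k_def by (intro power_mono) (auto simp: bump_nonneg)
    then show ?thesis using True by simp
  qed simp
  have bad_fin: "emeasure lborel W.bad \<noteq> \<infinity>" "emeasure lborel V.bad \<noteq> \<infinity>"
    using W.emeasure_bad V.emeasure_bad by (auto simp: top_unique)
  have bad_le: "measure lborel W.bad \<le> 24 * pi * R\<^sup>2 * (1 / 400)" "measure lborel V.bad \<le> 24 * pi * R\<^sup>2 * (1 / 400)"
  proof -
    have w_sum: "0 \<le> (\<Sum>\<gamma>\<in>A1. w \<gamma>)" and v_sum: "0 \<le> (\<Sum>\<gamma>\<in>A. v \<gamma>)"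
      using W.w_pos V.w_pos by (auto simp: sum_nonneg less_imp_le)
    have "measure lborel W.bad \<le> 24 * pi * R\<^sup>2 * (\<Sum>\<gamma>\<in>A1. w \<gamma>)"
      using W.emeasure_bad w_sum unfolding measure_def by (intro enn2real_leI) auto
    also have "\<dots> \<le> 24 * pi * R\<^sup>2 * (1 / 400)" by (intro mult_left_mono w_small) auto
    finally show "measure lborel W.bad \<le> 24 * pi * R\<^sup>2 * (1 / 400)" .
    have "measure lborel V.bad \<le> 24 * pi * R\<^sup>2 * (\<Sum>\<gamma>\<in>A. v \<gamma>)"
      using V.emeasure_bad v_sum unfolding measure_def by (intro enn2real_leI) auto
    also have "\<dots> \<le> 24 * pi * R\<^sup>2 * (1 / 400)" by (intro mult_left_mono v_small) auto
    finally show "measure lborel V.bad \<le> 24 * pi * R\<^sup>2 * (1 / 400)" .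
  qed
  have ball_fm: "ball c (R / 2) \<in> fmeasurable lborel"
    using emeasure_lborel_ball_finite[of c "R / 2"] by (intro fmeasurableI) (auto simp: less_top)
  have S_fin: "S \<in> fmeasurable lborel"
    by (rule fmeasurableI2[of "ball c (R / 2)"]) (use S_sets ball_fm in \<open>auto simp: S_def\<close>)
  have bad_fm: "W.bad \<in> fmeasurable lborel" "V.bad \<in> fmeasurable lborel"
    using bad_fin W.bad_sets V.bad_sets by (auto intro!: fmeasurableI simp: less_top)
  have A_fm: "A \<in> fmeasurable lborel" and A_0: "measure lborel A = 0"
    using A_null by (auto intro!: fmeasurableI simp: null_sets_def measure_def)
  have "pi * (R / 2)\<^sup>2 = measure lborel (ball c (R / 2))"
    using R by (simp add: content_ball_complex)
  also have "\<dots> \<le> measure lborel (S \<union> (A \<union> (W.bad \<union> V.bad)))"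
    using S_fin A_fm bad_fm by (intro measure_mono_fmeasurable) (auto simp: S_def intro!: fmeasurable.Un)
  also have "\<dots> \<le> measure lborel S + measure lborel (A \<union> (W.bad \<union> V.bad))"
    using S_fin A_fm bad_fm by (intro measure_Un_le) (auto dest: fmeasurableD)
  also have "measure lborel (A \<union> (W.bad \<union> V.bad)) \<le> measure lborel A + measure lborel (W.bad \<union> V.bad)"
    using A_fm bad_fm by (intro measure_Un_le) (auto dest: fmeasurableD)
  also have "measure lborel (W.bad \<union> V.bad) \<le> measure lborel W.bad + measure lborel V.bad"
    using bad_fm by (intro measure_Un_le) (auto dest: fmeasurableD)
  finally have "pi * (R / 2)\<^sup>2 \<le> measure lborel S + 2 * (24 * pi * R\<^sup>2 * (1 / 400))"
    using bad_le A_0 by linarith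
  moreover define P where "P = pi * R\<^sup>2"
  ultimately have "P / 4 \<le> measure lborel S + 12 * P / 100" by (simp add: power_divide)
  moreover have "0 \<le> P" by (simp add: P_def)
  ultimately have "P / 8 \<le> measure lborel S" by linarith
  then have S_measure: "pi * R\<^sup>2 / 8 \<le> measure lborel S" by (simp add: P_def)
  have "trial_const * R\<^sup>2 = k * (pi * R\<^sup>2 / 8)" by (simp add: trial_const_def k_def)
  also have "\<dots> \<le> k * measure lborel S"
    using S_measure by (intro mult_left_mono) (auto simp: k_def)
  also have "\<dots> = (\<integral>z. k * indicator S z \<partial>lborel)" by simp
  also have "\<dots> \<le> (\<integral>z. (profile z)\<^sup>2 \<partial>lborel)"
  proof (rule integral_mono)
    show "integrable lborel (\<lambda>z. k * indicator S z)"
      using S_fin by (intro integrable_mult_right integrable_real_indicator) (auto simp: fmeasurable_def)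
    show "integrable lborel (\<lambda>z. (profile z)\<^sup>2)"
      by (rule continuous_compact_support_integrable[of _ "cball c R"])
        (auto intro!: continuous_intros smooth_on_continuous[OF profile_smooth] simp: profile_outside)
  qed (use lower in auto)
  finally show ?thesis .
qed

end

text \<open>The gauge factor exp (i Im G) with G' = h + i \<xi> cancels the regular part h and
  carries the plane wave of momentum \<xi> along the real axis. In units of pi the bound is 124 = 3
  * 4 + 4 * 16 + 3 * 16, from \<open>energy_density_le\<close>,
  \<open>integral_radial_grad_le\<close> and \<open>caccioppoli\<close>.\<close>

lemma trial_function:
  assumes lim: "\<And>z. \<not> z islimpt \<Gamma>" and parts: "has_simple_principal_parts \<Gamma> \<alpha> \<phi>"
    and nonneg: "\<And>\<gamma>. \<gamma> \<in> \<Gamma> \<Longrightarrow> 0 \<le> \<alpha> \<gamma>"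
    and R: "R > 0" and small: "(\<Sum>\<gamma>\<in>\<Gamma> \<inter> ball c (2 * R). \<alpha> \<gamma>) \<le> 1 / 400"
  shows "\<exists>u\<in>test_functions (- \<Gamma>). trial_const * R\<^sup>2 \<le> (L2_norm lborel u)\<^sup>2 \<and>
    (\<forall>b\<in>Basis. (L2_norm lborel (\<lambda>z. magnetic_deriv (vector_potential \<phi>) b u z - of_real (of_real \<xi> \<bullet> b) * u z))\<^sup>2 \<le> 124 * pi)"
proof -
  define A where "A = \<Gamma> \<inter> ball c (2 * R)"
  have fin: "finite A"
    unfolding A_def by (rule finite_subset[OF _ finite_not_islimpt_in_compact[of "cball c (2 * R)" \<Gamma>]]) (use lim in auto)
  define A1 where "A1 = {\<gamma>\<in>A. 0 < \<alpha> \<gamma>}"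
  \<comment> \<open>Equal positive weights whose total stays below 1/400 however many points A
    has.\<close>
  define v where "v = (\<lambda>\<gamma> :: complex. 1 / (400 * (real (card A) + 1)))"
  have v_sum: "(\<Sum>\<gamma>\<in>A. v \<gamma>) \<le> 1 / 400" by (simp add: v_def field_simps)
  have alpha_0: "\<alpha> \<gamma> = 0" if "\<gamma> \<in> A - A1" for \<gamma>
    using that nonneg[of \<gamma>] by (auto simp: A_def A1_def)
  have A1_sum: "(\<Sum>\<gamma>\<in>A1. \<alpha> \<gamma>) \<le> 1 / 400"
  proof -
    have "(\<Sum>\<gamma>\<in>A1. \<alpha> \<gamma>) = (\<Sum>\<gamma>\<in>A. \<alpha> \<gamma>)"
      by (rule sum.mono_neutral_left) (use fin alpha_0 in \<open>auto simp: A1_def\<close>)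
    with small show ?thesis by (simp add: A_def)
  qed
  have fin1: "finite A1" using fin by (simp add: A1_def)
  have subsets: "A1 \<subseteq> A" "A \<subseteq> ball c (2 * R)" by (auto simp: A1_def A_def)
  have pos: "0 < \<alpha> \<gamma>" if "\<gamma> \<in> A1" for \<gamma> using that by (simp add: A1_def)
  have v_pos: "0 < v \<gamma>" for \<gamma> by (simp add: v_def add_nonneg_pos)
  interpret two_weights A1 A \<alpha> v c R
    by unfold_locales (use fin fin1 R A1_sum v_sum subsets pos v_pos in auto)
  have fld_eq: "cauchy_sum A \<alpha> z = W.fld z" for z
    unfolding cauchy_sum_def by (rule sum.mono_neutral_right) (use fin alpha_0 in \<open>auto simp: A1_def\<close>)
  obtain h where h: "h holomorphic_on ball c (2 * R)"
    and phi: "\<And>z. z \<in> ball c (2 * R) \<Longrightarrow> z \<notin> A \<Longrightarrow> \<phi> z = W.fld z + h z"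
    using regular_part[OF lim parts A_def] unfolding fld_eq by auto
  \<comment> \<open>The constant i \<xi> adds Im (i \<xi> d) = \<xi> Re d to the derivative of the
    phase, which is the plane wave.\<close>
  have "(\<lambda>z. h z + \<i> * of_real \<xi>) holomorphic_on ball c (2 * R)" by (intro holomorphic_intros h)
  then obtain G where G0: "\<And>z. z \<in> ball c (2 * R) \<Longrightarrow> (G has_field_derivative (h z + \<i> * of_real \<xi>)) (at z within ball c (2 * R))"
    using holomorphic_convex_primitive'[OF convex_ball open_ball] by blast
  have G: "(G has_field_derivative (h z + \<i> * of_real \<xi>)) (at z)" if "z \<in> ball c (2 * R)" for z
    using G0[OF that] at_within_open[OF that open_ball] by simp
  have G_hol: "G holomorphic_on ball c (2 * R)"
    unfolding holomorphic_on_def field_differentiable_def using G0 by blast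
  \<comment> \<open>This is exp (i Im G), written so that its smoothness follows from that of G and
    its conjugate.\<close>
  define \<Theta> where "\<Theta> z = exp ((1 / 2) * (G z - cnj (G z)))" for z
  have Theta_smooth: "smooth_on (ball c (2 * R)) \<Theta>"
    unfolding \<Theta>_def[abs_def]
    by (intro smooth_on_exp smooth_on_mult smooth_on_const smooth_on_minus open_ball
        smooth_on_linear[OF open_ball bounded_linear_cnj] smooth_on_holomorphic G_hol)
  have Theta_norm: "cmod (\<Theta> z) = 1" for z by (simp add: \<Theta>_def)
  have Theta_deriv: "(\<Theta> has_derivative (\<lambda>d. \<i> * of_real (Im ((h z + \<i> * of_real \<xi>) * d)) * \<Theta> z)) (at z)"
    if z: "z \<in> ball c (2 * R)" for z
  proof -
    have dG: "(G has_derivative (\<lambda>d. (h z + \<i> * of_real \<xi>) * d)) (at z)"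
      using G[OF z] by (rule has_field_derivative_imp_has_derivative)
    have "((\<lambda>z. (1 / 2) * (G z - cnj (G z))) has_derivative
        (\<lambda>d. (1 / 2) * ((h z + \<i> * of_real \<xi>) * d - cnj ((h z + \<i> * of_real \<xi>) * d)))) (at z)"
      by (intro has_derivative_mult_right has_derivative_diff dG bounded_linear.has_derivative[OF bounded_linear_cnj dG])
    from has_derivative_compose[OF this has_field_derivative_imp_has_derivative[OF DERIV_exp]]
    have "(\<Theta> has_derivative (\<lambda>d. \<Theta> z * ((1 / 2) * ((h z + \<i> * of_real \<xi>) * d - cnj ((h z + \<i> * of_real \<xi>) * d))))) (at z)"
      by (simp add: \<Theta>_def[abs_def])
    moreover have "\<Theta> z * ((1 / 2) * (q - cnj q)) = \<i> * of_real (Im q) * \<Theta> z" for q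
      using complex_diff_cnj[of q] by simp
    ultimately show ?thesis by (simp only:)
  qed
  define u where "u z = (if z \<in> ball c (2 * R) then \<Theta> z * of_real (profile z) else 0)" for z
  have u_outside: "u z = 0" if "z \<notin> cball c R" for z
    using profile_outside[OF that] by (simp add: u_def)
  have cmod_u: "cmod (u z) = \<bar>profile z\<bar>" for z
  proof (cases "z \<in> ball c (2 * R)")
    case False
    then have "z \<notin> cball c R" using R by auto
    then show ?thesis by (simp add: u_outside profile_outside)
  qed (simp add: u_def norm_mult Theta_norm)
  obtain N where N: "open N" "A \<subseteq> N" "\<And>p z. z \<in> N \<Longrightarrow> cutoff p A v R z = 0"
    using cutoff_vanishes[of A R v] V.finite_A V.R_pos V.w_pos by blast
  have u_N: "u z = 0" if "z \<in> N" for z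
    using N(3)[OF that] by (simp add: u_def profile_def)
  have "smooth_on (ball c (2 * R)) u"
  proof (rule smooth_on_cong[OF open_ball])
    show "smooth_on (ball c (2 * R)) (\<lambda>z. \<Theta> z * complex_of_real (profile z))"
      by (intro smooth_on_mult open_ball Theta_smooth smooth_on_linear[OF open_ball bounded_linear_of_real]
          smooth_on_subset[OF profile_smooth]) auto
  qed (simp add: u_def)
  moreover have "smooth_on (- cball c R) u"
    by (rule smooth_on_cong[OF _ smooth_on_const[of _ 0]]) (auto simp: u_outside)
  ultimately have "smooth_on (ball c (2 * R) \<union> - cball c R) u"
    by (intro smooth_on_Un) auto
  also have "ball c (2 * R) \<union> - cball c R = UNIV" using R by auto
  finally have u_smooth: "smooth_on UNIV u" .
  have u_test: "u \<in> test_functions (- \<Gamma>)"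
  proof (rule test_functionsI[OF u_smooth])
    show "compact (cball c R - N)" by (intro compact_diff N) auto
    show "cball c R - N \<subseteq> - \<Gamma>" using N(2) R by (auto simp: A_def)
    show "u z = 0" if "z \<notin> cball c R - N" for z using that u_outside u_N by blast
  qed
  interpret smooth_potential "- \<Gamma>" "vector_potential \<phi>"
    by (rule smooth_potential_vector_potential[OF lim parts])
  \<comment> \<open>Here m is the derivative of the phase, a' the potential, x the momentum and w'
    the singular part. The phase cancels a' and x and leaves only w' and the derivative r of the
    profile.\<close>
  have gauge: "(1 / \<i>) * (T * of_real r + \<i> * of_real m * T * of_real p) - of_real a' * (T * of_real p) - of_real x * (T * of_real p)
      = T * Complex (- w' * p) (- r)" if "m = a' + x - w'" for T and r m p a' x w' :: real
    unfolding that Complex_eq by (simp add: algebra_simps)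
  have gauge_norm: "(cmod (\<Theta> z * Complex (- w' * p) (- r)))\<^sup>2 = (w' * p)\<^sup>2 + r\<^sup>2" for z and w' p r :: real
    by (simp add: norm_mult Theta_norm cmod_power2)
  define E where "E z = 3 * (cmod (radial_grad c R z))\<^sup>2 + 4 * W.weight z + 3 * V.weight z" for z
  have E_int: "integrable lborel E"
    unfolding E_def[abs_def]
    by (intro Bochner_Integration.integrable_add integrable_mult_right integrable_radial_grad R W.integrable_weight V.integrable_weight)
  have E_le: "(\<integral>z. E z \<partial>lborel) \<le> 124 * pi"
    unfolding E_def[abs_def]
    using integral_radial_grad_le[OF R, of c] W.caccioppoli V.caccioppoli
      integrable_radial_grad[OF R, of c] W.integrable_weight V.integrable_weight by simp
  have energy_nonneg: "0 \<le> E z" for z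
  proof -
    have "0 \<le> energy_density z" by (simp add: energy_density_def)
    also have "\<dots> \<le> E z" unfolding E_def by (rule energy_density_le)
    finally show ?thesis .
  qed
  have energy: "(L2_norm lborel (\<lambda>z. magnetic_deriv (vector_potential \<phi>) b u z - of_real (of_real \<xi> \<bullet> b) * u z))\<^sup>2 \<le> 124 * pi"
    if b: "b \<in> Basis" for b
  proof -
    define f where "f z = magnetic_deriv (vector_potential \<phi>) b u z - of_real (of_real \<xi> \<bullet> b) * u z" for z
    have f_L2: "f \<in> L2 lborel"
      unfolding f_def[abs_def]
      by (intro L.V_diff L.V_scale D_in_L2 magnetic_deriv_test u_test b)
    have norm_b: "cmod b = 1" using b by simp
    have "(cmod (f z))\<^sup>2 \<le> E z" if "z \<notin> A" for z
    proof (cases "z \<in> ball c (2 * R)")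
      case False
      then have "z \<notin> cball c R" using R by auto
      then have "f z = 0"
        using partial_deriv_eq_0[of "cball c R" u z b] u_outside by (simp add: f_def magnetic_deriv_def)
      then show ?thesis using energy_nonneg by simp
    next
      case True
      let ?H = "h z + \<i> * of_real \<xi>"
      have "((\<lambda>z. \<Theta> z * of_real (profile z)) has_derivative
          (\<lambda>d. \<Theta> z * of_real (Re (profile_grad z * d)) + \<i> * of_real (Im (?H * d)) * \<Theta> z * of_real (profile z))) (at z)"
        by (rule has_derivative_mult[OF Theta_deriv[OF True] bounded_linear.has_derivative[OF bounded_linear_of_real profile_has_derivative]])
      then have "(u has_derivative
          (\<lambda>d. \<Theta> z * of_real (Re (profile_grad z * d)) + \<i> * of_real (Im (?H * d)) * \<Theta> z * of_real (profile z))) (at z)"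
        by (rule has_derivative_transform_within_open[OF _ open_ball True]) (simp add: u_def)
      then have pd: "partial_deriv b u z = \<Theta> z * of_real (Re (profile_grad z * b)) + \<i> * of_real (Im (?H * b)) * \<Theta> z * of_real (profile z)"
        by (rule partial_deriv_eqI)
      have "Im (?H * b) = vector_potential \<phi> z \<bullet> b + of_real \<xi> \<bullet> b - Im (W.fld z * b)"
        using phi[OF True that] b
        by (auto simp: vector_potential_def Basis_complex_def inner_complex_def)
      then have "f z = \<Theta> z * Complex (- Im (W.fld z * b) * profile z) (- Re (profile_grad z * b))"
        unfolding f_def magnetic_deriv_def pd using True
        by (simp only: u_def if_True gauge)
      then have "(cmod (f z))\<^sup>2 = (Im (W.fld z * b) * profile z)\<^sup>2 + (Re (profile_grad z * b))\<^sup>2"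
        by (simp only: gauge_norm)
      also have "\<dots> \<le> (cmod (W.fld z))\<^sup>2 * (profile z)\<^sup>2 + (cmod (profile_grad z))\<^sup>2"
      proof (intro add_mono)
        have "\<bar>Im (W.fld z * b)\<bar> \<le> cmod (W.fld z)" "\<bar>Re (profile_grad z * b)\<bar> \<le> cmod (profile_grad z)"
          using abs_Im_le_cmod[of "W.fld z * b"] abs_Re_le_cmod[of "profile_grad z * b"] norm_b by (simp_all add: norm_mult)
        then show "(Im (W.fld z * b) * profile z)\<^sup>2 \<le> (cmod (W.fld z))\<^sup>2 * (profile z)\<^sup>2"
            "(Re (profile_grad z * b))\<^sup>2 \<le> (cmod (profile_grad z))\<^sup>2"
          by (auto simp: power_mult_distrib abs_le_square_iff[symmetric] intro!: mult_right_mono)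
      qed
      also have "\<dots> \<le> E z" using energy_density_le[of z] by (simp add: E_def energy_density_def)
      finally show ?thesis .
    qed
    \<comment> \<open>The splitting of \<phi> is available only off A, which is a null set.\<close>
    moreover have "AE z in lborel. z \<notin> A"
      by (rule AE_not_in[OF finite_imp_null_set_lborel[OF fin]])
    ultimately have "AE z in lborel. (cmod (f z))\<^sup>2 \<le> E z" by (auto elim: eventually_mono)
    then have "(\<integral>z. (cmod (f z))\<^sup>2 \<partial>lborel) \<le> (\<integral>z. E z \<partial>lborel)"
      using f_L2 E_int by (intro integral_mono_AE) (auto simp: L2_def)
    then have "(L2_norm lborel f)\<^sup>2 \<le> 124 * pi"
      using E_le by (simp add: L2_norm_def)
    then show ?thesis by (simp add: f_def[abs_def])
  qed
  have "trial_const * R\<^sup>2 \<le> (L2_norm lborel u)\<^sup>2"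
    using profile_lower_bound by (simp add: L2_norm_def cmod_u)
  with u_test energy show ?thesis by blast
qed

section \<open>Large discs with small flux\<close>

text \<open>None of the first n + 1 events occurs with probability (1 - p)^(n + 1), which tends to
  0.\<close>

lemma (in prob_space) AE_ex_indep_events:
  fixes F :: "nat \<Rightarrow> 'a set"
  assumes indep: "indep_events F UNIV" and p: "\<And>j. prob (F j) = p" "0 < p"
  shows "AE \<omega> in M. \<exists>j. \<omega> \<in> F j"
proof -
  have ev: "F j \<in> events" for j using indep by (auto simp: indep_events_def)
  have "indep_sets (\<lambda>j. sigma_sets (space M) {F j}) UNIV"
    using indep unfolding indep_events_def_alt by (rule indep_sets_sigma) (simp add: Int_stable_def)
  then have prod: "prob (\<Inter>j\<in>{..n}. space M - F j) = (\<Prod>j\<in>{..n}. prob (space M - F j))" for n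
    by (rule indep_setsD) (auto intro: sigma_sets.Compl)
  have p1: "p \<le> 1" using p(1)[of 0] prob_le_1 by metis
  define B where "B = space M - (\<Union>j. F j)"
  have B: "B \<in> events" using ev by (auto simp: B_def)
  have "prob B \<le> (1 - p) ^ Suc n" for n
  proof -
    have "prob B \<le> prob (\<Inter>j\<in>{..n}. space M - F j)"
      using ev by (intro finite_measure_mono sets.finite_INT) (auto simp: B_def)
    also have "\<dots> = (1 - p) ^ Suc n" unfolding prod using ev p(1) by (simp add: prob_compl)
    finally show ?thesis .
  qed
  moreover have "(\<lambda>n. (1 - p) ^ Suc n) \<longlonglongrightarrow> 0"
    using p(2) p1 by (intro LIMSEQ_Suc LIMSEQ_power_zero) auto
  ultimately have "prob B \<le> 0" by (intro LIMSEQ_le_const) auto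
  then have "prob B = 0" using measure_nonneg[of M B] by linarith
  then have "B \<in> null_sets M" using B by (simp add: null_sets_def emeasure_eq_measure)
  then show ?thesis by (rule AE_I') (auto simp: B_def)
qed

definition tile :: "complex \<Rightarrow> complex set" where
  "tile n = (\<lambda>z. z + n) ` square 0"

lemma tile_eq: "tile n = {z. - 1/2 \<le> Re z - Re n \<and> Re z - Re n < 1/2 \<and> - 1/2 \<le> Im z - Im n \<and> Im z - Im n < 1/2}"
proof
  show "tile n \<subseteq> {z. - 1/2 \<le> Re z - Re n \<and> Re z - Re n < 1/2 \<and> - 1/2 \<le> Im z - Im n \<and> Im z - Im n < 1/2}"
    by (auto simp: tile_def square_def)
  show "{z. - 1/2 \<le> Re z - Re n \<and> Re z - Re n < 1/2 \<and> - 1/2 \<le> Im z - Im n \<and> Im z - Im n < 1/2} \<subseteq> tile n"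
  proof
    fix z assume "z \<in> {z. - 1/2 \<le> Re z - Re n \<and> Re z - Re n < 1/2 \<and> - 1/2 \<le> Im z - Im n \<and> Im z - Im n < 1/2}"
    then have "z - n \<in> square 0" by (auto simp: square_def)
    then show "z \<in> tile n" unfolding tile_def by (rule rev_image_eqI) simp
  qed
qed

lemma tile_sets [measurable]: "tile n \<in> sets borel"
  unfolding tile_eq by measurable

lemma square_0: "square 0 = tile 0"
  by (simp add: tile_def)

text \<open>Square arrays of tile centres around the points j (2k + 1) of the real axis, the
  smallest spacing that keeps them disjoint; translates along one direction already give infinitely
  many.\<close>

definition block :: "nat \<Rightarrow> nat \<Rightarrow> complex set" where
  "block k j = (\<lambda>(p, q). Complex (of_int (int j * (2 * int k + 1) + p)) (of_int q)) ` ({- int k..int k} \<times> {- int k..int k})"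

lemma finite_block: "finite (block k j)"
  by (simp add: block_def)

lemma block_lattice: "block k j \<subseteq> int_lattice"
  unfolding block_def int_lattice_def by (auto simp del: of_int_add of_int_mult)

lemma card_block: "card (block k j) = (2 * k + 1)\<^sup>2"
proof -
  have "card (block k j) = card ({- int k..int k} \<times> {- int k..int k})"
    unfolding block_def by (rule card_image) (auto simp: inj_on_def)
  also have "\<dots> = (2 * k + 1)\<^sup>2"
    by (simp add: card_cartesian_product power2_eq_square nat_add_distrib nat_mult_distrib)
  finally show ?thesis .
qed

text \<open>The centres of different blocks are at least 2k + 1 apart, while two offsets differ by
  at most 2k.\<close>

lemma block_disjoint:
  assumes "i \<noteq> j" shows "block k i \<inter> block k j = {}"
proof (rule ccontr)
  assume "block k i \<inter> block k j \<noteq> {}"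
  then obtain p p' where p: "p \<in> {- int k..int k}" "p' \<in> {- int k..int k}"
    and eq: "int i * (2 * int k + 1) + p = int j * (2 * int k + 1) + p'"
    unfolding block_def by (auto simp del: of_int_add of_int_mult atLeastAtMost_iff)
  from eq have eq': "(int i - int j) * (2 * int k + 1) = p' - p"
    by (simp add: algebra_simps)
  have "1 \<le> \<bar>int i - int j\<bar>" using assms by auto
  then have "1 * (2 * int k + 1) \<le> \<bar>int i - int j\<bar> * (2 * int k + 1)" by (intro mult_right_mono) auto
  also have "\<dots> = \<bar>p' - p\<bar>" unfolding eq'[symmetric] by (simp add: abs_mult)
  finally show False using p by auto
qed

section \<open>Tiles, blocks and discs of small flux\<close>

context random_flux
begin

text \<open>The first alternative of \<open>small_flux\<close> includes this bound in its event. In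
  the second, \<alpha> <= sqrt \<alpha> because 0 <= \<alpha> < 1, so a small sum of roots forces a
  small flux.\<close>

lemma prob_flux_small_pos:
  assumes e: "e > 0"
  shows "0 < prob {\<omega> \<in> space P. flux (\<Gamma> \<omega>) (\<alpha> \<omega>) (square 0) < ennreal e}"
proof -
  have sq: "square 0 \<in> sets borel"
    unfolding square_def by measurable
  have ev: "{\<omega> \<in> space P. flux (\<Gamma> \<omega>) (\<alpha> \<omega>) (square 0) < ennreal e} \<in> events"
    using flux_measurable[OF sq] by measurable
  have mono: "0 < prob {\<omega> \<in> space P. flux (\<Gamma> \<omega>) (\<alpha> \<omega>) (square 0) < ennreal e}"
    if "S \<subseteq> {\<omega> \<in> space P. flux (\<Gamma> \<omega>) (\<alpha> \<omega>) (square 0) < ennreal e}" "0 < prob S" for S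
    using finite_measure_mono[OF that(1) ev] that(2) by linarith
  show ?thesis
    using small_flux
  proof (elim disjE exE conjE)
    fix c :: real
    assume "\<forall>\<epsilon>>0. prob {\<omega> \<in> space P. flux (\<Gamma> \<omega>) (\<alpha> \<omega>) (square 0) < ennreal \<epsilon> \<and>
            (\<forall>\<gamma>\<in>\<Gamma> \<omega> \<inter> square 0. \<forall>\<gamma>'\<in>\<Gamma> \<omega> \<inter> square 0. \<gamma> \<noteq> \<gamma>' \<longrightarrow>
               ball \<gamma> (c * sqrt (\<alpha> \<omega> \<gamma>)) \<inter> ball \<gamma>' (c * sqrt (\<alpha> \<omega> \<gamma>')) = {}) \<and>
            (\<forall>\<gamma>\<in>\<Gamma> \<omega> \<inter> square 0. ball \<gamma> (c * sqrt (\<alpha> \<omega> \<gamma>)) \<inter> frontier (square 0) = {})} > 0"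
    from this[rule_format, OF e] show ?thesis by (rule mono[rotated]) auto
  next
    assume *: "\<forall>\<epsilon>>0. prob {\<omega> \<in> space P. (\<Sum>\<gamma>\<in>\<Gamma> \<omega> \<inter> square 0. sqrt (\<alpha> \<omega> \<gamma>)) < \<epsilon>} > 0"
    have "flux (\<Gamma> \<omega>) (\<alpha> \<omega>) (square 0) < ennreal e"
      if w: "\<omega> \<in> space P" and lt: "(\<Sum>\<gamma>\<in>\<Gamma> \<omega> \<inter> square 0. sqrt (\<alpha> \<omega> \<gamma>)) < e" for \<omega>
    proof -
      have fin: "finite (\<Gamma> \<omega> \<inter> square 0)"
        by (rule finite_Int_square) (rule no_accumulation[OF w])
      have range: "0 \<le> \<alpha> \<omega> \<gamma>" "\<alpha> \<omega> \<gamma> \<le> sqrt (\<alpha> \<omega> \<gamma>)" if "\<gamma> \<in> \<Gamma> \<omega> \<inter> square 0" for \<gamma>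
      proof -
        have a: "0 \<le> \<alpha> \<omega> \<gamma>" "\<alpha> \<omega> \<gamma> < 1" using alpha_range[OF w] that by auto
        then show "0 \<le> \<alpha> \<omega> \<gamma>" by simp
        have "(\<alpha> \<omega> \<gamma>)\<^sup>2 \<le> \<alpha> \<omega> \<gamma>" using a by (simp add: power2_eq_square mult_left_le)
        then show "\<alpha> \<omega> \<gamma> \<le> sqrt (\<alpha> \<omega> \<gamma>)" by (rule real_le_rsqrt)
      qed
      have "flux (\<Gamma> \<omega>) (\<alpha> \<omega>) (square 0) = ennreal (\<Sum>\<gamma>\<in>\<Gamma> \<omega> \<inter> square 0. \<alpha> \<omega> \<gamma>)"
        unfolding flux_def by (subst infsum_finite[OF fin], rule sum_ennreal) (rule range)
      also have "\<dots> \<le> ennreal (\<Sum>\<gamma>\<in>\<Gamma> \<omega> \<inter> square 0. sqrt (\<alpha> \<omega> \<gamma>))"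
        using range by (intro ennreal_leI sum_mono) auto
      also have "\<dots> < ennreal e" using lt e by (simp add: ennreal_lessI)
      finally show ?thesis .
    qed
    then show ?thesis using *[rule_format, OF e] by (intro mono) auto
  qed
qed

lemma finite_Int_tile:
  assumes "\<omega> \<in> space P" shows "finite (\<Gamma> \<omega> \<inter> tile n)"
proof -
  have "tile n \<subseteq> cball n 1"
  proof
    fix z assume "z \<in> tile n"
    then have "- 1/2 \<le> Re z - Re n" "Re z - Re n < 1/2" "- 1/2 \<le> Im z - Im n" "Im z - Im n < 1/2"
      by (auto simp: tile_eq)
    then have "\<bar>Re (z - n)\<bar> \<le> 1 / 2" "\<bar>Im (z - n)\<bar> \<le> 1 / 2"
      unfolding minus_complex.simps by linarith+
    then show "z \<in> cball n 1"
      using cmod_le[of "z - n"] by (simp add: dist_norm norm_minus_commute)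
  qed
  moreover have "finite (cball n 1 \<inter> \<Gamma> \<omega>)"
    using no_accumulation[OF assms] by (intro finite_not_islimpt_in_compact) auto
  ultimately show ?thesis by (rule_tac finite_subset[of _ "cball n 1 \<inter> \<Gamma> \<omega>"]) auto
qed

lemma flux_tile:
  assumes "\<omega> \<in> space P"
  shows "flux (\<Gamma> \<omega>) (\<alpha> \<omega>) (tile n) = ennreal (\<Sum>\<gamma>\<in>\<Gamma> \<omega> \<inter> tile n. \<alpha> \<omega> \<gamma>)"
  unfolding flux_def
  by (subst infsum_finite[OF finite_Int_tile[OF assms]], rule sum_ennreal) (use alpha_range[OF assms] in auto)

definition quiet :: "real \<Rightarrow> complex \<Rightarrow> 'w set" where
  "quiet e n = {\<omega> \<in> space P. flux (\<Gamma> \<omega>) (\<alpha> \<omega>) (tile n) < ennreal e}"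

lemma quiet_events [measurable]: "quiet e n \<in> events"
  unfolding quiet_def using flux_measurable[OF tile_sets] by measurable

lemma prob_quiet:
  assumes "n \<in> int_lattice"
  shows "prob (quiet e n) = prob (quiet e 0)"
proof -
  have 0: "0 \<in> int_lattice" by (simp add: int_lattice_def)
  let ?X = "\<lambda>n \<omega>. flux (\<Gamma> \<omega>) (\<alpha> \<omega>) (tile n)"
  have D: "distr P borel (?X n) = distr P borel (?X 0)"
    using flux_identically_distributed[of "square 0" n 0] assms 0 tile_sets[of 0]
    unfolding tile_def[symmetric] square_0[symmetric] by simp
  have "prob (quiet e m) = measure (distr P borel (?X m)) {x. x < ennreal e}" for m
    using flux_measurable[OF tile_sets]
    by (subst measure_distr) (auto simp: quiet_def vimage_def Int_def conj_commute)
  then show ?thesis using D by simp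
qed

lemma prob_quiet_Inter:
  assumes "finite J" "J \<noteq> {}" "J \<subseteq> int_lattice"
  shows "prob (\<Inter>n\<in>J. quiet e n) = prob (quiet e 0) ^ card J"
proof -
  have "indep_vars (\<lambda>_. borel) (\<lambda>n \<omega>. flux (\<Gamma> \<omega>) (\<alpha> \<omega>) (tile n)) J"
    using assms by (intro flux_indep) (auto simp: tile_def[symmetric])
  then have "prob (\<Inter>n\<in>J. (\<lambda>\<omega>. flux (\<Gamma> \<omega>) (\<alpha> \<omega>) (tile n)) -` {x. x < ennreal e} \<inter> space P) =
      (\<Prod>n\<in>J. prob ((\<lambda>\<omega>. flux (\<Gamma> \<omega>) (\<alpha> \<omega>) (tile n)) -` {x. x < ennreal e} \<inter> space P))"
    using assms by (intro indep_varsD_finite) auto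
  moreover have eq: "(\<lambda>\<omega>. flux (\<Gamma> \<omega>) (\<alpha> \<omega>) (tile n)) -` {x. x < ennreal e} \<inter> space P = quiet e n" for n
    by (auto simp: quiet_def)
  ultimately have "prob (\<Inter>n\<in>J. quiet e n) = (\<Prod>n\<in>J. prob (quiet e n))"
    unfolding eq by simp
  also have "\<dots> = (\<Prod>n\<in>J. prob (quiet e 0))"
    using assms(3) by (intro prod.cong refl prob_quiet) auto
  finally show ?thesis by simp
qed

text \<open>Independence of the block events is read off from probabilities: the blocks are
  disjoint, so a finite intersection has as its probability a power of
  \<open>prob (quiet e 0)\<close> whose exponent counts all tiles involved.\<close>

lemma AE_quiet_block:
  assumes e: "e > 0"
  shows "AE \<omega> in P. \<exists>j. \<forall>n\<in>block k j. \<omega> \<in> quiet e n"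
proof -
  define F where "F j = (\<Inter>n\<in>block k j. quiet e n)" for j
  have ne: "block k j \<noteq> {}" for j using card_block[of k j] by (auto simp del: card_eq_0_iff)
  have prob_Inter: "prob (\<Inter>j\<in>J. F j) = prob (quiet e 0) ^ (card J * (2 * k + 1)\<^sup>2)" if J: "finite J" "J \<noteq> {}" for J
  proof -
    have "(\<Inter>j\<in>J. F j) = (\<Inter>n\<in>(\<Union>j\<in>J. block k j). quiet e n)" by (auto simp: F_def)
    also have "prob \<dots> = prob (quiet e 0) ^ card (\<Union>j\<in>J. block k j)"
      using J ne block_lattice by (intro prob_quiet_Inter) (auto simp: finite_block)
    also have "card (\<Union>j\<in>J. block k j) = (\<Sum>j\<in>J. card (block k j))"
      using J block_disjoint by (intro card_UN_disjoint) (auto simp: finite_block)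
    also have "\<dots> = card J * (2 * k + 1)\<^sup>2" by (simp add: card_block)
    finally show ?thesis .
  qed
  have prob_F: "prob (F j) = prob (quiet e 0) ^ (2 * k + 1)\<^sup>2" for j
    using prob_Inter[of "{j}"] by simp
  have "F j \<in> events" for j unfolding F_def by (intro sets.finite_INT finite_block ne quiet_events)
  then have indep: "indep_events F UNIV"
    by (intro indep_eventsI) (auto simp: prob_Inter prob_F mult.commute simp flip: power_mult)
  have "0 < prob (quiet e 0)"
    using prob_flux_small_pos[OF e] by (simp add: quiet_def square_0)
  then have "AE \<omega> in P. \<exists>j. \<omega> \<in> F j"
    by (intro AE_ex_indep_events[OF indep prob_F]) simp
  then show ?thesis by (simp add: F_def)
qed

text \<open>A disc of radius k around the centre of a block is covered by the (2k + 1)^2 tiles of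
  the block, and each tile is allotted an equal share of 1/400.\<close>

lemma AE_small_flux_ball:
  "AE \<omega> in P. \<forall>k. \<exists>c. (\<Sum>\<gamma>\<in>\<Gamma> \<omega> \<inter> ball c (real k). \<alpha> \<omega> \<gamma>) \<le> 1 / 400"
  unfolding AE_all_countable
proof
  fix k
  define N :: nat where "N = (2 * k + 1)\<^sup>2"
  define e where "e = 1 / (400 * real N)"
  have N: "real N > 0" by (simp add: N_def)
  have e: "e > 0" using N by (simp add: e_def)
  show "AE \<omega> in P. \<exists>c. (\<Sum>\<gamma>\<in>\<Gamma> \<omega> \<inter> ball c (real k). \<alpha> \<omega> \<gamma>) \<le> 1 / 400"
    using AE_quiet_block[OF e, of k] AE_space
  proof eventually_elim
    case (elim \<omega>)
    then obtain j where j: "\<And>n. n \<in> block k j \<Longrightarrow> \<omega> \<in> quiet e n" by blast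
    define c where "c = Complex (of_int (int j * (2 * int k + 1))) 0"
    define S where "S = \<Gamma> \<omega> \<inter> ball c (real k)"
    \<comment> \<open>Rounding by the floor of x + 1/2 matches the half-open tiles. A coordinate of
      modulus below k relative to the centre rounds to an integer in [-k, k].\<close>
    define g where "g z = Complex (of_int \<lfloor>Re z + 1 / 2\<rfloor>) (of_int \<lfloor>Im z + 1 / 2\<rfloor>)" for z
    have g_tile: "z \<in> tile (g z)" for z
      unfolding tile_eq g_def by simp linarith
    have g_block: "g z \<in> block k j" if "z \<in> S" for z
    proof -
      have d: "cmod (z - c) < real k" using that by (simp add: S_def dist_norm norm_minus_commute)
      define p where "p = \<lfloor>Re z + 1 / 2\<rfloor> - int j * (2 * int k + 1)"
      have "\<bar>Re z - of_int (int j * (2 * int k + 1))\<bar> < real k" "\<bar>Im z\<bar> < real k"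
        using abs_Re_le_cmod[of "z - c"] abs_Im_le_cmod[of "z - c"] d by (auto simp: c_def)
      then have mem: "p \<in> {- int k..int k}" "\<lfloor>Im z + 1 / 2\<rfloor> \<in> {- int k..int k}"
        unfolding p_def by (simp_all del: of_int_mult of_int_add) linarith+
      have "g z = (\<lambda>(p, q). Complex (of_int (int j * (2 * int k + 1) + p)) (of_int q)) (p, \<lfloor>Im z + 1 / 2\<rfloor>)"
        by (simp add: g_def p_def)
      then show ?thesis unfolding block_def by (rule image_eqI) (use mem in auto)
    qed
    have fin: "finite S"
      unfolding S_def
      by (rule finite_subset[OF _ finite_not_islimpt_in_compact[of "cball c (real k)" "\<Gamma> \<omega>"]])
        (use no_accumulation elim in auto)
    have pos: "0 \<le> \<alpha> \<omega> \<gamma>" if "\<gamma> \<in> \<Gamma> \<omega>" for \<gamma> using alpha_range that elim by blast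
    have "(\<Sum>\<gamma>\<in>S. \<alpha> \<omega> \<gamma>) = (\<Sum>n\<in>block k j. \<Sum>\<gamma>\<in>{\<gamma>\<in>S. g \<gamma> = n}. \<alpha> \<omega> \<gamma>)"
      using g_block by (intro sum.group[symmetric] fin finite_block) auto
    also have "\<dots> \<le> (\<Sum>n\<in>block k j. e)"
    proof (rule sum_mono)
      fix n assume n: "n \<in> block k j"
      have "(\<Sum>\<gamma>\<in>{\<gamma>\<in>S. g \<gamma> = n}. \<alpha> \<omega> \<gamma>) \<le> (\<Sum>\<gamma>\<in>\<Gamma> \<omega> \<inter> tile n. \<alpha> \<omega> \<gamma>)"
        using elim g_tile pos by (intro sum_mono2 finite_Int_tile) (auto simp: S_def)
      moreover have "0 \<le> (\<Sum>\<gamma>\<in>\<Gamma> \<omega> \<inter> tile n. \<alpha> \<omega> \<gamma>)" using pos by (intro sum_nonneg) auto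
      moreover have "flux (\<Gamma> \<omega>) (\<alpha> \<omega>) (tile n) < ennreal e" using j[OF n] by (simp add: quiet_def)
      ultimately show "(\<Sum>\<gamma>\<in>{\<gamma>\<in>S. g \<gamma> = n}. \<alpha> \<omega> \<gamma>) \<le> e"
        using flux_tile elim by (simp add: ennreal_less_iff)
    qed
    also have "\<dots> = 1 / 400" using N by (simp add: card_block e_def N_def)
    finally show ?case unfolding S_def by blast
  qed
qed

end

theorem theorem1p3:
  fixes P :: "'w measure"
    and \<Gamma> :: "'w \<Rightarrow> complex set"
    and \<alpha> :: "'w \<Rightarrow> complex \<Rightarrow> real"
    and \<phi> :: "'w \<Rightarrow> complex \<Rightarrow> complex"
  assumes "random_flux P \<Gamma> \<alpha>"
    and "\<And>\<omega>. \<omega> \<in> space P \<Longrightarrow> has_simple_principal_parts (\<Gamma> \<omega>) (\<alpha> \<omega>) (\<phi> \<omega>)"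
  shows "AE \<omega> in P. op_spectrum lborel (delta_hamiltonian (\<Gamma> \<omega>) (\<phi> \<omega>)) = complex_of_real ` {0..}"
proof -
  interpret random_flux P \<Gamma> \<alpha> by fact
  show ?thesis
    using AE_small_flux_ball AE_space
  proof eventually_elim
    case (elim \<omega>)
    note lim = no_accumulation[OF elim(2)] and parts = assms(2)[OF elim(2)]
    interpret smooth_potential "- \<Gamma> \<omega>" "vector_potential (\<phi> \<omega>)"
      by (rule smooth_potential_vector_potential[OF lim parts])
    let ?H = "friedrichs_extension lborel (test_functions (- \<Gamma> \<omega>)) (magnetic_schroedinger (vector_potential (\<phi> \<omega>)))"
    have "complex_of_real x \<in> op_spectrum lborel ?H" if x: "x \<ge> 0" for x
    proof -
      \<comment> \<open>Momentum \<open>sqrt x\<close> along the real axis has energy x.\<close>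
      have "complex_of_real ((norm (complex_of_real (sqrt x)))\<^sup>2) \<in> op_spectrum lborel ?H"
      proof (rule approximate_plane_waves)
        fix \<delta> :: real assume \<delta>: "\<delta> > 0"
        \<comment> \<open>R^2 >= B is exactly what makes 124 pi at most \<delta>^2 times
          \<open>trial_const\<close> R^2. It holds once R > B + 1, since then both R >= 1 and R >=
          B.\<close>
        define B where "B = 124 * pi / (\<delta>\<^sup>2 * trial_const)"
        have B: "B > 0" using \<delta> trial_const_pos by (simp add: B_def)
        obtain k :: nat where k: "real k > 2 * (B + 1)" using reals_Archimedean2 by blast
        define R where "R = real k / 2"
        have R: "R > B + 1" using k by (simp add: R_def)
        have R0: "R > 0" using R B by linarith
        obtain c where "(\<Sum>\<gamma>\<in>\<Gamma> \<omega> \<inter> ball c (2 * R). \<alpha> \<omega> \<gamma>) \<le> 1 / 400"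
          using elim(1) by (auto simp: R_def)
        then obtain u where u: "u \<in> test_functions (- \<Gamma> \<omega>)" "trial_const * R\<^sup>2 \<le> (L2_norm lborel u)\<^sup>2"
          and small: "\<And>b. b \<in> Basis \<Longrightarrow> (L2_norm lborel (\<lambda>z. magnetic_deriv (vector_potential (\<phi> \<omega>)) b u z
            - of_real (of_real (sqrt x) \<bullet> b) * u z))\<^sup>2 \<le> 124 * pi"
          using trial_function[OF lim parts _ R0, of c "sqrt x"] alpha_range[OF elim(2)] by blast
        have "B \<le> R * R" using R B mult_mono[of 1 R B R] by linarith
        then have "124 * pi \<le> \<delta>\<^sup>2 * (trial_const * R\<^sup>2)"
          using \<delta> trial_const_pos by (simp add: B_def field_simps power2_eq_square)
        also have "\<dots> \<le> \<delta>\<^sup>2 * (L2_norm lborel u)\<^sup>2" by (intro mult_left_mono u) auto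
        finally have le: "124 * pi \<le> (\<delta> * L2_norm lborel u)\<^sup>2" by (simp add: power_mult_distrib)
        have "L2_norm lborel (\<lambda>z. magnetic_deriv (vector_potential (\<phi> \<omega>)) b u z - of_real (of_real (sqrt x) \<bullet> b) * u z)
            \<le> \<delta> * L2_norm lborel u" if "b \<in> Basis" for b
          by (rule power2_le_imp_le[OF order_trans[OF small[OF that] le]]) (use \<delta> in simp)
        moreover have "L2_norm lborel u > 0"
        proof -
          have "0 < trial_const * R\<^sup>2" using trial_const_pos R0 by simp
          with u(2) have "L2_norm lborel u \<noteq> 0" by auto
          then show ?thesis by (simp add: less_le)
        qed
        ultimately show "\<exists>u\<in>test_functions (- \<Gamma> \<omega>). L2_norm lborel u > 0 \<and>
            (\<forall>b\<in>Basis. L2_norm lborel (\<lambda>z. magnetic_deriv (vector_potential (\<phi> \<omega>)) b u z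
              - of_real (of_real (sqrt x) \<bullet> b) * u z) \<le> \<delta> * L2_norm lborel u)"
          using u(1) by blast
      qed
      then show ?thesis using x by simp
    qed
    moreover have "z \<in> complex_of_real ` {0..}" if "z \<in> op_spectrum lborel ?H" for z
      using resolvent_set_friedrichs[of z] that by (auto simp: op_spectrum_def)
    ultimately show ?case unfolding delta_hamiltonian_def by auto
  qed
qed

end
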